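(* Let $1<\gamma<2$ and let $\rho,u$ be a solution in the sense of distributions on $(0,T)\times\mathbb{T}^d$ of the isentropic compressible Euler system $$\partial_t(\rho u)+\operatorname{div}(\rho u\otimes u)+\nabla p(\rho)=0,\qquad \partial_t\rho+\operatorname{div}(\rho u)=0.$$ Assume $$u\in C^\alpha((0,T)\times\mathbb{T}^d),\qquad \rho,\ \rho u\in C^\beta((0,T)\times\mathbb{T}^d),\qquad 0\le\underline{\rho}\le\rho\le\overline{\rho}\ \text{ a.e. in }(0,T)\times\mathbb{T}^d,$$ for some constants $\underline{\rho},\overline{\rho}$ and $0\le\alpha,\beta\le1$ such that $$\alpha+\gamma\beta>1\qquad\text{and}\qquad2\alpha+\beta>1.$$ Assume further that $p\in C^{1,\gamma-1}([\underline{\rho},\overline{\rho}])$ and, in addition, $p'(0)=0$ as soon as $\underline{\rho}=0$. Then the energy is locally conserved, i.e. $$\partial_t\left(\tfrac12\rho|u|^2+P(\rho)\right)+\operatorname{div}\left[\left(\tfrac12\rho|u|^2+p(\rho)+P(\rho)\right)u\right]=0$$ in the sense of distributions on $(0,T)\times\mathbb{T}^d$.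
   Context: $\mathbb{T}^d$ is the $d$-dimensional torus; $u$ is the velocity, $\rho\ge0$ the density, $p=p(\rho)$ the pressure law. $\operatorname{div}$ and $\nabla$ act in the space variable. $C^\alpha((0,T)\times\mathbb{T}^d)$ denotes the space of (bounded) functions that are Hölder continuous with exponent $\alpha$ in space-time (Lipschitz if $\alpha=1$). The pressure potential is $P(\rho)=\rho\int_1^\rho\frac{p(s)}{s^2}\,ds$, with the value at $\rho=0$ understood as the limit $\rho\to0^+$; the pressure is understood to be given on an interval for which this integral makes sense. *)

theory Defs
  imports "HOL-Analysis.Analysis"
begin

text \<open>
  The torus is $R^d / Z^d$, with $d$ the cardinality of the index type. A function on
  $(0,T) \times T^d$ is represented by a function on $R \times R^d$ of which only the values on
  the strip \<open>spacetime T\<close> matter and which is 1-periodic there in every space coordinate.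
\<close>

definition spacetime :: "real \<Rightarrow> (real \<times> (real ^ 'd)) set" where
  "spacetime T = {0<..<T} \<times> UNIV"

definition space_periodic_on ::
    "(real \<times> (real ^ 'd)) set \<Rightarrow> (real \<times> (real ^ 'd) \<Rightarrow> 'b) \<Rightarrow> bool" where
  "space_periodic_on S f \<longleftrightarrow>
     (\<forall>t x i. (t, x) \<in> S \<longrightarrow> f (t, x + axis i 1) = f (t, x))"

definition fundamental_domain :: "real \<Rightarrow> (real \<times> (real ^ 'd)) set" where
  "fundamental_domain T = {0<..<T} \<times> cbox 0 (\<chi> i. 1)"

text \<open>
  Continuity is implied by the estimate unless the exponent is 0, in which case it ensures that
  the space is that of bounded continuous functions.
\<close>

definition holder_on ::
    "'a::metric_space set \<Rightarrow> real \<Rightarrow> ('a \<Rightarrow> 'b::metric_space) \<Rightarrow> bool" where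
  "holder_on S \<alpha> f \<longleftrightarrow> continuous_on S f \<and> bounded (f ` S) \<and>
     (\<exists>C. \<forall>x\<in>S. \<forall>y\<in>S. dist (f x) (f y) \<le> C * dist x y powr \<alpha>)"

text \<open>
  For a space-periodic function, the bound in terms of the distance in $R \times R^d$ is equivalent,
  with the same constant, to the bound in terms of the distance in the quotient.
\<close>

definition holder_torus ::
    "real \<Rightarrow> real \<Rightarrow> (real \<times> (real ^ 'd) \<Rightarrow> 'b::metric_space) set" where
  "holder_torus \<alpha> T = {f. space_periodic_on (spacetime T) f \<and> holder_on (spacetime T) \<alpha> f}"

text \<open>Derivatives at the end points are one-sided.\<close>

definition C1_holder_on :: "real set \<Rightarrow> real \<Rightarrow> (real \<Rightarrow> real) \<Rightarrow> bool" where
  "C1_holder_on I \<theta> p \<longleftrightarrow>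
     (\<exists>p'. (\<forall>x\<in>I. (p has_real_derivative p' x) (at x within I)) \<and> holder_on I \<theta> p')"

text \<open>
  A function is of class $C^{k+1}$ iff it is differentiable and all its directional derivatives
  are of class $C^k$.
\<close>

primrec C_k :: "nat \<Rightarrow> ('a::euclidean_space \<Rightarrow> real) \<Rightarrow> bool" where
  "C_k 0 f \<longleftrightarrow> continuous_on UNIV f"
| "C_k (Suc k) f \<longleftrightarrow> f differentiable_on UNIV \<and>
     (\<forall>v. C_k k (\<lambda>x. frechet_derivative f (at x) v))"

text \<open>
  The torus being compact, compact support in $(0,T) \times T^d$ is a condition on the times only.
\<close>

definition test_functions :: "real \<Rightarrow> (real \<times> (real ^ 'd) \<Rightarrow> real) set" where
  "test_functions T = {\<phi>. (\<forall>k. C_k k \<phi>) \<and> space_periodic_on UNIV \<phi> \<and>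
     (\<exists>a b. 0 < a \<and> b < T \<and> (\<forall>t x. t \<notin> {a..b} \<longrightarrow> \<phi> (t, x) = 0))}"

text \<open>
  Distributional derivatives, as functionals on test functions, of (the distribution given by) a
  locally integrable function.
\<close>

definition weak_deriv ::
    "real \<Rightarrow> real \<times> (real ^ 'd) \<Rightarrow> (real \<times> (real ^ 'd) \<Rightarrow> real) \<Rightarrow>
     (real \<times> (real ^ 'd) \<Rightarrow> real) \<Rightarrow> real" where
  "weak_deriv T e f \<phi> =
     - (LINT z:fundamental_domain T|lborel. f z * frechet_derivative \<phi> (at z) e)"

definition weak_dt ::
    "real \<Rightarrow> (real \<times> (real ^ 'd) \<Rightarrow> real) \<Rightarrow> (real \<times> (real ^ 'd) \<Rightarrow> real) \<Rightarrow> real" where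
  "weak_dt T = weak_deriv T (1, 0)"

definition weak_dx ::
    "real \<Rightarrow> 'd \<Rightarrow> (real \<times> (real ^ 'd) \<Rightarrow> real) \<Rightarrow> (real \<times> (real ^ 'd) \<Rightarrow> real) \<Rightarrow> real" where
  "weak_dx T i = weak_deriv T (0, axis i 1)"

definition weak_div ::
    "real \<Rightarrow> (real \<times> (real ^ 'd) \<Rightarrow> real ^ 'd) \<Rightarrow> (real \<times> (real ^ 'd) \<Rightarrow> real) \<Rightarrow> real" where
  "weak_div T F \<phi> = (\<Sum>j\<in>UNIV. weak_dx T j (\<lambda>z. F z $ j) \<phi>)"

text \<open>
  Row \<open>i\<close> of \<open>\<rho> u \<otimes> u\<close> is \<open>\<rho> u\<^sub>i u\<close>.
\<close>

definition isentropic_euler ::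
    "real \<Rightarrow> (real \<Rightarrow> real) \<Rightarrow> (real \<times> (real ^ 'd) \<Rightarrow> real) \<Rightarrow>
     (real \<times> (real ^ 'd) \<Rightarrow> real ^ 'd) \<Rightarrow> bool" where
  "isentropic_euler T p \<rho> u \<longleftrightarrow>
     (\<forall>\<phi>\<in>test_functions T.
        (\<forall>i. weak_dt T (\<lambda>z. \<rho> z * u z $ i) \<phi>
             + weak_div T (\<lambda>z. (\<rho> z * u z $ i) *\<^sub>R u z) \<phi>
             + weak_dx T i (\<lambda>z. p (\<rho> z)) \<phi> = 0) \<and>
        weak_dt T \<rho> \<phi> + weak_div T (\<lambda>z. \<rho> z *\<^sub>R u z) \<phi> = 0)"

definition pressure_potential :: "(real \<Rightarrow> real) \<Rightarrow> real \<Rightarrow> real" where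
  "pressure_potential p r =
     (if r = 0 then Lim (at_right 0) (\<lambda>r. r * (LBINT s=1..r. p s / s\<^sup>2))
      else r * (LBINT s=1..r. p s / s\<^sup>2))"

text \<open>
  The integrals defining the potential exist for all positive densities in the smallest interval
  that contains the range \<open>[lo, hi]\<close> of densities and the base point 1.
\<close>

definition potential_well_defined :: "(real \<Rightarrow> real) \<Rightarrow> real \<Rightarrow> real \<Rightarrow> bool" where
  "potential_well_defined p lo hi \<longleftrightarrow>
     (\<forall>r. 0 < r \<and> min lo 1 \<le> r \<and> r \<le> max hi 1 \<longrightarrow>
        interval_lebesgue_integrable lborel 1 r (\<lambda>s. p s / s\<^sup>2))"

definition energy_locally_conserved ::
    "real \<Rightarrow> (real \<Rightarrow> real) \<Rightarrow> (real \<times> (real ^ 'd) \<Rightarrow> real) \<Rightarrow>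
     (real \<times> (real ^ 'd) \<Rightarrow> real ^ 'd) \<Rightarrow> bool" where
  "energy_locally_conserved T p \<rho> u \<longleftrightarrow>
     (\<forall>\<phi>\<in>test_functions T.
        weak_dt T (\<lambda>z. 1 / 2 * \<rho> z * (norm (u z))\<^sup>2 + pressure_potential p (\<rho> z)) \<phi>
        + weak_div T (\<lambda>z. (1 / 2 * \<rho> z * (norm (u z))\<^sup>2 + p (\<rho> z)
                            + pressure_potential p (\<rho> z)) *\<^sub>R u z) \<phi> = 0)"

end

theory Submission
  imports Defs
begin

text \<open>
  Why the theorem holds. Let $r$, $v$, $n$ be the mollifications, in space and time at scale
  $\epsilon$, of $\rho$, $u$, $\rho u$. Testing the Euler system with translates of the mollifier
  shows that the mollified system holds pointwise away from the time boundary. For smooth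
  solutions the energy balance is the momentum equation multiplied by the velocity, rewritten
  with the mass equation and with $\rho P'(\rho) - P(\rho) = p(\rho)$. The same computation for
  $r$, $v$, $n$ (lemma \<open>energy_flux_identity\<close>) leaves an error that consists of commutators
  between mollification and nonlinearities: $n_j v_i - (\rho u_j u_i)^\epsilon$, $r v - n$,
  $p(r) - p(\rho)^\epsilon$ and $P'(r) - P'(\rho)^\epsilon$.

  Let $a$ be the oscillation of $u$ at scale $\epsilon$, of order $\epsilon^\alpha$, and $b$ that
  of $\rho$ and $\rho u$, of order $\epsilon^\beta$. A commutator of a product is bounded by the
  product of the oscillations, here $ab$; a derivative of a mollified function costs an
  oscillation over $\epsilon$ (lemmas \<open>commutator_bound\<close>, \<open>commutator_deriv_bound\<close>). Averaging
  commutes with affine functions, so the commutator of a function of class $C^{1,\gamma-1}$ with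
  $\rho$ is of order $b^\gamma$, and that of a function of class $C^{0,\gamma-1}$ is of order
  $b^{\gamma-1}$ (lemma \<open>nonlinear_commutator_bound\<close>). Every commutator stands under a
  divergence, which integration by parts moves to the other factors. The product
  $P'(r)\,{\rm div}(rv - n)$ needs more care, as $P'$ is only Hoelder continuous: for the
  part $P'(\rho)^\epsilon$ the divergence is moved to that factor, whereas $P'(r) - P'(\rho)^\epsilon$
  is small and is multiplied by a divergence of order $ab/\epsilon$. In all, the error is of order
  $a^2 b/\epsilon + a b^\gamma/\epsilon$ up to terms that tend to 0 trivially (lemmas
  \<open>energy_defect\<close>, \<open>energy_defect_limit\<close>), and the two conditions on the exponents say
  that this tends to 0.

  The pressure enters through three facts: $p$ is of class $C^{1,\gamma-1}$, so is $P$, and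
  $rP'(r) - P(r) = p(r)$. For $P$ the regularity comes from $P''(r) = p'(r)/r$ together with
  $|p'(r)| \le C r^{\gamma-1}$, which at vacuum is the place where $p'(0) = 0$ is used (lemma
  \<open>potential_C1_holder\<close>). The functions $p$ and $P$ are extended to the whole line, because
  this turns all chain rules into two-sided ones.
\<close>

section \<open>A smooth function that vanishes on a half-line\<close>

text \<open>
  The $n$-th derivative of $e^{-1/x}$ is \<open>flat_poly n\<close>, evaluated at $1/x$, times $e^{-1/x}$.
\<close>

fun flat_poly :: "nat \<Rightarrow> real poly" where
  "flat_poly 0 = 1"
| "flat_poly (Suc n) = monom 1 2 * (flat_poly n - pderiv (flat_poly n))"

definition bump_deriv :: "nat \<Rightarrow> real \<Rightarrow> real" where
  "bump_deriv n x = (if x > 0 then poly (flat_poly n) (1 / x) * exp (- 1 / x) else 0)"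

abbreviation bump :: "real \<Rightarrow> real" where "bump \<equiv> bump_deriv 0"

lemma poly_div_exp_tendsto_0:
  fixes q :: "real poly"
  shows "((\<lambda>y. poly q y / exp y) \<longlongrightarrow> 0) at_top"
proof -
  have "((\<lambda>y. \<Sum>i\<le>degree q. coeff q i * (y ^ i / exp y)) \<longlongrightarrow> (\<Sum>i\<le>degree q. coeff q i * 0)) at_top"
    by (intro tendsto_intros tendsto_power_div_exp_0)
  then show ?thesis
    by (simp add: poly_altdef sum_divide_distrib)
qed

text \<open>
  At 0 the difference quotient is $y q(y) e^{-y}$ with $y = 1/h$ and a polynomial $q$, which tends
  to 0. All derivatives vanish at 0 for this reason.
\<close>

lemma bump_deriv_has_derivative:
  "(bump_deriv n has_real_derivative bump_deriv (Suc n) x) (at x)"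
proof (cases "x = 0")
  case True
  have R: "((\<lambda>h. bump_deriv n h / h) \<longlongrightarrow> 0) (at_right 0)"
  proof -
    have "((\<lambda>h. poly (pCons 0 (flat_poly n)) (inverse h) / exp (inverse h)) \<longlongrightarrow> 0) (at_right (0::real))"
      by (rule filterlim_compose[OF poly_div_exp_tendsto_0 filterlim_inverse_at_top_right])
    moreover have "eventually (\<lambda>h. poly (pCons 0 (flat_poly n)) (inverse h) / exp (inverse h)
        = bump_deriv n h / h) (at_right (0::real))"
      using eventually_at_right_less[of "0::real"]
      by eventually_elim (simp add: bump_deriv_def exp_minus field_simps)
    ultimately show ?thesis by (rule Lim_transform_eventually)
  qed
  have L: "((\<lambda>h. bump_deriv n h / h) \<longlongrightarrow> 0) (at_left 0)"
  proof -
    have "eventually (\<lambda>h. 0 = bump_deriv n h / h) (at_left (0::real))"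
      unfolding eventually_at_left_field by (auto simp: bump_deriv_def intro!: exI[of _ "-1"])
    then show ?thesis
      by (rule Lim_transform_eventually[OF tendsto_const])
  qed
  have "((\<lambda>h. bump_deriv n h / h) \<longlongrightarrow> 0) (at 0)"
    using L R filterlim_split_at by blast
  then show ?thesis
    using True by (simp add: DERIV_def bump_deriv_def)
next
  case False
  then consider "x > 0" | "x < 0" by linarith
  then show ?thesis
  proof cases
    case 1
    have d: "((\<lambda>x. poly (flat_poly n) (1 / x) * exp (- 1 / x)) has_real_derivative bump_deriv (Suc n) x) (at x)"
      using 1 by (auto intro!: derivative_eq_intros poly_DERIV[THEN DERIV_chain2]
          simp: bump_deriv_def poly_monom power2_eq_square field_simps)
    have ev: "eventually (\<lambda>x. poly (flat_poly n) (1 / x) * exp (- 1 / x) = bump_deriv n x) (nhds x)"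
      using eventually_nhds_in_open[of "{0<..}" x] 1
      by (auto elim!: eventually_mono simp: bump_deriv_def)
    show ?thesis
      by (rule iffD1[OF DERIV_cong_ev[OF refl ev refl] d])
  next
    case 2
    have d: "((\<lambda>x. 0) has_real_derivative bump_deriv (Suc n) x) (at x)"
      using 2 by (simp add: bump_deriv_def)
    have ev: "eventually (\<lambda>x. 0 = bump_deriv n x) (nhds x)"
      using eventually_nhds_in_open[of "{..<0}" x] 2
      by (auto elim!: eventually_mono simp: bump_deriv_def)
    show ?thesis
      by (rule iffD1[OF DERIV_cong_ev[OF refl ev refl] d])
  qed
qed

lemma continuous_on_bump_deriv: "continuous_on S (bump_deriv n)"
  using bump_deriv_has_derivative
  by (meson DERIV_isCont continuous_at_imp_continuous_on)

lemma bump_nonneg: "0 \<le> bump x"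
  by (simp add: bump_deriv_def)

lemma bump_ge: "x \<ge> 1 / 2 \<Longrightarrow> exp (- 2) \<le> bump x"
  by (simp add: bump_deriv_def field_simps)

lemma bump_deriv_eq_0: "x \<le> 0 \<Longrightarrow> bump_deriv n x = 0"
  by (simp add: bump_deriv_def)

lemma bump_deriv_bounded: "\<exists>M>0. \<forall>x\<le>1. \<bar>bump_deriv n x\<bar> \<le> M"
proof -
  have "compact (bump_deriv n ` {0..1})"
    by (intro compact_continuous_image continuous_on_bump_deriv compact_Icc)
  then obtain M where M: "M > 0" "\<And>x. x \<in> {0..1} \<Longrightarrow> \<bar>bump_deriv n x\<bar> \<le> M"
    using compact_imp_bounded[of "bump_deriv n ` {0..1}"] unfolding bounded_pos by auto
  have "\<bar>bump_deriv n x\<bar> \<le> M" if "x \<le> 1" for x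
    using M(1) M(2)[of x] that bump_deriv_eq_0[of x n] by (cases "x \<ge> 0") auto
  with M(1) show ?thesis by auto
qed

lemma C_k_Suc_imp: "C_k (Suc k) f \<Longrightarrow> C_k k f"
proof (induction k arbitrary: f)
  case 0
  then show ?case by (simp add: differentiable_imp_continuous_on)
next
  case (Suc k)
  then show ?case by simp
qed

lemma C_k_const: "C_k k (\<lambda>x. c)"
  by (induction k arbitrary: c) (auto simp: frechet_derivative_const)

lemma frechet_derivative_eq:
  "(f has_derivative f') (at x) \<Longrightarrow> frechet_derivative f (at x) v = f' v"
  using frechet_derivative_at by metis

lemma C_k_add: "C_k k f \<Longrightarrow> C_k k g \<Longrightarrow> C_k k (\<lambda>x. f x + g x)"
proof (induction k arbitrary: f g)
  case (Suc k)
  then have d: "(f has_derivative frechet_derivative f (at x)) (at x)"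
    "(g has_derivative frechet_derivative g (at x)) (at x)" for x
    by (auto simp: differentiable_on_eq_differentiable_at frechet_derivative_works)
  show ?case
    using Suc by (auto simp: frechet_derivative_eq[OF has_derivative_add[OF d]]
        intro!: Suc.IH differentiable_on_add)
qed (auto intro: continuous_intros)

lemma C_k_mult: "C_k k f \<Longrightarrow> C_k k g \<Longrightarrow> C_k k (\<lambda>x. f x * g x)"
proof (induction k arbitrary: f g)
  case (Suc k)
  then have d: "(f has_derivative frechet_derivative f (at x)) (at x)"
    "(g has_derivative frechet_derivative g (at x)) (at x)" for x
    by (auto simp: differentiable_on_eq_differentiable_at frechet_derivative_works)
  show ?case
    using Suc.prems C_k_Suc_imp
    by (auto simp: frechet_derivative_eq[OF has_derivative_mult[OF d]]
        intro!: C_k_add Suc.IH differentiable_on_mult)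
qed (auto intro: continuous_intros)

lemma C_k_sum: "(\<And>i. i \<in> I \<Longrightarrow> C_k k (f i)) \<Longrightarrow> C_k k (\<lambda>x. \<Sum>i\<in>I. f i x)"
  by (induction I rule: infinite_finite_induct) (auto intro: C_k_const C_k_add)

lemma C_k_affine:
  fixes l :: "'a::euclidean_space \<Rightarrow> real"
  assumes "bounded_linear l"
  shows "C_k k (\<lambda>x. c + l x)"
proof (cases k)
  case 0
  then show ?thesis using assms by (simp add: continuous_on_add linear_continuous_on)
next
  case (Suc m)
  have D: "((\<lambda>x. c + l x) has_derivative l) (at x)" for x
    by (rule derivative_eq_intros bounded_linear_imp_has_derivative assms refl | simp)+
  then have "frechet_derivative (\<lambda>x. c + l x) (at x) = l" for x
    using frechet_derivative_at by metis
  moreover have "(\<lambda>x. c + l x) differentiable_on UNIV"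
    using D by (auto simp: differentiable_on_def differentiable_def)
  ultimately show ?thesis
    using Suc by (simp add: C_k_const)
qed

text \<open>
  The induction is on the order of differentiability, for all \<open>n\<close> at once, because the derivative of
  \<open>F n \<circ> g\<close> involves \<open>F (Suc n) \<circ> g\<close>.
\<close>

lemma C_k_compose:
  fixes g :: "'a::euclidean_space \<Rightarrow> real"
  assumes F: "\<And>n x. (F n has_real_derivative F (Suc n) x) (at x)"
    and g: "\<And>k. C_k k g"
  shows "C_k k (\<lambda>x. F n (g x))"
proof (induction k arbitrary: n)
  case 0
  have "continuous_on UNIV (F n)"
    by (meson DERIV_isCont continuous_at_imp_continuous_on F)
  then show ?case
    using g[of 0] by (auto intro: continuous_on_compose2)
next
  case (Suc k)
  have gd: "(g has_derivative frechet_derivative g (at x)) (at x)" for x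
    using g[of 1] by (simp add: differentiable_on_eq_differentiable_at frechet_derivative_works)
  have D: "((\<lambda>x. F n (g x)) has_derivative (\<lambda>v. F (Suc n) (g x) * frechet_derivative g (at x) v)) (at x)" for x
    using has_derivative_compose[OF gd, of "F n" "(*) (F (Suc n) (g x))"] F
    by (simp add: has_field_derivative_def)
  then have "frechet_derivative (\<lambda>x. F n (g x)) (at x) = (\<lambda>v. F (Suc n) (g x) * frechet_derivative g (at x) v)" for x
    using frechet_derivative_at by metis
  moreover have "(\<lambda>x. F n (g x)) differentiable_on UNIV"
    using D by (auto simp: differentiable_on_def differentiable_def)
  moreover have "C_k k (\<lambda>x. frechet_derivative g (at x) v)" for v
    using g[of "Suc k"] by simp
  ultimately show ?case
    by (simp add: C_k_mult Suc.IH)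
qed

lemma C_k_sin:
  fixes g :: "'a::euclidean_space \<Rightarrow> real"
  assumes "\<And>k. C_k k g"
  shows "C_k k (\<lambda>x. sin (g x))"
proof -
  \<comment> \<open>Differentiating a sine shifts its phase by a quarter period.\<close>
  let ?F = "\<lambda>n x. sin (x + real n * (pi / 2))"
  have "(?F n has_real_derivative ?F (Suc n) x) (at x)" for n x
    using sin_add[of "x + real n * (pi / 2)" "pi / 2"]
    by (auto intro!: derivative_eq_intros simp: algebra_simps add_divide_distrib)
  from C_k_compose[of ?F, OF this assms, of k 0] show ?thesis by simp
qed

section \<open>Directional derivatives and integration by parts\<close>

text \<open>
  Conservation laws involve derivatives in coordinate
  directions only, and for these the calculus rules are those of one real variable.
\<close>

definition has_dir_deriv :: "('a::real_normed_vector \<Rightarrow> real) \<Rightarrow> ('a \<Rightarrow> real) \<Rightarrow> 'a \<Rightarrow> bool" where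
  "has_dir_deriv f f' e \<longleftrightarrow> (\<forall>z. ((\<lambda>s. f (z + s *\<^sub>R e)) has_real_derivative f' z) (at 0))"

lemma has_dir_deriv_line:
  assumes "has_dir_deriv f f' e"
  shows "((\<lambda>s. f (z + s *\<^sub>R e)) has_real_derivative f' (z + s *\<^sub>R e)) (at s within S)"
proof -
  have "((\<lambda>r. f ((z + s *\<^sub>R e) + r *\<^sub>R e)) has_real_derivative f' (z + s *\<^sub>R e)) (at 0)"
    using assms by (simp add: has_dir_deriv_def)
  then have "((\<lambda>r. f (z + (r + s) *\<^sub>R e)) has_real_derivative f' (z + s *\<^sub>R e)) (at 0)"
    by (simp add: algebra_simps)
  then have "((\<lambda>s. f (z + s *\<^sub>R e)) has_real_derivative f' (z + s *\<^sub>R e)) (at s)"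
    using DERIV_shift[of "\<lambda>s. f (z + s *\<^sub>R e)" _ 0 s] by simp
  then show ?thesis by (rule has_field_derivative_at_within)
qed

lemma has_dir_derivD: "has_dir_deriv f f' e \<Longrightarrow> ((\<lambda>s. f (z + s *\<^sub>R e)) has_real_derivative f' z) (at 0)"
  by (simp add: has_dir_deriv_def)

lemma has_dir_deriv_const: "has_dir_deriv (\<lambda>z. c) (\<lambda>z. 0) e"
  by (simp add: has_dir_deriv_def)

lemma has_dir_deriv_add:
  "has_dir_deriv f f' e \<Longrightarrow> has_dir_deriv g g' e \<Longrightarrow> has_dir_deriv (\<lambda>z. f z + g z) (\<lambda>z. f' z + g' z) e"
  unfolding has_dir_deriv_def by (auto intro!: derivative_eq_intros)

lemma has_dir_deriv_diff:
  "has_dir_deriv f f' e \<Longrightarrow> has_dir_deriv g g' e \<Longrightarrow> has_dir_deriv (\<lambda>z. f z - g z) (\<lambda>z. f' z - g' z) e"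
  unfolding has_dir_deriv_def by (auto intro!: derivative_eq_intros)

lemma has_dir_deriv_mult:
  "has_dir_deriv f f' e \<Longrightarrow> has_dir_deriv g g' e \<Longrightarrow>
   has_dir_deriv (\<lambda>z. f z * g z) (\<lambda>z. f' z * g z + f z * g' z) e"
  unfolding has_dir_deriv_def by (auto intro!: derivative_eq_intros simp: algebra_simps)

lemma has_dir_deriv_sum:
  "(\<And>i. i \<in> I \<Longrightarrow> has_dir_deriv (f i) (f' i) e) \<Longrightarrow>
   has_dir_deriv (\<lambda>z. \<Sum>i\<in>I. f i z) (\<lambda>z. \<Sum>i\<in>I. f' i z) e"
  by (induction I rule: infinite_finite_induct) (auto intro: has_dir_deriv_const has_dir_deriv_add)

lemma has_dir_deriv_compose:
  assumes "has_dir_deriv f f' e" and "\<And>x. (Q has_real_derivative q x) (at x)"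
  shows "has_dir_deriv (\<lambda>z. Q (f z)) (\<lambda>z. q (f z) * f' z) e"
  unfolding has_dir_deriv_def
  using DERIV_chain2[OF assms(2) has_dir_derivD[OF assms(1)]] by simp

lemma has_dir_deriv_cong:
  "has_dir_deriv f f' e \<Longrightarrow> (\<And>z. f z = g z) \<Longrightarrow> (\<And>z. f' z = g' z) \<Longrightarrow> has_dir_deriv g g' e"
  unfolding has_dir_deriv_def by simp

lemma has_dir_deriv_of_differentiable:
  fixes f :: "'a::euclidean_space \<Rightarrow> real"
  assumes "f differentiable_on UNIV"
  shows "has_dir_deriv f (\<lambda>z. frechet_derivative f (at z) e) e"
  unfolding has_dir_deriv_def
proof
  fix z
  have D: "(f has_derivative frechet_derivative f (at z)) (at z)"
    using assms by (simp add: differentiable_on_eq_differentiable_at frechet_derivative_works)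
  have "((\<lambda>s. z + s *\<^sub>R e) has_derivative (\<lambda>s. s *\<^sub>R e)) (at 0)"
    by (auto intro!: derivative_eq_intros)
  from has_derivative_compose[OF this, of f "frechet_derivative f (at z)"] D
  have "((\<lambda>s. f (z + s *\<^sub>R e)) has_derivative (\<lambda>s. frechet_derivative f (at z) (s *\<^sub>R e))) (at 0)"
    by simp
  moreover have "frechet_derivative f (at z) (s *\<^sub>R e) = frechet_derivative f (at z) e * s" for s
    using linear_cmul[OF has_derivative_linear[OF D]] by simp
  ultimately show "((\<lambda>s. f (z + s *\<^sub>R e)) has_real_derivative frechet_derivative f (at z) e) (at 0)"
    by (simp add: has_field_derivative_def)
qed

lemma integral_shift_cbox:
  fixes f :: "'a::euclidean_space \<Rightarrow> real"
  shows "integral (cbox a b) (\<lambda>z. f (z + c)) = integral (cbox (a + c) (b + c)) f"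
proof (cases "f integrable_on cbox (a + c) (b + c)")
  case True
  then have "((f \<circ> (+) c) has_integral integral (cbox (a + c) (b + c)) f) (cbox a b)"
    by (simp add: has_integral_shift_cbox_iff integrable_integral)
  then show ?thesis
    by (simp add: o_def add.commute integral_unique)
next
  case False
  then have "\<not> (f \<circ> (+) c) integrable_on cbox a b"
    by (simp add: integrable_on_shift_cbox)
  then show ?thesis
    using False by (simp add: o_def add.commute not_integrable_integral)
qed

text \<open>
  Translating the box by \<open>h\<close> in direction \<open>e\<close> removes a slab at one face and adds one at the
  opposite face, and both carry the same integral. Since the hypothesis compares \<open>g\<close> on these slabs
  only, it covers functions that are periodic in direction \<open>e\<close> as well as functions that vanish
  near both faces.
\<close>

lemma integral_shift_periodic:
  fixes g :: "'a::euclidean_space \<Rightarrow> real"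
  assumes e: "e \<in> Basis" and cont: "continuous_on UNIV g"
    and h: "0 \<le> h" "h \<le> (b - a) \<bullet> e"
    and per: "\<And>z. a \<bullet> e \<le> z \<bullet> e \<Longrightarrow> z \<bullet> e \<le> a \<bullet> e + h \<Longrightarrow> g (z + ((b - a) \<bullet> e) *\<^sub>R e) = g z"
  shows "integral (cbox a b) (\<lambda>z. g (z + h *\<^sub>R e)) = integral (cbox a b) g"
proof -
  define L where "L = (b - a) \<bullet> e"
  have int: "g integrable_on cbox x y" for x y
    using cont by (intro integrable_continuous) (auto intro: continuous_on_subset)
  have ie: "i \<bullet> e = (if i = e then 1 else 0)" "e \<bullet> i = (if i = e then 1 else 0)" if "i \<in> Basis" for i
    using e that by (auto simp: inner_Basis)
  have ge: "z \<bullet> e \<ge> a \<bullet> e + h" if "z \<in> cbox (a + h *\<^sub>R e) w" for z w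
    using that e by (auto simp: mem_box algebra_simps)
  have "integral (cbox a b) (\<lambda>z. g (z + h *\<^sub>R e)) = integral (cbox (a + h *\<^sub>R e) (b + h *\<^sub>R e)) g"
    by (rule integral_shift_cbox)
  \<comment> \<open>The slab beyond the original box is split off and moved back by the length of the box.\<close>
  also have "\<dots> = integral (cbox (a + h *\<^sub>R e) (b + h *\<^sub>R e) \<inter> {z. z \<bullet> e \<le> b \<bullet> e}) g +
      integral (cbox (a + h *\<^sub>R e) (b + h *\<^sub>R e) \<inter> {z. z \<bullet> e \<ge> b \<bullet> e}) g"
    by (rule integral_split[OF int e])
  also have "cbox (a + h *\<^sub>R e) (b + h *\<^sub>R e) \<inter> {z. z \<bullet> e \<le> b \<bullet> e} = cbox a b \<inter> {z. z \<bullet> e \<ge> a \<bullet> e + h}"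
  proof -
    have "z \<in> cbox (a + h *\<^sub>R e) (b + h *\<^sub>R e) \<and> z \<bullet> e \<le> b \<bullet> e \<longleftrightarrow> z \<in> cbox a b \<and> z \<bullet> e \<ge> a \<bullet> e + h" for z
    proof -
      have "(\<forall>i\<in>Basis. (a + h *\<^sub>R e) \<bullet> i \<le> z \<bullet> i \<and> z \<bullet> i \<le> (b + h *\<^sub>R e) \<bullet> i) \<and> z \<bullet> e \<le> b \<bullet> e \<longleftrightarrow>
         (\<forall>i\<in>Basis-{e}. a \<bullet> i \<le> z \<bullet> i \<and> z \<bullet> i \<le> b \<bullet> i) \<and> a \<bullet> e + h \<le> z \<bullet> e \<and> z \<bullet> e \<le> b \<bullet> e"
        using e h(1) by (auto simp: inner_add_left ie)
      moreover have "(\<forall>i\<in>Basis. a \<bullet> i \<le> z \<bullet> i \<and> z \<bullet> i \<le> b \<bullet> i) \<and> z \<bullet> e \<ge> a \<bullet> e + h \<longleftrightarrow>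
         (\<forall>i\<in>Basis-{e}. a \<bullet> i \<le> z \<bullet> i \<and> z \<bullet> i \<le> b \<bullet> i) \<and> a \<bullet> e + h \<le> z \<bullet> e \<and> z \<bullet> e \<le> b \<bullet> e"
        using e h(1) by auto
      ultimately show ?thesis by (simp add: mem_box)
    qed
    then show ?thesis by auto
  qed
  also have "cbox (a + h *\<^sub>R e) (b + h *\<^sub>R e) \<inter> {z. z \<bullet> e \<ge> b \<bullet> e} =
     cbox (a + L *\<^sub>R e) (b + h *\<^sub>R e)"
  proof -
    have "z \<in> cbox (a + h *\<^sub>R e) (b + h *\<^sub>R e) \<and> z \<bullet> e \<ge> b \<bullet> e \<longleftrightarrow> z \<in> cbox (a + L *\<^sub>R e) (b + h *\<^sub>R e)" for z
    proof -
      have "(\<forall>i\<in>Basis. (a + h *\<^sub>R e) \<bullet> i \<le> z \<bullet> i \<and> z \<bullet> i \<le> (b + h *\<^sub>R e) \<bullet> i) \<and> z \<bullet> e \<ge> b \<bullet> e \<longleftrightarrow>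
         (\<forall>i\<in>Basis-{e}. a \<bullet> i \<le> z \<bullet> i \<and> z \<bullet> i \<le> b \<bullet> i) \<and> b \<bullet> e \<le> z \<bullet> e \<and> z \<bullet> e \<le> b \<bullet> e + h"
        using e h(2) by (auto simp: inner_add_left inner_diff_left ie)
      moreover have "(\<forall>i\<in>Basis. (a + L *\<^sub>R e) \<bullet> i \<le> z \<bullet> i \<and> z \<bullet> i \<le> (b + h *\<^sub>R e) \<bullet> i) \<longleftrightarrow>
         (\<forall>i\<in>Basis-{e}. a \<bullet> i \<le> z \<bullet> i \<and> z \<bullet> i \<le> b \<bullet> i) \<and> b \<bullet> e \<le> z \<bullet> e \<and> z \<bullet> e \<le> b \<bullet> e + h"
        using e by (auto simp: inner_add_left inner_diff_left ie L_def)
      ultimately show ?thesis by (simp add: mem_box)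
    qed
    then show ?thesis by auto
  qed
  also have "cbox (a + L *\<^sub>R e) (b + h *\<^sub>R e) = cbox (a + L *\<^sub>R e) ((b + (h - L) *\<^sub>R e) + L *\<^sub>R e)"
    by (simp add: algebra_simps)
  also have "integral \<dots> g = integral (cbox a (b + (h - L) *\<^sub>R e)) (\<lambda>z. g (z + L *\<^sub>R e))"
    by (rule integral_shift_cbox[symmetric])
  also have "cbox a (b + (h - L) *\<^sub>R e) = cbox a b \<inter> {z. z \<bullet> e \<le> a \<bullet> e + h}"
  proof -
    have "z \<in> cbox a (b + (h - L) *\<^sub>R e) \<longleftrightarrow> z \<in> cbox a b \<and> z \<bullet> e \<le> a \<bullet> e + h" for z
    proof -
      have "(\<forall>i\<in>Basis. a \<bullet> i \<le> z \<bullet> i \<and> z \<bullet> i \<le> (b + (h - L) *\<^sub>R e) \<bullet> i) \<longleftrightarrow>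
         (\<forall>i\<in>Basis-{e}. a \<bullet> i \<le> z \<bullet> i \<and> z \<bullet> i \<le> b \<bullet> i) \<and> a \<bullet> e \<le> z \<bullet> e \<and> z \<bullet> e \<le> a \<bullet> e + h"
        using e by (auto simp: inner_add_left inner_diff_left ie L_def)
      moreover have "(\<forall>i\<in>Basis. a \<bullet> i \<le> z \<bullet> i \<and> z \<bullet> i \<le> b \<bullet> i) \<and> z \<bullet> e \<le> a \<bullet> e + h \<longleftrightarrow>
         (\<forall>i\<in>Basis-{e}. a \<bullet> i \<le> z \<bullet> i \<and> z \<bullet> i \<le> b \<bullet> i) \<and> a \<bullet> e \<le> z \<bullet> e \<and> z \<bullet> e \<le> a \<bullet> e + h"
        using e h(2) by (auto simp: inner_diff_left)
      ultimately show ?thesis by (simp add: mem_box)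
    qed
    then show ?thesis by auto
  qed
  also have "integral (cbox a b \<inter> {z. z \<bullet> e \<le> a \<bullet> e + h}) (\<lambda>z. g (z + L *\<^sub>R e)) =
     integral (cbox a b \<inter> {z. z \<bullet> e \<le> a \<bullet> e + h}) g"
    using e by (intro integral_cong per[folded L_def]) (auto simp: mem_box)
  finally show ?thesis
    using integral_split[OF int e, of a b "a \<bullet> e + h"] by simp
qed

text \<open>
  The integrals of small translates of \<open>g\<close> agree; differentiating under the integral sign with
  respect to the translation gives the claim. Applied to a product it is integration by parts without
  boundary terms.
\<close>

lemma integral_dir_deriv_eq_0:
  fixes g :: "'a::euclidean_space \<Rightarrow> real"
  assumes e: "e \<in> Basis" and g: "has_dir_deriv g g' e"
    and cont: "continuous_on UNIV g" "continuous_on UNIV g'"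
    and h: "0 < h" "h \<le> (b - a) \<bullet> e"
    and per: "\<And>z. a \<bullet> e \<le> z \<bullet> e \<Longrightarrow> z \<bullet> e \<le> a \<bullet> e + h \<Longrightarrow> g (z + ((b - a) \<bullet> e) *\<^sub>R e) = g z"
  shows "integral (cbox a b) g' = 0"
proof -
  let ?G = "\<lambda>s. integral (cbox a b) (\<lambda>z. g (z + s *\<^sub>R e))"
  have "(?G has_real_derivative integral (cbox a b) (\<lambda>z. g' (z + 0 *\<^sub>R e))) (at 0 within {0..h})"
  proof (rule leibniz_rule_field_derivative[where U="{0..h}"])
    show "((\<lambda>s. g (z + s *\<^sub>R e)) has_real_derivative g' (z + s *\<^sub>R e)) (at s within {0..h})" for s z
      by (rule has_dir_deriv_line[OF g])
    show "(\<lambda>z. g (z + s *\<^sub>R e)) integrable_on cbox a b" for s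
      by (intro integrable_continuous continuous_on_compose2[OF cont(1)] continuous_intros) auto
    show "continuous_on ({0..h} \<times> cbox a b) (\<lambda>(s, z). g' (z + s *\<^sub>R e))"
      unfolding split_beta by (intro continuous_on_compose2[OF cont(2)] continuous_intros) auto
  qed (use h in auto)
  moreover have "?G s = ?G 0" if "s \<in> {0..h}" for s
    using integral_shift_periodic[OF e cont(1), of s b a] that h per by auto
  then have "(?G has_real_derivative 0) (at 0 within {0..h})"
    using h by (intro has_field_derivative_transform_within[OF DERIV_const[of "?G 0"] zero_less_one]) auto
  moreover have "at (0::real) within {0..h} \<noteq> bot"
    using h by (simp add: at_within_Icc_at_right trivial_limit_at_right_real)
  ultimately show ?thesis
    using has_field_derivative_unique by fastforce
qed

section \<open>A mollifier on the torus\<close>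

text \<open>
  The index \<open>None\<close> stands for time and \<open>Some j\<close> for the \<open>j\<close>-th space coordinate, so that a
  space-time divergence is a sum over \<open>'d option\<close>.
\<close>

definition st_dir :: "'d option \<Rightarrow> real \<times> (real ^ 'd)" where
  "st_dir e = (case e of None \<Rightarrow> (1, 0) | Some j \<Rightarrow> (0, axis j 1))"

lemma st_dir_simps [simp]: "st_dir None = (1, 0)" "st_dir (Some j) = (0, axis j 1)"
  by (simp_all add: st_dir_def)

lemma st_dir_in_Basis: "st_dir e \<in> Basis"
  by (cases e) (auto simp: Basis_prod_def axis_in_Basis_iff)

text \<open>
  A smooth function, periodic in space, that is comparable with the squared distance to the lattice
  of space periods as long as it is small.
\<close>

definition torus_norm_sq :: "real \<times> (real ^ 'd) \<Rightarrow> real" where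
  "torus_norm_sq z = (fst z)\<^sup>2 + (\<Sum>i\<in>UNIV. (sin (pi * snd z $ i))\<^sup>2)"

definition torus_norm_sq_deriv :: "'d option \<Rightarrow> real \<times> (real ^ 'd) \<Rightarrow> real" where
  "torus_norm_sq_deriv e z = (case e of None \<Rightarrow> 2 * fst z
     | Some j \<Rightarrow> 2 * pi * sin (pi * snd z $ j) * cos (pi * snd z $ j))"

text \<open>
  The mollifier is periodic in space by construction, so that its translates are test functions on the
  torus. It is not normalised.
\<close>

definition mollifier :: "real \<Rightarrow> real \<times> (real ^ 'd) \<Rightarrow> real" where
  "mollifier \<epsilon> z = bump (1 - torus_norm_sq z / \<epsilon>\<^sup>2)"

definition mollifier_deriv :: "real \<Rightarrow> 'd option \<Rightarrow> real \<times> (real ^ 'd) \<Rightarrow> real" where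
  "mollifier_deriv \<epsilon> e z =
     - bump_deriv 1 (1 - torus_norm_sq z / \<epsilon>\<^sup>2) * torus_norm_sq_deriv e z / \<epsilon>\<^sup>2"

lemma torus_norm_sq_has_dir_deriv:
  "has_dir_deriv torus_norm_sq (torus_norm_sq_deriv e) (st_dir e)"
proof (cases e)
  case None
  then show ?thesis
    unfolding has_dir_deriv_def torus_norm_sq_def torus_norm_sq_deriv_def
    by (auto intro!: derivative_eq_intros)
next
  case (Some j)
  have "((\<lambda>s. \<Sum>i\<in>UNIV. (sin (pi * (x $ i + s * axis j 1 $ i)))\<^sup>2) has_real_derivative
      (\<Sum>i\<in>UNIV. 2 * sin (pi * x $ i) * cos (pi * x $ i) * pi * axis j 1 $ i)) (at 0)" for x :: "real ^ 'a"
    by (auto intro!: derivative_eq_intros sum.cong)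
  moreover have "(\<Sum>i\<in>UNIV. 2 * sin (pi * x $ i) * cos (pi * x $ i) * pi * axis j 1 $ i)
      = 2 * pi * sin (pi * x $ j) * cos (pi * x $ j)" for x :: "real ^ 'a"
    by (simp add: axis_def if_distrib[of "(*) _"] sum.delta' cong: if_cong)
  ultimately have "((\<lambda>s. t\<^sup>2 + (\<Sum>i\<in>UNIV. (sin (pi * (x $ i + s * axis j 1 $ i)))\<^sup>2)) has_real_derivative
      0 + 2 * pi * sin (pi * x $ j) * cos (pi * x $ j)) (at 0)" for t and x :: "real ^ 'a"
    by (intro DERIV_add DERIV_const) auto
  then show ?thesis
    using Some unfolding has_dir_deriv_def torus_norm_sq_def torus_norm_sq_deriv_def
    by auto
qed

lemma mollifier_has_dir_deriv: "has_dir_deriv (mollifier \<epsilon>) (mollifier_deriv \<epsilon> e) (st_dir e)"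
proof -
  have "((\<lambda>r. bump (1 - r / \<epsilon>\<^sup>2)) has_real_derivative - bump_deriv 1 (1 - r / \<epsilon>\<^sup>2) / \<epsilon>\<^sup>2) (at r)" for r
  proof -
    have "((\<lambda>r. 1 - r / \<epsilon>\<^sup>2) has_real_derivative - (1 / \<epsilon>\<^sup>2)) (at r)"
      unfolding divide_inverse by (auto intro!: derivative_eq_intros)
    from DERIV_chain2[OF bump_deriv_has_derivative[of 0] this] show ?thesis by simp
  qed
  from has_dir_deriv_compose[OF torus_norm_sq_has_dir_deriv this]
  show ?thesis by (rule has_dir_deriv_cong) (auto simp: mollifier_def mollifier_deriv_def)
qed

lemma continuous_torus_norm_sq: "continuous_on S torus_norm_sq"
  unfolding torus_norm_sq_def by (intro continuous_intros)

lemma continuous_mollifier: "continuous_on S (mollifier \<epsilon>)"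
  unfolding mollifier_def divide_inverse
  by (intro continuous_on_compose2[OF continuous_on_bump_deriv[of UNIV]] continuous_intros
      continuous_torus_norm_sq) auto

lemma continuous_mollifier_deriv: "continuous_on S (mollifier_deriv \<epsilon> e)"
proof -
  have "continuous_on S (torus_norm_sq_deriv e)"
    unfolding torus_norm_sq_deriv_def by (cases e) (auto intro!: continuous_intros)
  then show ?thesis
    unfolding mollifier_deriv_def divide_inverse
    by (intro continuous_on_compose2[OF continuous_on_bump_deriv[of UNIV]] continuous_intros
        continuous_torus_norm_sq) auto
qed

lemma torus_norm_sq_periodic: "torus_norm_sq (t, x + axis i 1) = torus_norm_sq (t, x)"
proof -
  have "(sin (pi * (x $ j + axis i 1 $ j)))\<^sup>2 = (sin (pi * x $ j))\<^sup>2" for j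
    by (cases "i = j") (simp_all add: axis_def ring_distribs)
  then show ?thesis by (simp add: torus_norm_sq_def)
qed

lemma torus_norm_sq_deriv_periodic:
  "torus_norm_sq_deriv e (t, x + axis i 1) = torus_norm_sq_deriv e (t, x)"
proof (cases e)
  case (Some j)
  then show ?thesis
    by (cases "i = j") (simp_all add: torus_norm_sq_deriv_def axis_def ring_distribs)
qed (simp add: torus_norm_sq_deriv_def)

lemma mollifier_periodic: "mollifier \<epsilon> (t, x + axis i 1) = mollifier \<epsilon> (t, x)"
  by (simp add: mollifier_def torus_norm_sq_periodic)

lemma mollifier_deriv_periodic: "mollifier_deriv \<epsilon> e (t, x + axis i 1) = mollifier_deriv \<epsilon> e (t, x)"
  by (simp add: mollifier_deriv_def torus_norm_sq_periodic torus_norm_sq_deriv_periodic)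

lemma mollifier_support:
  assumes "\<epsilon> > 0" "torus_norm_sq z \<ge> \<epsilon>\<^sup>2"
  shows "mollifier \<epsilon> z = 0" "mollifier_deriv \<epsilon> e z = 0"
proof -
  have "1 - torus_norm_sq z / \<epsilon>\<^sup>2 \<le> 0" using assms by simp
  then show "mollifier \<epsilon> z = 0" "mollifier_deriv \<epsilon> e z = 0"
    by (simp_all add: mollifier_def mollifier_deriv_def bump_deriv_eq_0)
qed

lemma torus_norm_sq_ge:
  "(fst z)\<^sup>2 \<le> torus_norm_sq z" "(sin (pi * snd z $ i))\<^sup>2 \<le> torus_norm_sq z"
proof -
  show "(fst z)\<^sup>2 \<le> torus_norm_sq z" by (simp add: torus_norm_sq_def sum_nonneg)
  have "(sin (pi * snd z $ i))\<^sup>2 \<le> (\<Sum>i\<in>UNIV. (sin (pi * snd z $ i))\<^sup>2)"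
    by (rule member_le_sum) auto
  then show "(sin (pi * snd z $ i))\<^sup>2 \<le> torus_norm_sq z"
    by (simp add: torus_norm_sq_def add_increasing)
qed

lemma torus_norm_sq_less:
  assumes "torus_norm_sq z < \<epsilon>\<^sup>2" "\<epsilon> > 0"
  shows "\<bar>fst z\<bar> < \<epsilon>" "\<bar>sin (pi * snd z $ i)\<bar> < \<epsilon>"
  using torus_norm_sq_ge[of z] assms
  by (metis abs_le_square_iff abs_of_pos not_le order.strict_trans1 power2_abs)+

lemma mollifier_nonneg: "0 \<le> mollifier \<epsilon> z"
  by (simp add: mollifier_def bump_nonneg)

lemma torus_norm_sq_nonneg: "0 \<le> torus_norm_sq z"
  by (simp add: torus_norm_sq_def sum_nonneg)

text \<open>
  On the support of the mollifier the derivative of \<open>torus_norm_sq\<close> is at most of order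
  \<open>\<epsilon>\<close>, which cancels one of the two factors \<open>1 / \<epsilon>\<close>.
\<close>

lemma mollifier_deriv_bound:
  "\<exists>M>0. \<forall>\<epsilon>>0. \<forall>e. \<forall>z::real \<times> (real ^ 'd). \<bar>mollifier_deriv \<epsilon> e z\<bar> \<le> M / \<epsilon>"
proof -
  obtain M where M: "M > 0" "\<And>x. x \<le> 1 \<Longrightarrow> \<bar>bump_deriv 1 x\<bar> \<le> M"
    using bump_deriv_bounded by blast
  have "\<bar>mollifier_deriv \<epsilon> e z\<bar> \<le> 2 * pi * M / \<epsilon>" if \<epsilon>: "\<epsilon> > 0" for \<epsilon> e and z :: "real \<times> (real ^ 'd)"
  proof (cases "torus_norm_sq z < \<epsilon>\<^sup>2")
    case True
    have "\<bar>torus_norm_sq_deriv e z\<bar> \<le> 2 * pi * \<epsilon>"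
    proof (cases e)
      case None
      have "\<bar>fst z\<bar> * 1 \<le> \<epsilon> * pi"
        using torus_norm_sq_less(1)[OF True \<epsilon>] pi_gt3 by (intro mult_mono) auto
      with None show ?thesis by (simp add: torus_norm_sq_deriv_def abs_mult mult_ac)
    next
      case (Some j)
      have "\<bar>sin (pi * snd z $ j)\<bar> * \<bar>cos (pi * snd z $ j)\<bar> \<le> \<epsilon> * 1"
        using torus_norm_sq_less(2)[OF True \<epsilon>, of j] by (intro mult_mono) auto
      with Some show ?thesis by (simp add: torus_norm_sq_deriv_def abs_mult)
    qed
    moreover have "\<bar>bump_deriv 1 (1 - torus_norm_sq z / \<epsilon>\<^sup>2)\<bar> \<le> M"
      by (rule M) (simp add: torus_norm_sq_nonneg)
    ultimately have "\<bar>bump_deriv 1 (1 - torus_norm_sq z / \<epsilon>\<^sup>2)\<bar> * \<bar>torus_norm_sq_deriv e z\<bar> / \<epsilon>\<^sup>2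
        \<le> M * (2 * pi * \<epsilon>) / \<epsilon>\<^sup>2"
      using M(1) by (intro divide_right_mono mult_mono) auto
    then show ?thesis
      using \<epsilon> by (simp add: mollifier_deriv_def abs_mult power2_eq_square mult_ac)
  next
    case False
    then show ?thesis using mollifier_support(2)[OF \<epsilon>, of z e] M(1) \<epsilon> by (simp add: not_less)
  qed
  with M(1) show ?thesis by (intro exI[of _ "2 * pi * M"]) auto
qed

lemma C_k_torus_norm_sq: "C_k k (\<lambda>w. torus_norm_sq (z - w))"
proof -
  have t: "C_k k (\<lambda>w. fst (z - w))" for k
    using C_k_affine[of "\<lambda>w. - fst w" k "fst z"] by (simp add: bounded_linear_fst bounded_linear_minus)
  have x: "C_k k (\<lambda>w. pi * snd (z - w) $ i)" for k i
  proof -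
    have "bounded_linear (\<lambda>w. - pi * (snd w $ i) :: real)"
      by (intro bounded_linear_const_mult bounded_linear_compose[OF bounded_linear_vec_nth bounded_linear_snd])
    from C_k_affine[OF this, of k "pi * snd z $ i"] show ?thesis by (simp add: algebra_simps)
  qed
  show ?thesis
    unfolding torus_norm_sq_def power2_eq_square
    by (intro C_k_add C_k_mult C_k_sum t C_k_sin x)
qed

lemma C_k_mollifier: "C_k k (\<lambda>w. mollifier \<epsilon> (z - w))"
proof -
  have "C_k k (\<lambda>w. 1 + (- 1 / \<epsilon>\<^sup>2) * torus_norm_sq (z - w))" for k
    by (intro C_k_add C_k_mult C_k_const C_k_torus_norm_sq)
  then have "C_k k (\<lambda>w. 1 - torus_norm_sq (z - w) / \<epsilon>\<^sup>2)" for k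
    by simp
  from C_k_compose[of bump_deriv, OF bump_deriv_has_derivative this, of k 0]
  show ?thesis by (simp add: mollifier_def)
qed

lemma frechet_derivative_mollifier:
  "frechet_derivative (\<lambda>w. mollifier \<epsilon> (z - w)) (at w) (st_dir e) = - mollifier_deriv \<epsilon> e (z - w)"
proof -
  have "(\<lambda>w. mollifier \<epsilon> (z - w)) differentiable_on UNIV"
    using C_k_mollifier[of 1 \<epsilon> z] by simp
  from has_dir_derivD[OF has_dir_deriv_of_differentiable[OF this]]
  have "((\<lambda>s. mollifier \<epsilon> (z - (w + s *\<^sub>R st_dir e))) has_real_derivative
      frechet_derivative (\<lambda>w. mollifier \<epsilon> (z - w)) (at w) (st_dir e)) (at 0)" .
  moreover have "((\<lambda>s. mollifier \<epsilon> ((z - w) + (- s) *\<^sub>R st_dir e)) has_real_derivative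
      - mollifier_deriv \<epsilon> e (z - w)) (at 0)"
  proof -
    have "((\<lambda>s::real. - s) has_real_derivative - 1) (at 0)"
      by (auto intro!: derivative_eq_intros)
    from DERIV_chain2[of "\<lambda>s. mollifier \<epsilon> ((z - w) + s *\<^sub>R st_dir e)", OF _ this]
    show ?thesis
      using has_dir_derivD[OF mollifier_has_dir_deriv, of \<epsilon> "z - w" e] by simp
  qed
  ultimately show ?thesis
    by (simp add: algebra_simps) (metis DERIV_unique)
qed

text \<open>
  A weak form of Jordan's inequality. It bounds the distance to the lattice by \<open>torus_norm_sq\<close>.
\<close>

lemma abs_le_abs_sin_pi:
  assumes "\<bar>r\<bar> \<le> 1 / 2"
  shows "\<bar>r\<bar> \<le> \<bar>sin (pi * r)\<bar>"
proof -
  have *: "r \<le> sin (pi * r)" if r: "0 < r" "r \<le> 1 / 2" for r :: real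
  proof -
    \<comment> \<open>Halving the angle gives an interval on which the cosine is bounded below by $\cos(\pi/4)$; then
      $\sin(2y) = 2 \sin y \cos y \ge 2 y \cos^2(\pi/4) = y$.\<close>
    define y where "y = pi * r / 2"
    have y: "0 < y" "y \<le> pi / 4" using r by (auto simp: y_def)
    obtain \<xi> where \<xi>: "0 < \<xi>" "\<xi> < y" "sin y - sin 0 = (y - 0) * cos \<xi>"
      using MVT2[of 0 y sin cos] y by (auto intro!: derivative_eq_intros)
    have c: "cos (pi / 4) \<le> cos \<xi>" "cos (pi / 4) \<le> cos y"
      using \<xi> y by (auto intro!: cos_monotone_0_pi_le)
    have c0: "0 < cos (pi / 4)" by (intro cos_gt_zero_pi) auto
    have "y * cos (pi / 4) * cos (pi / 4) \<le> sin y * cos y"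
      using \<xi> y c c0 by (intro mult_mono) auto
    moreover have "cos (pi / 4) * cos (pi / 4) = (1 / 2 :: real)"
      by (simp add: cos_45)
    ultimately have "y / 2 \<le> sin y * cos y" by (simp add: mult.assoc)
    moreover have "sin (pi * r) = 2 * (sin y * cos y)"
      using sin_double[of y] by (simp add: y_def)
    moreover have "r \<le> y" using r pi_gt3 by (simp add: y_def field_simps)
    ultimately show ?thesis by linarith
  qed
  show ?thesis
  proof (cases r "0::real" rule: linorder_cases)
    case less
    then show ?thesis using *[of "- r"] assms by auto
  next
    case greater
    then show ?thesis using *[of r] assms by auto
  qed auto
qed

section \<open>Mass of the mollifier\<close>

text \<open>
  A fundamental domain of the torus times $[\delta, T - \delta]$. Mollification integrates over
  \<open>core \<delta> T\<close>; estimates are made at points of the smaller set \<open>core (2 * \<delta>) T\<close>, from which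
  the mollifier does not reach the time boundary of the larger one.
\<close>

definition core :: "real \<Rightarrow> real \<Rightarrow> (real \<times> (real ^ 'd)) set" where
  "core \<delta> T = cbox (\<delta>, 0) (T - \<delta>, \<chi> i. 1)"

lemma mem_core:
  "z \<in> core \<delta> T \<longleftrightarrow> \<delta> \<le> fst z \<and> fst z \<le> T - \<delta> \<and> (\<forall>i. 0 \<le> snd z $ i \<and> snd z $ i \<le> 1)"
  by (cases z) (simp add: core_def cbox_Pair_eq mem_box_cart)

definition centre :: "real \<Rightarrow> real \<times> (real ^ 'd)" where
  "centre T = (T / 2, \<chi> i. 1 / 2)"

definition cube :: "real \<Rightarrow> real \<Rightarrow> (real \<times> (real ^ 'd)) set" where
  "cube T h = cbox (T / 2 - h, \<chi> i. 1 / 2 - h) (T / 2 + h, \<chi> i. 1 / 2 + h)"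

lemma mem_cube:
  "w \<in> cube T h \<longleftrightarrow> \<bar>fst (centre T - w)\<bar> \<le> h \<and> (\<forall>i. \<bar>snd (centre T - w) $ i\<bar> \<le> h)"
proof -
  have "\<bar>c - y\<bar> \<le> h \<longleftrightarrow> c - h \<le> y \<and> y \<le> c + h" for c y :: real
    by linarith
  then show ?thesis
    by (cases w) (simp add: cube_def centre_def cbox_Pair_eq mem_box_cart)
qed

lemma content_cube:
  assumes "h \<ge> 0"
  shows "measure lborel (cube T h :: (real \<times> (real ^ 'd)) set) = (2 * h) ^ (CARD('d) + 1)"
proof -
  have "((T / 2 + h, \<chi> i. 1 / 2 + h) - (T / 2 - h, \<chi> i. 1 / 2 - h)) \<bullet> b = 2 * h"
    if "b \<in> Basis" for b :: "real \<times> (real ^ 'd)"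
    using that by (auto simp: Basis_prod_def Basis_vec_def inner_axis)
  moreover from this have "(T / 2 - h, \<chi> i. 1 / 2 - h) \<bullet> b \<le> (T / 2 + h, \<chi> i. 1 / 2 + h) \<bullet> b"
    if "b \<in> Basis" for b :: "real \<times> (real ^ 'd)"
    using that assms by (metis diff_ge_0_iff_ge inner_diff_left mult_nonneg_nonneg zero_le_numeral)
  ultimately have "measure lborel (cube T h :: (real \<times> (real ^ 'd)) set) =
      (\<Prod>b\<in>(Basis :: (real \<times> (real ^ 'd)) set). 2 * h)"
    unfolding cube_def by (subst content_cbox) (auto simp only: inner_diff_left intro!: prod.cong)
  then show ?thesis by (simp add: add.commute)
qed

text \<open>
  \<open>M0\<close> is a constant as in lemma \<open>mollifier_deriv_bound\<close>, and thus independent of the scale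
  \<open>\<epsilon>\<close>.
\<close>

locale smoothing =
  fixes T \<delta> \<epsilon> M0 :: real and B :: "(real \<times> (real ^ 'd)) set"
  assumes \<delta>: "0 < \<delta>" "\<delta> \<le> T / 8"
    and \<epsilon>: "0 < \<epsilon>" "\<epsilon> \<le> \<delta> / 2" "\<epsilon> \<le> 1 / 2"
    and M0: "0 < M0" "\<And>e (z :: real \<times> (real ^ 'd)). \<bar>mollifier_deriv \<epsilon> e z\<bar> \<le> M0 / \<epsilon>"
    and B: "B = core \<delta> T"
begin

lemma integrable_B: "continuous_on B f \<Longrightarrow> (f :: _ \<Rightarrow> real) integrable_on B"
  unfolding B core_def by (rule integrable_continuous)

lemma cube_subset: "cube T \<epsilon> \<subseteq> B"
proof
  fix w :: "real \<times> (real ^ 'd)"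
  assume "w \<in> cube T \<epsilon>"
  then have w: "\<bar>T / 2 - fst w\<bar> \<le> \<epsilon>" "\<And>i. \<bar>1 / 2 - snd w $ i\<bar> \<le> \<epsilon>"
    by (auto simp: mem_cube centre_def)
  have "0 \<le> snd w $ i \<and> snd w $ i \<le> 1" for i
    using w(2)[of i] \<epsilon> by (auto simp: abs_le_iff)
  then show "w \<in> B"
    using w(1) \<delta> \<epsilon> unfolding B mem_core by (auto simp: abs_le_iff)
qed

lemma continuous_shifted:
  assumes "continuous_on UNIV h"
  shows "continuous_on S (\<lambda>w. h (z - w :: real \<times> (real ^ 'd)) :: real)"
  by (rule continuous_on_compose2[OF assms]) (intro continuous_intros, simp)

lemmas continuous_mollifier_minus = continuous_shifted[OF continuous_mollifier]
lemmas continuous_mollifier_deriv_minus = continuous_shifted[OF continuous_mollifier_deriv]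

lemma integral_shift_space:
  fixes h :: "real \<times> (real ^ 'd) \<Rightarrow> real"
  assumes cont: "continuous_on UNIV h" and per: "\<And>t x i. h (t, x + axis i 1) = h (t, x)"
    and s: "\<bar>s\<bar> \<le> 1"
  shows "integral B (\<lambda>w. h ((t, x + s *\<^sub>R axis i 1) - w)) = integral B (\<lambda>w. h ((t, x) - w))"
proof -
  have *: "integral B (\<lambda>w. h ((t, x - s *\<^sub>R axis i 1) - w)) = integral B (\<lambda>w. h ((t, x) - w))"
    if "0 \<le> s" "s \<le> 1" for s and x :: "real ^ 'd"
  proof -
    let ?g = "\<lambda>w. h ((t, x) - w)"
    have "integral B (\<lambda>w. ?g (w + s *\<^sub>R st_dir (Some i))) = integral B ?g"
      unfolding B core_def
    proof (rule integral_shift_periodic[OF st_dir_in_Basis])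
      show "continuous_on UNIV ?g" by (rule continuous_shifted[OF cont])
      show "?g (w + (((T - \<delta>, \<chi> i. 1) - (\<delta>, 0)) \<bullet> st_dir (Some i)) *\<^sub>R st_dir (Some i)) = ?g w" for w
        using per[of "t - fst w" "x - snd w - axis i 1" i]
        by (cases w) (simp add: inner_axis algebra_simps)
    qed (use that in \<open>auto simp: inner_axis\<close>)
    then show ?thesis by (simp add: minus_prod_def algebra_simps)
  qed
  show ?thesis
  proof (cases "s \<ge> 0")
    case True
    then show ?thesis using *[of s "x + s *\<^sub>R axis i 1"] s by simp
  next
    case False
    then show ?thesis using *[of "- s" x] s by simp
  qed
qed

text \<open>
  Here the slabs compared in \<open>integral_shift_periodic\<close> are both outside the support of the
  translated function.
\<close>

lemma integral_shift_time:
  fixes h :: "real \<times> (real ^ 'd) \<Rightarrow> real"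
  assumes cont: "continuous_on UNIV h" and supp: "\<And>z. \<bar>fst z\<bar> \<ge> \<epsilon> \<Longrightarrow> h z = 0"
    and t: "\<delta> + \<epsilon> \<le> t" "t \<le> T - \<delta> - \<epsilon>" "\<delta> + \<epsilon> \<le> t'" "t' \<le> T - \<delta> - \<epsilon>"
  shows "integral B (\<lambda>w. h ((t, x) - w)) = integral B (\<lambda>w. h ((t', x) - w))"
proof -
  have *: "integral B (\<lambda>w. h ((t1, x) - w)) = integral B (\<lambda>w. h ((t2, x) - w))"
    if t: "\<delta> + \<epsilon> \<le> t1" "t1 \<le> t2" "t2 \<le> T - \<delta> - \<epsilon>" for t1 t2
  proof -
    let ?g = "\<lambda>w. h ((t2, x) - w)"
    have "integral B (\<lambda>w. ?g (w + (t2 - t1) *\<^sub>R st_dir None)) = integral B ?g"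
      unfolding B core_def
    proof (rule integral_shift_periodic[OF st_dir_in_Basis])
      show "continuous_on UNIV ?g" by (rule continuous_shifted[OF cont])
      fix w :: "real \<times> (real ^ 'd)"
      assume "(\<delta>, 0) \<bullet> st_dir None \<le> w \<bullet> st_dir (None :: 'd option)"
        "w \<bullet> st_dir (None :: 'd option) \<le> (\<delta>, 0) \<bullet> st_dir (None :: 'd option) + (t2 - t1)"
      then have w: "\<delta> \<le> fst w" "fst w \<le> \<delta> + (t2 - t1)" by (cases w; simp)+
      have "?g w = 0"
        using w t \<epsilon> by (intro supp) auto
      moreover have "?g (w + (((T - \<delta>, \<chi> i. 1) - (\<delta>, 0 :: real ^ 'd)) \<bullet> st_dir None) *\<^sub>R st_dir None) = 0"
        using w t \<epsilon> by (intro supp) auto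
      ultimately show "?g (w + (((T - \<delta>, \<chi> i. 1) - (\<delta>, 0)) \<bullet> st_dir None) *\<^sub>R st_dir None) = ?g w"
        by simp
    qed (use t \<delta> \<epsilon> in auto)
    then show ?thesis by (simp add: minus_prod_def algebra_simps)
  qed
  show ?thesis
  proof (cases "t \<le> t'")
    case True
    then show ?thesis using *[of t t'] t by simp
  next
    case False
    then show ?thesis using *[of t' t] t by simp
  qed
qed

text \<open>
  The integral over the fundamental domain does not change under translation of the integrand, as long
  as its support stays away from the time boundary. The translation is made in one coordinate direction
  after the other.
\<close>

lemma integral_translate:
  fixes h :: "real \<times> (real ^ 'd) \<Rightarrow> real"
  assumes cont: "continuous_on UNIV h" and per: "\<And>t x i. h (t, x + axis i 1) = h (t, x)"
    and supp: "\<And>z. \<bar>fst z\<bar> \<ge> \<epsilon> \<Longrightarrow> h z = 0"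
    and z: "\<delta> + \<epsilon> \<le> fst z" "fst z \<le> T - \<delta> - \<epsilon>" "\<And>i. \<bar>snd z $ i - 1 / 2\<bar> \<le> 1"
  shows "integral B (\<lambda>w. h (z - w)) = integral B (\<lambda>w. h (centre T - w))"
proof -
  obtain t x where zx: "z = (t, x)" by (cases z)
  let ?c = "\<chi> i. 1 / 2 :: real ^ 'd"
  have A: "integral B (\<lambda>w. h ((t, ?c + (\<Sum>i\<in>I. (x $ i - 1 / 2) *\<^sub>R axis i 1)) - w)) =
        integral B (\<lambda>w. h ((t, ?c) - w))" for I
  proof (induction I rule: infinite_finite_induct)
    case (insert i I)
    have eq: "?c + (\<Sum>i\<in>insert i I. (x $ i - 1 / 2) *\<^sub>R axis i 1) =
        (?c + (\<Sum>i\<in>I. (x $ i - 1 / 2) *\<^sub>R axis i 1)) + (x $ i - 1 / 2) *\<^sub>R axis i 1"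
      unfolding sum.insert[OF insert.hyps] by (simp only: ac_simps)
    have "\<bar>x $ i - 1 / 2\<bar> \<le> 1" using z(3)[of i] zx by simp
    then show ?case
      unfolding eq by (rule trans[OF integral_shift_space[OF cont per] insert.IH])
  qed auto
  have "?c + (\<Sum>i\<in>UNIV. (x $ i - 1 / 2) *\<^sub>R axis i 1) = x"
    using basis_expansion[of "\<chi> i. x $ i - 1 / 2"] by (simp add: vec_eq_iff scalar_mult_eq_scaleR)
  note A[of UNIV, unfolded this, folded zx]
  also have "integral B (\<lambda>w. h ((t, ?c) - w)) = integral B (\<lambda>w. h ((T / 2, ?c) - w))"
    using z zx \<delta> \<epsilon> by (intro integral_shift_time[OF cont supp]) auto
  finally show ?thesis by (simp add: centre_def)
qed

definition mass :: real where "mass = integral B (\<lambda>w. mollifier \<epsilon> (centre T - w))"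

text \<open>
  On the cube of half-side \<open>\<epsilon> / K0\<close> the argument of the bump function is at least 1/2.
\<close>

definition K0 :: real where "K0 = 2 * pi * (real CARD('d) + 1)"

lemma K0_pos: "0 < K0"
proof -
  have "0 < real CARD('d) + 1" by simp
  then show ?thesis unfolding K0_def by (intro mult_pos_pos) auto
qed

lemma mass_ge: "exp (- 2) * (2 * (\<epsilon> / K0)) ^ (CARD('d) + 1) \<le> mass"
proof -
  define h where "h = \<epsilon> / K0"
  have K1: "K0 \<ge> 1"
  proof -
    have "1 * 1 \<le> (2 * pi) * (real CARD('d) + 1)"
      using pi_gt3 by (intro mult_mono) auto
    then show ?thesis by (simp add: K0_def)
  qed
  have h: "0 < h" "h \<le> \<epsilon>"
    using \<epsilon> K0_pos K1 mult_left_mono[OF K1, of \<epsilon>] by (simp_all add: h_def pos_divide_le_eq)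
  have sub: "cube T h \<subseteq> (B :: (real \<times> (real ^ 'd)) set)"
  proof -
    have "cube T h \<subseteq> (cube T \<epsilon> :: (real \<times> (real ^ 'd)) set)"
      unfolding subset_iff mem_cube using order_trans[OF _ h(2)] by blast
    with cube_subset show ?thesis by blast
  qed
  have ge: "exp (- 2) \<le> mollifier \<epsilon> (centre T - w)" if "w \<in> cube T h" for w :: "real \<times> (real ^ 'd)"
  proof -
    have w: "\<bar>fst (centre T - w)\<bar> \<le> h" "\<And>i. \<bar>snd (centre T - w) $ i\<bar> \<le> h"
      using that unfolding mem_cube by auto
    have pih: "h\<^sup>2 \<le> (pi * h)\<^sup>2"
      using h(1) pi_gt3 by (intro power_mono) auto
    have "(fst (centre T - w))\<^sup>2 \<le> h\<^sup>2"
      using w(1) h(1) by (simp add: abs_le_square_iff[symmetric])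
    with pih have 1: "(fst (centre T - w))\<^sup>2 \<le> (pi * h)\<^sup>2" by linarith
    have 2: "(sin (pi * snd (centre T - w) $ i))\<^sup>2 \<le> (pi * h)\<^sup>2" for i
    proof -
      have "\<bar>sin (pi * snd (centre T - w) $ i)\<bar> \<le> \<bar>pi * snd (centre T - w) $ i\<bar>"
        by (rule abs_sin_x_le_abs_x)
      also have "\<dots> \<le> \<bar>pi * h\<bar>" using w(2)[of i] h(1) by (simp add: abs_mult)
      finally show ?thesis by (simp add: abs_le_square_iff)
    qed
    have "torus_norm_sq (centre T - w) \<le> (pi * h)\<^sup>2 + (\<Sum>i\<in>(UNIV::'d set). (pi * h)\<^sup>2)"
      unfolding torus_norm_sq_def by (intro add_mono sum_mono 1 2)
    also have "\<dots> = (real CARD('d) + 1) * (pi * h)\<^sup>2" by (simp add: algebra_simps)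
    also have "\<dots> = \<epsilon>\<^sup>2 / (4 * (real CARD('d) + 1))"
    proof -
      define n where "n = real CARD('d) + 1"
      have "n > 0" by (simp add: n_def add_pos_nonneg)
      moreover have "pi * h = \<epsilon> / (2 * n)" by (simp add: h_def K0_def n_def)
      ultimately show ?thesis by (simp add: n_def[symmetric] power2_eq_square)
    qed
    also have "\<dots> \<le> \<epsilon>\<^sup>2 / 2"
      using \<epsilon> by (intro divide_left_mono) auto
    finally have "torus_norm_sq (centre T - w) / \<epsilon>\<^sup>2 \<le> 1 / 2"
      using \<epsilon> by (simp add: field_simps)
    then show ?thesis unfolding mollifier_def by (intro bump_ge) linarith
  qed
  have intK: "(\<lambda>w. mollifier \<epsilon> (centre T - w)) integrable_on (cube T h :: (real \<times> (real ^ 'd)) set)"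
    unfolding cube_def by (intro integrable_continuous continuous_mollifier_minus)
  have "exp (- 2) * measure lborel (cube T h :: (real \<times> (real ^ 'd)) set) = integral (cube T h :: (real \<times> (real ^ 'd)) set) (\<lambda>w. exp (- 2))"
    by (simp add: cube_def)
  also have "\<dots> \<le> integral (cube T h) (\<lambda>w :: real \<times> (real ^ 'd). mollifier \<epsilon> (centre T - w))"
    by (intro integral_le intK ge) (simp add: cube_def integrable_const)
  also have "\<dots> \<le> mass"
    unfolding mass_def
    by (intro integral_subset_le sub intK integrable_B continuous_mollifier_minus ballI mollifier_nonneg)
  finally show ?thesis using h by (simp add: content_cube h_def)
qed

lemma mass_pos: "0 < mass"
proof -
  have "0 < 2 * (\<epsilon> / K0)" using \<epsilon>(1) K0_pos by simp
  then have "0 < exp (- 2) * (2 * (\<epsilon> / K0)) ^ (CARD('d) + 1)"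
    by (intro mult_pos_pos[OF exp_gt_zero] zero_less_power)
  with mass_ge show ?thesis by linarith
qed

definition \<kappa> :: real where "\<kappa> = exp 2 * K0 ^ (CARD('d) + 1) * M0 / \<epsilon>"

lemma \<kappa>_pos: "0 < \<kappa>"
  unfolding \<kappa>_def
  by (intro divide_pos_pos mult_pos_pos exp_gt_zero zero_less_power K0_pos M0(1) \<epsilon>(1))

text \<open>
  The support of the derivative lies in a cube of half-side \<open>\<epsilon>\<close>, whose volume is a constant
  multiple of that of the cube in lemma \<open>mass_ge\<close>. After normalisation a derivative of the mollifier
  therefore costs a constant over \<open>\<epsilon>\<close>; this is \<open>\<kappa>\<close>.
\<close>

lemma mollifier_deriv_mass:
  "integral B (\<lambda>w. \<bar>mollifier_deriv \<epsilon> e (centre T - w)\<bar>) \<le> \<kappa> * mass"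
proof -
  let ?f = "\<lambda>w. \<bar>mollifier_deriv \<epsilon> e (centre T - w)\<bar>"
  have z: "?f w = 0" if "w \<in> B - cube T \<epsilon>" for w
  proof -
    have "\<epsilon>\<^sup>2 \<le> torus_norm_sq (centre T - w)"
    proof (rule ccontr)
      assume "\<not> ?thesis"
      then have less: "torus_norm_sq (centre T - w) < \<epsilon>\<^sup>2" by simp
      have "\<bar>snd (centre T - w) $ i\<bar> \<le> \<epsilon>" for i
      proof -
        have "\<bar>snd (centre T - w) $ i\<bar> \<le> 1 / 2"
        proof -
          have "0 \<le> snd w $ i" "snd w $ i \<le> 1"
            using that by (auto simp: B mem_core)
          then show ?thesis by (simp add: centre_def abs_if)
        qed
        from abs_le_abs_sin_pi[OF this] torus_norm_sq_less(2)[OF less \<epsilon>(1), of i]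
        show ?thesis by linarith
      qed
      moreover have "\<bar>fst (centre T - w)\<bar> \<le> \<epsilon>"
        using torus_norm_sq_less(1)[OF less \<epsilon>(1)] by linarith
      ultimately have "w \<in> cube T \<epsilon>" by (simp add: mem_cube)
      with that show False by simp
    qed
    then show ?thesis using mollifier_support(2)[OF \<epsilon>(1), of "centre T - w" e] by simp
  qed
  have int: "?f integrable_on cube T \<epsilon>"
    unfolding cube_def
    by (intro integrable_continuous continuous_on_rabs continuous_mollifier_deriv_minus)
  have "integral B ?f = integral (cube T \<epsilon>) ?f"
  proof -
    have "integral B ?f = integral B (\<lambda>w. if w \<in> cube T \<epsilon> then ?f w else 0)"
      using z by (intro integral_cong) auto
    then show ?thesis
      using cube_subset by (simp add: integral_restrict_Int Int_absorb2)
  qed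
  also have "\<dots> \<le> integral (cube T \<epsilon> :: (real \<times> (real ^ 'd)) set) (\<lambda>w. M0 / \<epsilon>)"
    by (rule integral_le[OF int _ M0(2)]) (simp add: cube_def integrable_const)
  also have "\<dots> = M0 / \<epsilon> * (2 * \<epsilon>) ^ (CARD('d) + 1)"
  proof -
    have "integral (cube T \<epsilon> :: (real \<times> (real ^ 'd)) set) (\<lambda>w. M0 / \<epsilon>) =
        measure lborel (cube T \<epsilon> :: (real \<times> (real ^ 'd)) set) * (M0 / \<epsilon>)"
      unfolding cube_def by (simp only: integral_const real_scaleR_def)
    then show ?thesis
      using content_cube[of \<epsilon> T, where 'd='d] \<epsilon> by (simp only: less_imp_le mult.commute)
  qed
  also have "\<dots> = \<kappa> * (exp (- 2) * (2 * (\<epsilon> / K0)) ^ (CARD('d) + 1))"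
  proof -
    have "(2 * (\<epsilon> / K0)) ^ (CARD('d) + 1) = (2 * \<epsilon>) ^ (CARD('d) + 1) / K0 ^ (CARD('d) + 1)"
      by (simp only: power_divide times_divide_eq_right)
    then show ?thesis
      using K0_pos by (simp add: \<kappa>_def exp_minus del: power_Suc)
  qed
  also have "\<dots> \<le> \<kappa> * mass"
    using \<kappa>_pos mass_ge by (intro mult_left_mono) auto
  finally show ?thesis .
qed

end

section \<open>Mollification and commutators\<close>

context smoothing
begin

text \<open>
  \<open>avg f\<close> is the mollification of \<open>f\<close>, and \<open>davg e f\<close> its derivative in direction \<open>e\<close>. For a
  fixed point both are weighted means, with a positive weight of mass 1 and with a signed weight of
  mass 0 and variation at most \<open>\<kappa>\<close>.
\<close>

definition weigh :: "(real \<times> (real ^ 'd) \<Rightarrow> real) \<Rightarrow> (real \<times> (real ^ 'd) \<Rightarrow> real) \<Rightarrow> real" where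
  "weigh K f = integral B (\<lambda>w. f w * K w) / mass"

definition avg :: "(real \<times> (real ^ 'd) \<Rightarrow> real) \<Rightarrow> real \<times> (real ^ 'd) \<Rightarrow> real" where
  "avg f z = weigh (\<lambda>w. mollifier \<epsilon> (z - w)) f"

definition davg :: "'d option \<Rightarrow> (real \<times> (real ^ 'd) \<Rightarrow> real) \<Rightarrow> real \<times> (real ^ 'd) \<Rightarrow> real" where
  "davg e f z = weigh (\<lambda>w. mollifier_deriv \<epsilon> e (z - w)) f"

lemma weigh_add:
  assumes "continuous_on B K" "continuous_on B f" "continuous_on B g"
  shows "weigh K (\<lambda>w. f w + g w) = weigh K f + weigh K g"
  unfolding weigh_def ring_distribs
  by (subst integral_add) (auto intro!: integrable_B continuous_on_mult assms simp: add_divide_distrib)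

lemma weigh_cmult: "weigh K (\<lambda>w. c * f w) = c * weigh K f"
  unfolding weigh_def mult.assoc by simp

lemma weigh_bound:
  assumes "continuous_on B K" "continuous_on B f" and "\<And>w. w \<in> B \<Longrightarrow> K w \<noteq> 0 \<Longrightarrow> \<bar>f w\<bar> \<le> a"
  shows "\<bar>weigh K f\<bar> \<le> a * weigh (\<lambda>w. \<bar>K w\<bar>) (\<lambda>w. 1)"
proof -
  have "\<bar>integral B (\<lambda>w. f w * K w)\<bar> \<le> integral B (\<lambda>w. a * \<bar>K w\<bar>)"
    unfolding real_norm_def[symmetric]
  proof (rule integral_norm_bound_integral)
    fix w assume "w \<in> B"
    then show "norm (f w * K w) \<le> a * norm (K w)"
      using assms(3)[of w] by (cases "K w = 0") (auto simp: abs_mult intro: mult_right_mono)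
  qed (use assms in \<open>auto intro!: integrable_B continuous_intros\<close>)
  then show ?thesis
    using mass_pos by (simp add: weigh_def divide_right_mono)
qed

lemma avg_add:
  "continuous_on B f \<Longrightarrow> continuous_on B g \<Longrightarrow> avg (\<lambda>w. f w + g w) z = avg f z + avg g z"
  unfolding avg_def by (rule weigh_add[OF continuous_mollifier_minus])

lemma davg_add:
  "continuous_on B f \<Longrightarrow> continuous_on B g \<Longrightarrow> davg e (\<lambda>w. f w + g w) z = davg e f z + davg e g z"
  unfolding davg_def by (rule weigh_add[OF continuous_mollifier_deriv_minus])

lemma avg_cmult: "avg (\<lambda>w. c * f w) z = c * avg f z"
  unfolding avg_def by (rule weigh_cmult)

lemma davg_cmult: "davg e (\<lambda>w. c * f w) z = c * davg e f z"
  unfolding davg_def by (rule weigh_cmult)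

lemma avg_one_near:
  assumes "\<delta> + \<epsilon> \<le> fst z" "fst z \<le> T - \<delta> - \<epsilon>" "\<And>i. \<bar>snd z $ i - 1 / 2\<bar> \<le> 1"
  shows "avg (\<lambda>w. 1) z = 1"
proof -
  have "integral B (\<lambda>w. mollifier \<epsilon> (z - w)) = mass"
    unfolding mass_def
  proof (rule integral_translate[OF continuous_mollifier mollifier_periodic _ assms])
    show "mollifier \<epsilon> y = 0" if "\<epsilon> \<le> \<bar>fst y\<bar>" for y :: "real \<times> (real ^ 'd)"
      using torus_norm_sq_less(1)[of y \<epsilon>] that \<epsilon> mollifier_support(1)[of \<epsilon> y] by fastforce
  qed
  then show ?thesis using mass_pos by (simp add: avg_def weigh_def)
qed

lemma inner_near:
  assumes "z \<in> core (2 * \<delta>) T"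
  shows "\<delta> + \<epsilon> < fst z" "fst z < T - \<delta> - \<epsilon>" "\<bar>snd z $ i - 1 / 2\<bar> < 1" "z \<in> B"
proof -
  have "0 \<le> snd z $ i" "snd z $ i \<le> 1" and t: "2 * \<delta> \<le> fst z" "fst z \<le> T - 2 * \<delta>"
    using assms by (auto simp: mem_core)
  then show "\<bar>snd z $ i - 1 / 2\<bar> < 1" by (simp add: abs_if)
  show "\<delta> + \<epsilon> < fst z" "fst z < T - \<delta> - \<epsilon>" using t \<delta> \<epsilon> by auto
  show "z \<in> B" using assms \<delta> by (auto simp: B mem_core)
qed

lemma avg_has_dir_deriv:
  assumes f: "continuous_on B f"
  shows "has_dir_deriv (avg f) (davg e f) (st_dir e)"
  unfolding has_dir_deriv_def
proof
  fix z
  have "((\<lambda>s. integral B (\<lambda>w. f w * mollifier \<epsilon> (z + s *\<^sub>R st_dir e - w))) has_real_derivative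
      integral B (\<lambda>w. f w * mollifier_deriv \<epsilon> e (z + 0 *\<^sub>R st_dir e - w))) (at 0)"
    unfolding B core_def
  proof (rule leibniz_rule_field_derivative[where U=UNIV])
    show "((\<lambda>s. f w * mollifier \<epsilon> (z + s *\<^sub>R st_dir e - w)) has_real_derivative
        f w * mollifier_deriv \<epsilon> e (z + s *\<^sub>R st_dir e - w)) (at s)" for w s
      using DERIV_cmult[OF has_dir_deriv_line[OF mollifier_has_dir_deriv], of "f w" \<epsilon> "z - w" e s UNIV]
      by (simp add: algebra_simps)
    show "(\<lambda>w. f w * mollifier \<epsilon> (z + s *\<^sub>R st_dir e - w)) integrable_on cbox (\<delta>, 0) (T - \<delta>, \<chi> i. 1)" for s
      using f unfolding B core_def
      by (intro integrable_continuous continuous_on_mult continuous_mollifier_minus)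
    show "continuous_on (UNIV \<times> cbox (\<delta>, 0) (T - \<delta>, \<chi> i. 1))
       (\<lambda>(s, w). f w * mollifier_deriv \<epsilon> e (z + s *\<^sub>R st_dir e - w))"
      unfolding split_beta
      by (intro continuous_on_mult continuous_on_compose2[OF f]
          continuous_on_compose2[OF continuous_mollifier_deriv[of UNIV]] continuous_intros)
        (auto simp: B core_def)
  qed auto
  then show "((\<lambda>s. avg f (z + s *\<^sub>R st_dir e)) has_real_derivative davg e f z) (at 0)"
    unfolding avg_def davg_def weigh_def by (auto intro: DERIV_cdivide)
qed

lemma continuous_avg:
  assumes f: "continuous_on B f"
  shows "continuous_on S (avg f)"
proof -
  have "continuous_on (S \<times> cbox (\<delta>, 0) (T - \<delta>, \<chi> i. 1)) (\<lambda>(z, w). f w * mollifier \<epsilon> (z - w))"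
    unfolding split_beta
    by (intro continuous_on_mult continuous_on_compose2[OF f]
        continuous_on_compose2[OF continuous_mollifier[of UNIV]] continuous_intros)
      (auto simp: B core_def)
  from integral_continuous_on_param[OF this]
  have "continuous_on S (\<lambda>z. integral B (\<lambda>w. f w * mollifier \<epsilon> (z - w)))"
    by (simp only: B core_def)
  then show ?thesis
    unfolding avg_def weigh_def divide_inverse by (intro continuous_on_mult continuous_on_const)
qed

lemma continuous_davg:
  assumes f: "continuous_on B f"
  shows "continuous_on S (davg e f)"
proof -
  have "continuous_on (S \<times> cbox (\<delta>, 0) (T - \<delta>, \<chi> i. 1)) (\<lambda>(z, w). f w * mollifier_deriv \<epsilon> e (z - w))"
    unfolding split_beta
    by (intro continuous_on_mult continuous_on_compose2[OF f]
        continuous_on_compose2[OF continuous_mollifier_deriv[of UNIV]] continuous_intros)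
      (auto simp: B core_def)
  from integral_continuous_on_param[OF this]
  have "continuous_on S (\<lambda>z. integral B (\<lambda>w. f w * mollifier_deriv \<epsilon> e (z - w)))"
    by (simp only: B core_def)
  then show ?thesis
    unfolding davg_def weigh_def divide_inverse by (intro continuous_on_mult continuous_on_const)
qed

lemma avg_periodic: "avg f (t, x + axis i 1) = avg f (t, x)"
proof -
  have "mollifier \<epsilon> ((t, x + axis i 1) - w) = mollifier \<epsilon> ((t, x) - w)" for w
    using mollifier_periodic[of \<epsilon> "t - fst w" "x - snd w" i] by (cases w) (simp add: algebra_simps)
  then show ?thesis by (simp add: avg_def)
qed

lemma avg_one:
  assumes z: "z \<in> core (2 * \<delta>) T"
  shows "avg (\<lambda>w. 1) z = 1"
  by (intro avg_one_near less_imp_le inner_near[OF z])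

text \<open>
  Near an interior point the mean of the constant 1 is 1, by translation invariance; so its derivative
  vanishes. Hence \<open>davg e f z\<close> does not change when a constant is subtracted from \<open>f\<close>, and is
  bounded by the oscillation of \<open>f\<close>.
\<close>

lemma davg_one:
  assumes z: "z \<in> core (2 * \<delta>) T"
  shows "davg e (\<lambda>w. 1) z = 0"
proof -
  define U where "U = {y :: real \<times> (real ^ 'd). \<delta> + \<epsilon> < fst y \<and> fst y < T - \<delta> - \<epsilon> \<and>
      (\<forall>i. \<bar>snd y $ i - 1 / 2\<bar> < 1)}"
  have "U = {\<delta> + \<epsilon><..<T - \<delta> - \<epsilon>} \<times> box (\<chi> i. - 1 / 2) (\<chi> i. 3 / 2)"
  proof -
    have "\<bar>y - 1 / 2\<bar> < 1 \<longleftrightarrow> - 1 / 2 < y \<and> y < 3 / 2" for y :: real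
      by linarith
    then show ?thesis
      by (simp only: U_def set_eq_iff mem_Collect_eq mem_Times_iff greaterThanLessThan_iff
          mem_box_cart vec_lambda_beta simp_thms conj_assoc)
  qed
  then have "open U" by (simp only: open_Times open_greaterThanLessThan open_box)
  moreover have "z \<in> U" using inner_near[OF z] by (simp add: U_def)
  moreover have "((\<lambda>s. z + s *\<^sub>R st_dir e) \<longlongrightarrow> z + 0 *\<^sub>R st_dir e) (nhds 0)"
    by (intro tendsto_intros filterlim_ident)
  ultimately have "eventually (\<lambda>s. z + s *\<^sub>R st_dir e \<in> U) (nhds 0)"
    using topological_tendstoD[of "\<lambda>s. z + s *\<^sub>R st_dir e" z "nhds 0" U] by simp
  then have ev: "eventually (\<lambda>s. avg (\<lambda>w. 1) (z + s *\<^sub>R st_dir e) = 1) (nhds 0)"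
    by (rule eventually_mono) (auto simp: U_def intro!: avg_one_near intro: less_imp_le)
  have "((\<lambda>s. avg (\<lambda>w. 1) (z + s *\<^sub>R st_dir e)) has_real_derivative davg e (\<lambda>w. 1) z) (at 0)"
    by (intro has_dir_derivD avg_has_dir_deriv continuous_intros)
  then have "((\<lambda>s. 1) has_real_derivative davg e (\<lambda>w. 1) z) (at 0)"
    by (rule iffD1[OF DERIV_cong_ev[OF refl ev refl]])
  then show ?thesis using DERIV_unique[OF DERIV_const] by fastforce
qed

lemma avg_const: "z \<in> core (2 * \<delta>) T \<Longrightarrow> avg (\<lambda>w. c) z = c"
  using avg_cmult[of c "\<lambda>w. 1" z] avg_one by simp

lemma davg_const: "z \<in> core (2 * \<delta>) T \<Longrightarrow> davg e (\<lambda>w. c) z = 0"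
  using davg_cmult[of e c "\<lambda>w. 1" z] davg_one by simp

definition near :: "real \<times> (real ^ 'd) \<Rightarrow> (real \<times> (real ^ 'd)) set" where
  "near z = {w\<in>B. torus_norm_sq (z - w) < \<epsilon>\<^sup>2}"

lemma
  assumes "w \<in> B"
  shows mollifier_near: "mollifier \<epsilon> (z - w) \<noteq> 0 \<Longrightarrow> w \<in> near z"
    and mollifier_deriv_near: "mollifier_deriv \<epsilon> e (z - w) \<noteq> 0 \<Longrightarrow> w \<in> near z"
  unfolding near_def
  using mollifier_support[OF \<epsilon>(1), of "z - w"] assms by (auto simp: not_less[symmetric])

lemma near_self: "z \<in> core (2 * \<delta>) T \<Longrightarrow> z \<in> near z"
  using inner_near(4) \<epsilon> by (simp add: near_def torus_norm_sq_def)

lemma avg_bound: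
  assumes z: "z \<in> core (2 * \<delta>) T" and f: "continuous_on B f" and a: "\<And>w. w \<in> near z \<Longrightarrow> \<bar>f w\<bar> \<le> a"
  shows "\<bar>avg f z\<bar> \<le> a"
proof -
  have "\<bar>avg f z\<bar> \<le> a * weigh (\<lambda>w. \<bar>mollifier \<epsilon> (z - w)\<bar>) (\<lambda>w. 1)"
    unfolding avg_def
    by (rule weigh_bound[OF continuous_mollifier_minus f a]) (rule mollifier_near)
  also have "weigh (\<lambda>w. \<bar>mollifier \<epsilon> (z - w)\<bar>) (\<lambda>w. 1) = 1"
    using avg_one[OF z] by (simp only: avg_def abs_of_nonneg[OF mollifier_nonneg])
  finally show ?thesis by simp
qed

lemma davg_bound:
  assumes z: "z \<in> core (2 * \<delta>) T" and f: "continuous_on B f" and a: "\<And>w. w \<in> near z \<Longrightarrow> \<bar>f w\<bar> \<le> a"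
  shows "\<bar>davg e f z\<bar> \<le> \<kappa> * a"
proof -
  have a0: "0 \<le> a" using a[OF near_self[OF z]] by linarith
  have "\<bar>davg e f z\<bar> \<le> a * weigh (\<lambda>w. \<bar>mollifier_deriv \<epsilon> e (z - w)\<bar>) (\<lambda>w. 1)"
    unfolding davg_def
    by (rule weigh_bound[OF continuous_mollifier_deriv_minus f a]) (rule mollifier_deriv_near)
  also have "\<dots> \<le> a * \<kappa>"
  proof (rule mult_left_mono[OF _ a0])
    have "integral B (\<lambda>w. \<bar>mollifier_deriv \<epsilon> e (z - w)\<bar>) = integral B (\<lambda>w. \<bar>mollifier_deriv \<epsilon> e (centre T - w)\<bar>)"
    proof (rule integral_translate)
      show "continuous_on UNIV (\<lambda>w. \<bar>mollifier_deriv \<epsilon> e w\<bar>)"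
        by (intro continuous_on_rabs continuous_mollifier_deriv)
      show "\<bar>mollifier_deriv \<epsilon> e y\<bar> = 0" if "\<epsilon> \<le> \<bar>fst y\<bar>" for y :: "real \<times> (real ^ 'd)"
        using torus_norm_sq_less(1)[of y \<epsilon>] that \<epsilon> mollifier_support(2)[of \<epsilon> y e] by fastforce
      show "\<bar>mollifier_deriv \<epsilon> e (t, x + axis i 1)\<bar> = \<bar>mollifier_deriv \<epsilon> e (t, x)\<bar>" for t x i
        by (simp only: mollifier_deriv_periodic)
    qed (intro less_imp_le inner_near[OF z])+
    with mollifier_deriv_mass[of e] show "weigh (\<lambda>w. \<bar>mollifier_deriv \<epsilon> e (z - w)\<bar>) (\<lambda>w. 1) \<le> \<kappa>"
      using mass_pos by (simp add: weigh_def divide_le_eq)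
  qed
  finally show ?thesis by (simp add: mult.commute)
qed

definition osc :: "(real \<times> (real ^ 'd) \<Rightarrow> real) \<Rightarrow> real \<times> (real ^ 'd) \<Rightarrow> real \<Rightarrow> bool" where
  "osc f z a \<longleftrightarrow> continuous_on B f \<and> (\<forall>w\<in>near z. \<bar>f w - f z\<bar> \<le> a)"

lemma avg_shift: "z \<in> core (2 * \<delta>) T \<Longrightarrow> continuous_on B f \<Longrightarrow> avg (\<lambda>w. f w - c) z = avg f z - c"
  using avg_add[of f "\<lambda>w. - c" z] avg_const[of z "- c"] by simp

lemma davg_shift: "z \<in> core (2 * \<delta>) T \<Longrightarrow> continuous_on B f \<Longrightarrow> davg e (\<lambda>w. f w - c) z = davg e f z"
  using davg_add[of f "\<lambda>w. - c" e z] davg_const[of z e "- c"] by simp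

lemma avg_osc: "z \<in> core (2 * \<delta>) T \<Longrightarrow> osc f z a \<Longrightarrow> \<bar>avg f z - f z\<bar> \<le> a"
  using avg_bound[of z "\<lambda>w. f w - f z" a] avg_shift[of z f "f z"]
  by (simp add: osc_def continuous_on_diff)

lemma davg_osc: "z \<in> core (2 * \<delta>) T \<Longrightarrow> osc f z a \<Longrightarrow> \<bar>davg e f z\<bar> \<le> \<kappa> * a"
  using davg_bound[of z "\<lambda>w. f w - f z" a e] davg_shift[of z f e "f z"]
  by (simp add: osc_def continuous_on_diff)

lemma osc_nonneg: "z \<in> core (2 * \<delta>) T \<Longrightarrow> osc f z a \<Longrightarrow> 0 \<le> a"
  unfolding osc_def by (drule near_self) (metis abs_ge_zero order_trans)

text \<open>
  The commutators do not change when the values at \<open>z\<close> are subtracted from \<open>f\<close> and \<open>g\<close>. After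
  that, every factor is bounded by an oscillation.
\<close>

lemma
  assumes z: "z \<in> core (2 * \<delta>) T" and f: "osc f z a" and g: "osc g z b"
  shows commutator_bound: "\<bar>avg f z * avg g z - avg (\<lambda>w. f w * g w) z\<bar> \<le> 2 * (a * b)"
    and commutator_deriv_bound:
      "\<bar>davg e f z * avg g z + avg f z * davg e g z - davg e (\<lambda>w. f w * g w) z\<bar> \<le> 3 * (\<kappa> * a * b)"
proof -
  define F where "F = (\<lambda>w. f w - f z)"
  define G where "G = (\<lambda>w. g w - g z)"
  have c: "continuous_on B f" "continuous_on B g"
    using f g by (auto simp: osc_def)
  then have C: "continuous_on B F" "continuous_on B G"
    by (auto simp: F_def G_def intro!: continuous_intros)
  note nn = osc_nonneg[OF z f] osc_nonneg[OF z g]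
  have F: "\<bar>F w\<bar> \<le> a" "\<bar>G w\<bar> \<le> b" if "w \<in> near z" for w
    using f g that by (auto simp: osc_def F_def G_def)
  have FG: "\<bar>F w * G w\<bar> \<le> a * b" if "w \<in> near z" for w
    using F[OF that] nn by (simp add: abs_mult mult_mono)
  have eq: "(\<lambda>w. f w * g w) = (\<lambda>w. F w * G w + (f z * g w + (g z * f w + - (f z * g z))))"
    by (simp add: F_def G_def algebra_simps)
  have cs: "continuous_on B (\<lambda>w. F w * G w)" "continuous_on B (\<lambda>w. f z * g w)" "continuous_on B (\<lambda>w. g z * f w)"
    "continuous_on B (\<lambda>w. g z * f w + - (f z * g z))"
    "continuous_on B (\<lambda>w. f z * g w + (g z * f w + - (f z * g z)))"
    using c C by (auto intro!: continuous_intros)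
  have A: "avg (\<lambda>w. f w * g w) z = avg (\<lambda>w. F w * G w) z + f z * avg g z + g z * avg f z - f z * g z"
    unfolding eq
    by (simp only: avg_add[OF cs(1,5)] avg_add[OF cs(2,4)] avg_add[OF cs(3) continuous_on_const]
        avg_cmult avg_const[OF z])
  have D: "davg e (\<lambda>w. f w * g w) z = davg e (\<lambda>w. F w * G w) z + f z * davg e g z + g z * davg e f z"
    unfolding eq
    by (simp only: davg_add[OF cs(1,5)] davg_add[OF cs(2,4)] davg_add[OF cs(3) continuous_on_const]
        davg_cmult davg_const[OF z])
  note dev = avg_osc[OF z f] avg_osc[OF z g] davg_osc[OF z f, of e] davg_osc[OF z g, of e]
  have "avg f z * avg g z - avg (\<lambda>w. f w * g w) z = (avg f z - f z) * (avg g z - g z) - avg (\<lambda>w. F w * G w) z"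
    unfolding A by (simp add: algebra_simps)
  moreover have "\<bar>(avg f z - f z) * (avg g z - g z)\<bar> \<le> a * b"
    using dev nn by (simp add: abs_mult mult_mono)
  moreover have "\<bar>avg (\<lambda>w. F w * G w) z\<bar> \<le> a * b"
    by (rule avg_bound[OF z cs(1) FG])
  ultimately show "\<bar>avg f z * avg g z - avg (\<lambda>w. f w * g w) z\<bar> \<le> 2 * (a * b)" by linarith
  have "davg e f z * avg g z + avg f z * davg e g z - davg e (\<lambda>w. f w * g w) z =
     davg e f z * (avg g z - g z) + (avg f z - f z) * davg e g z - davg e (\<lambda>w. F w * G w) z"
    unfolding D by (simp add: algebra_simps)
  moreover have "\<bar>davg e f z * (avg g z - g z)\<bar> \<le> (\<kappa> * a) * b" "\<bar>(avg f z - f z) * davg e g z\<bar> \<le> a * (\<kappa> * b)"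
    using dev nn \<kappa>_pos unfolding abs_mult by (intro mult_mono; simp)+
  moreover have "\<bar>davg e (\<lambda>w. F w * G w) z\<bar> \<le> \<kappa> * (a * b)"
    by (rule davg_bound[OF z cs(1) FG])
  ultimately show "\<bar>davg e f z * avg g z + avg f z * davg e g z - davg e (\<lambda>w. f w * g w) z\<bar> \<le> 3 * (\<kappa> * a * b)"
    by (simp add: mult_ac)
qed

text \<open>
  Averaging commutes with the affine function that is tangent to \<open>Q\<close> at \<open>f z\<close>, so only the
  remainder contributes. With \<open>q = 0\<close> this covers a \<open>Q\<close> that is merely Hoelder continuous.
\<close>

lemma nonlinear_commutator_bound:
  assumes z: "z \<in> core (2 * \<delta>) T" and f: "osc f z b"
    and Q: "continuous_on UNIV Q" "\<And>x y. \<bar>Q x - Q y - q y * (x - y)\<bar> \<le> H * \<bar>x - y\<bar> powr \<theta>"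
    and H: "0 \<le> H" "0 \<le> \<theta>"
  shows "\<bar>Q (avg f z) - avg (\<lambda>w. Q (f w)) z\<bar> \<le> 2 * H * b powr \<theta>"
proof -
  have c: "continuous_on B f" using f by (simp add: osc_def)
  have cQ: "continuous_on B (\<lambda>w. Q (f w))"
    by (rule continuous_on_compose2[OF Q(1) c]) simp
  let ?R = "\<lambda>w. Q (f w) - Q (f z) - q (f z) * (f w - f z)"
  have cR: "continuous_on B ?R" using c cQ by (intro continuous_intros)
  have R: "\<bar>?R w\<bar> \<le> H * b powr \<theta>" if "w \<in> near z" for w
  proof -
    have "\<bar>f w - f z\<bar> powr \<theta> \<le> b powr \<theta>"
      using f that H by (intro powr_mono2) (auto simp: osc_def)
    then show ?thesis
      using Q(2)[of "f w" "f z"] mult_left_mono[OF _ H(1)] order_trans by blast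
  qed
  have eq: "(\<lambda>w. Q (f w)) = (\<lambda>w. ?R w + (q (f z) * f w + (Q (f z) - q (f z) * f z)))"
    by (simp add: algebra_simps)
  have A: "avg (\<lambda>w. Q (f w)) z = avg ?R z + (q (f z) * avg f z + (Q (f z) - q (f z) * f z))"
  proof -
    have 1: "continuous_on B (\<lambda>w. q (f z) * f w)" "continuous_on B (\<lambda>w. q (f z) * f w + (Q (f z) - q (f z) * f z))"
      using c by (auto intro!: continuous_intros)
    show ?thesis
      by (subst eq) (simp only: avg_add[OF cR 1(2)] avg_add[OF 1(1) continuous_on_const] avg_cmult avg_const[OF z])
  qed
  have "Q (avg f z) - avg (\<lambda>w. Q (f w)) z =
      (Q (avg f z) - Q (f z) - q (f z) * (avg f z - f z)) - avg ?R z"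
    unfolding A by (simp add: algebra_simps)
  moreover have "\<bar>Q (avg f z) - Q (f z) - q (f z) * (avg f z - f z)\<bar> \<le> H * b powr \<theta>"
  proof -
    have "\<bar>avg f z - f z\<bar> powr \<theta> \<le> b powr \<theta>"
      using avg_osc[OF z f] H by (intro powr_mono2) auto
    then show ?thesis
      using Q(2)[of "avg f z" "f z"] mult_left_mono[OF _ H(1)] order_trans by blast
  qed
  moreover have "\<bar>avg ?R z\<bar> \<le> H * b powr \<theta>"
    by (rule avg_bound[OF z cR R])
  ultimately show ?thesis by linarith
qed

end

section \<open>The energy flux of the mollified fields\<close>

lemma sum_option: "(\<Sum>e\<in>(UNIV :: 'd::finite option set). f e) = f None + (\<Sum>j\<in>UNIV. f (Some j))"
  by (simp add: UNIV_option_conv sum.reindex)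

text \<open>
  The energy balance for mollified fields at one point. The variables are the values of: the density
  \<open>r\<close> and its mean flux \<open>n\<close>, the velocity \<open>v\<close>, the space-time velocity \<open>vh = (1, v)\<close>, the
  mollified momentum flux \<open>q\<close>, the mollified pressure \<open>\<pi>\<close>, the potential \<open>P\<close> and its derivative
  \<open>g\<close> at \<open>r\<close>, and a substitute \<open>L\<close> for \<open>g\<close>; a prefix \<open>d\<close> marks derivatives. On the left is
  the divergence of the energy flux minus two commutator fluxes. On the right every summand contains a
  commutator, multiplied by the derivative of a mollified field or, in the third sum, by derivatives of
  another commutator.

  The kinetic flux has divergence $\sum_{e,i} n_e v_i \partial_e v_i$ by the mass equation. The momentum
  equation turns this into commutator terms minus $v \cdot \nabla \pi$, which the pressure flux
  cancels, and \<open>pressure\<close> makes $\pi - p(r)$ the coefficient of the remaining ${\rm div}\,v$.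
\<close>

lemma energy_flux_identity:
  fixes v :: "'d::finite \<Rightarrow> real" and n vh dn dvh dr dL d\<pi> sp :: "'d option \<Rightarrow> real"
    and dv :: "'d option \<Rightarrow> 'd \<Rightarrow> real" and q dq :: "'d \<Rightarrow> 'd option \<Rightarrow> real"
  assumes mass: "(\<Sum>e\<in>UNIV. dn e) = 0"
    and momentum: "\<And>i. (\<Sum>e\<in>UNIV. dq i e) + d\<pi> (Some i) = 0"
    and pressure: "r * g - P = pr"
    and hat: "\<And>i. vh (Some i) = v i" "dvh None = 0"
    and sp: "sp None = 0" "\<And>i. sp (Some i) = 1"
  shows "(\<Sum>e\<in>UNIV. (\<Sum>i\<in>UNIV. v i * dv e i) * n e + 1 / 2 * (\<Sum>i\<in>UNIV. (v i)\<^sup>2) * dn e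
       + (g * dr e * vh e + P * dvh e) + sp e * (d\<pi> e * vh e + \<pi> * dvh e)
       - (\<Sum>i\<in>UNIV. dv e i * (n e * v i - q i e) + v i * (dn e * v i + n e * dv e i - dq i e))
       - (dL e * (r * vh e - n e) + L * (dr e * vh e + r * dvh e - dn e)))
     = - (\<Sum>e\<in>UNIV. \<Sum>i\<in>UNIV. dv e i * (n e * v i - q i e)) - (pr - \<pi>) * (\<Sum>e\<in>UNIV. dvh e)
       + (g - L) * (\<Sum>e\<in>UNIV. dr e * vh e + r * dvh e - dn e) - (\<Sum>e\<in>UNIV. dL e * (r * vh e - n e))"
proof -
  define A where "A = (\<Sum>e\<in>UNIV. (\<Sum>i\<in>UNIV. v i * dv e i) * n e)"
  define W where "W = (\<Sum>i\<in>UNIV. v i * d\<pi> (Some i))"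
  define X where "X = (\<Sum>e\<in>UNIV. \<Sum>i\<in>UNIV. dv e i * (n e * v i - q i e))"
  define V where "V = (\<Sum>e\<in>UNIV. dvh e)"
  define Y where "Y = (\<Sum>e\<in>UNIV. dr e * vh e)"
  define Z where "Z = (\<Sum>e\<in>UNIV. dL e * (r * vh e - n e))"
  have "(\<Sum>e\<in>UNIV. v i * (dn e * v i + n e * dv e i - dq i e))
      = v i * (\<Sum>e\<in>UNIV. n e * dv e i) + v i * d\<pi> (Some i)" for i
  proof -
    have "(\<Sum>e\<in>UNIV. v i * (dn e * v i + n e * dv e i - dq i e))
        = v i * (v i * (\<Sum>e\<in>UNIV. dn e) + (\<Sum>e\<in>UNIV. n e * dv e i) - (\<Sum>e\<in>UNIV. dq i e))"
      by (simp add: sum_distrib_left sum.distrib sum_subtractf right_diff_distrib ring_distribs mult_ac)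
    then show ?thesis
      using momentum[of i] mass by (simp add: ring_distribs eq_neg_iff_add_eq_0[symmetric])
  qed
  then have 1: "(\<Sum>e\<in>UNIV. \<Sum>i\<in>UNIV. v i * (dn e * v i + n e * dv e i - dq i e)) = A + W"
    by (subst sum.swap)
      (simp add: A_def W_def sum.distrib sum_distrib_left sum_distrib_right mult_ac sum.swap[of _ UNIV "UNIV::'d set"])
  have 2: "(\<Sum>e\<in>UNIV. sp e * (d\<pi> e * vh e)) = W" "(\<Sum>e\<in>UNIV. sp e * (\<pi> * dvh e)) = \<pi> * V"
    by (simp_all add: sum_option sp hat W_def V_def sum_distrib_left mult_ac)
  have 3: "(\<Sum>e\<in>UNIV. dr e * vh e + r * dvh e - dn e) = Y + r * V"
    using mass by (simp add: sum.distrib sum_subtractf Y_def V_def sum_distrib_left)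
  have 4: "(\<Sum>e\<in>UNIV. 1 / 2 * (\<Sum>i\<in>UNIV. (v i)\<^sup>2) * dn e) = 0"
    by (simp only: sum_distrib_left[symmetric] mass mult_zero_right)
  have 5: "(\<Sum>e\<in>UNIV. g * dr e * vh e + P * dvh e) = g * Y + P * V"
    by (simp add: sum.distrib sum_distrib_left Y_def V_def mult.assoc)
  have 6: "(\<Sum>e\<in>UNIV. sp e * (d\<pi> e * vh e + \<pi> * dvh e)) = W + \<pi> * V"
    by (simp only: distrib_left sum.distrib 2)
  have 7: "(\<Sum>e\<in>UNIV. \<Sum>i\<in>UNIV. dv e i * (n e * v i - q i e) + v i * (dn e * v i + n e * dv e i - dq i e))
      = X + (A + W)"
    by (simp only: sum.distrib 1 X_def)
  have 8: "(\<Sum>e\<in>UNIV. dL e * (r * vh e - n e) + L * (dr e * vh e + r * dvh e - dn e)) = Z + L * (Y + r * V)"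
    by (simp only: sum.distrib Z_def 3 sum_distrib_left[symmetric])
  have "A + 0 + (g * Y + P * V) + (W + \<pi> * V) - (X + (A + W)) - (Z + L * (Y + r * V))
     = - X - (pr - \<pi>) * V + (g - L) * (Y + r * V) - Z"
    unfolding pressure[symmetric] by (simp add: algebra_simps)
  then show ?thesis
    by (simp only: sum.distrib[where h="\<lambda>e. 1 / 2 * (\<Sum>i\<in>UNIV. (v i)\<^sup>2) * dn e"]
        sum_subtractf[where g="\<lambda>e. dL e * (r * vh e - n e) + L * (dr e * vh e + r * dvh e - dn e)"]
        sum_subtractf[where g="\<lambda>e. \<Sum>i\<in>UNIV. dv e i * (n e * v i - q i e) + v i * (dn e * v i + n e * dv e i - dq i e)"]
        sum.distrib[where h="\<lambda>e. sp e * (d\<pi> e * vh e + \<pi> * dvh e)"]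
        sum.distrib[where h="\<lambda>e. g * dr e * vh e + P * dvh e"]
        A_def[symmetric] X_def[symmetric] V_def[symmetric] Z_def[symmetric] 3 4 5 6 7 8)
qed

text \<open>
  Here \<open>q\<close> is the slope in the expansion of \<open>p\<close>, \<open>\<phi>'\<close> is the gradient of the test
  function \<open>\<phi>\<close>, and \<open>1 + \<theta>\<close> is the exponent \<open>\<gamma>\<close>.
\<close>

locale euler_smoothing = smoothing T \<delta> \<epsilon> M0 B
  for T \<delta> \<epsilon> M0 :: real and B :: "(real \<times> (real ^ 'd)) set" +
  fixes \<rho> :: "real \<times> (real ^ 'd) \<Rightarrow> real" and u :: "real \<times> (real ^ 'd) \<Rightarrow> real ^ 'd"
    and p q P g :: "real \<Rightarrow> real" and lo hi H \<theta> :: real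
    and \<phi> :: "real \<times> (real ^ 'd) \<Rightarrow> real" and \<phi>' :: "'d option \<Rightarrow> real \<times> (real ^ 'd) \<Rightarrow> real"
  assumes cont_\<rho>: "continuous_on B \<rho>" and cont_u: "\<And>i. continuous_on B (\<lambda>z. u z $ i)"
    and range_\<rho>: "\<And>z. z \<in> B \<Longrightarrow> lo \<le> \<rho> z \<and> \<rho> z \<le> hi"
    and cont_p: "continuous_on UNIV p"
    and p_taylor: "\<And>x y. \<bar>p x - p y - q y * (x - y)\<bar> \<le> H * \<bar>x - y\<bar> powr (1 + \<theta>)"
    and P_deriv: "\<And>x. (P has_real_derivative g x) (at x)"
    and cont_g: "continuous_on UNIV g"
    and g_holder: "\<And>x y. \<bar>g x - g y\<bar> \<le> H * \<bar>x - y\<bar> powr \<theta>"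
    and H: "0 \<le> H" and \<theta>: "0 < \<theta>"
    and pressure: "\<And>r. lo \<le> r \<Longrightarrow> r \<le> hi \<Longrightarrow> r * g r - P r = p r"
    and \<phi>_deriv: "\<And>e. has_dir_deriv \<phi> (\<phi>' e) (st_dir e)"
    and cont_\<phi>: "continuous_on UNIV \<phi>" "\<And>e. continuous_on UNIV (\<phi>' e)"
    and \<phi>_periodic: "\<And>t x i. \<phi> (t, x + axis i 1) = \<phi> (t, x)"
    and \<phi>_support: "\<And>z. fst z \<notin> {2 * \<delta>..T - 2 * \<delta>} \<Longrightarrow> \<phi> z = 0"
      "\<And>z e. fst z \<notin> {2 * \<delta>..T - 2 * \<delta>} \<Longrightarrow> \<phi>' e z = 0"
begin

text \<open>
  \<open>hat\<close> is the space-time velocity $(1, u)$. The other names are those of lemma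
  \<open>energy_flux_identity\<close>, with \<open>mf\<close> for the mollified momentum flux; in \<open>dn e' e\<close> and
  \<open>dmf e' i e\<close> the first argument is the direction of differentiation.
\<close>

definition hat :: "'d option \<Rightarrow> real \<times> (real ^ 'd) \<Rightarrow> real" where
  "hat e z = (case e of None \<Rightarrow> 1 | Some j \<Rightarrow> u z $ j)"

definition v :: "'d \<Rightarrow> real \<times> (real ^ 'd) \<Rightarrow> real" where "v i = avg (\<lambda>w. u w $ i)"

definition dv :: "'d option \<Rightarrow> 'd \<Rightarrow> real \<times> (real ^ 'd) \<Rightarrow> real" where
  "dv e i = davg e (\<lambda>w. u w $ i)"

definition vh :: "'d option \<Rightarrow> real \<times> (real ^ 'd) \<Rightarrow> real" where
  "vh e z = (case e of None \<Rightarrow> 1 | Some j \<Rightarrow> v j z)"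

definition dvh :: "'d option \<Rightarrow> real \<times> (real ^ 'd) \<Rightarrow> real" where
  "dvh e z = (case e of None \<Rightarrow> 0 | Some j \<Rightarrow> dv e j z)"

definition space_part :: "'d option \<Rightarrow> real" where
  "space_part e = (case e of None \<Rightarrow> 0 | Some j \<Rightarrow> 1)"

abbreviation r where "r \<equiv> avg \<rho>"

abbreviation dr where "dr e \<equiv> davg e \<rho>"

abbreviation n where "n e \<equiv> avg (\<lambda>w. \<rho> w * hat e w)"

abbreviation dn where "dn e' e \<equiv> davg e' (\<lambda>w. \<rho> w * hat e w)"

abbreviation mf where "mf i e \<equiv> avg (\<lambda>w. (\<rho> w * hat e w) * u w $ i)"

abbreviation dmf where "dmf e' i e \<equiv> davg e' (\<lambda>w. (\<rho> w * hat e w) * u w $ i)"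

abbreviation \<pi> where "\<pi> \<equiv> avg (\<lambda>w. p (\<rho> w))"

abbreviation d\<pi> where "d\<pi> e \<equiv> davg e (\<lambda>w. p (\<rho> w))"

abbreviation L where "L \<equiv> avg (\<lambda>w. g (\<rho> w))"

abbreviation dL where "dL e \<equiv> davg e (\<lambda>w. g (\<rho> w))"

definition flux :: "'d option \<Rightarrow> real \<times> (real ^ 'd) \<Rightarrow> real" where
  "flux e z = 1 / 2 * (\<Sum>i\<in>UNIV. (v i z)\<^sup>2) * n e z + P (r z) * vh e z + space_part e * (\<pi> z * vh e z)"

definition mom_comm :: "'d \<Rightarrow> 'd option \<Rightarrow> real \<times> (real ^ 'd) \<Rightarrow> real" where
  "mom_comm i e z = n e z * v i z - mf i e z"

definition mass_comm :: "'d option \<Rightarrow> real \<times> (real ^ 'd) \<Rightarrow> real" where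
  "mass_comm e z = r z * vh e z - n e z"

definition mass_comm_deriv :: "'d option \<Rightarrow> real \<times> (real ^ 'd) \<Rightarrow> real" where
  "mass_comm_deriv e z = dr e z * vh e z + r z * dvh e z - dn e e z"

text \<open>
  The energy flux without the commutator fluxes. Subtracting them replaces derivatives of commutators
  by commutators, up to the term with \<open>g (r z) - L z\<close>, in lemma \<open>corr_flux_deriv_sum\<close>.
\<close>

definition corr_flux :: "'d option \<Rightarrow> real \<times> (real ^ 'd) \<Rightarrow> real" where
  "corr_flux e z = flux e z - (\<Sum>i\<in>UNIV. v i z * mom_comm i e z) - L z * mass_comm e z"

definition corr_flux_deriv :: "'d option \<Rightarrow> real \<times> (real ^ 'd) \<Rightarrow> real" where
  "corr_flux_deriv e z = (\<Sum>i\<in>UNIV. v i z * dv e i z) * n e z + 1 / 2 * (\<Sum>i\<in>UNIV. (v i z)\<^sup>2) * dn e e z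
       + (g (r z) * dr e z * vh e z + P (r z) * dvh e z) + space_part e * (d\<pi> e z * vh e z + \<pi> z * dvh e z)
       - (\<Sum>i\<in>UNIV. dv e i z * (n e z * v i z - mf i e z)
            + v i z * (dn e e z * v i z + n e z * dv e i z - dmf e i e z))
       - (dL e z * (r z * vh e z - n e z) + L z * (dr e z * vh e z + r z * dvh e z - dn e e z))"

lemma cont_comps:
  "continuous_on B (hat e)" "continuous_on B (\<lambda>w. \<rho> w * hat e w)"
  "continuous_on B (\<lambda>w. (\<rho> w * hat e w) * u w $ i)"
  "continuous_on B (\<lambda>w. p (\<rho> w))" "continuous_on B (\<lambda>w. g (\<rho> w))"
proof -
  show h: "continuous_on B (hat e)"
    unfolding hat_def by (cases e) (auto intro: cont_u)
  show "continuous_on B (\<lambda>w. \<rho> w * hat e w)" "continuous_on B (\<lambda>w. (\<rho> w * hat e w) * u w $ i)"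
    by (intro continuous_on_mult cont_\<rho> cont_u h)+
  show "continuous_on B (\<lambda>w. p (\<rho> w))" "continuous_on B (\<lambda>w. g (\<rho> w))"
    by (rule continuous_on_compose2[OF cont_p cont_\<rho>] continuous_on_compose2[OF cont_g cont_\<rho>]; simp)+
qed

lemma cont_smooth:
  "continuous_on A (v i)" "continuous_on A (vh e)" "continuous_on A (dv e i)" "continuous_on A (dvh e)"
  unfolding v_def dv_def vh_def dvh_def
  by (cases e; auto intro!: continuous_avg continuous_davg cont_u simp: v_def dv_def)+

lemma cont_P: "continuous_on UNIV P"
  by (meson DERIV_isCont continuous_at_imp_continuous_on P_deriv)

lemma continuous_corr_flux: "continuous_on A (corr_flux e)" and continuous_corr_flux_deriv: "continuous_on A (corr_flux_deriv e)"
proof -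
  have P: "continuous_on A (\<lambda>z. P (r z))" "continuous_on A (\<lambda>z. g (r z))"
    by (rule continuous_on_compose2[OF cont_P continuous_avg[OF cont_\<rho>]]
        continuous_on_compose2[OF cont_g continuous_avg[OF cont_\<rho>]]; simp)+
  note c = continuous_avg[OF cont_\<rho>] continuous_avg[OF cont_comps(2)] continuous_avg[OF cont_comps(3)]
    continuous_avg[OF cont_comps(4)] continuous_avg[OF cont_comps(5)]
    continuous_davg[OF cont_\<rho>] continuous_davg[OF cont_comps(2)] continuous_davg[OF cont_comps(3)]
    continuous_davg[OF cont_comps(4)] continuous_davg[OF cont_comps(5)]
  show "continuous_on A (corr_flux e)"
    unfolding corr_flux_def flux_def mom_comm_def mass_comm_def
    by (intro continuous_on_add continuous_on_diff continuous_on_mult continuous_on_sum continuous_on_power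
        continuous_on_const P c cont_smooth)
  show "continuous_on A (corr_flux_deriv e)"
    unfolding corr_flux_deriv_def
    by (intro continuous_on_add continuous_on_diff continuous_on_mult continuous_on_sum continuous_on_power
        continuous_on_const P c cont_smooth)
qed

lemma v_has_dir_deriv: "has_dir_deriv (v i) (dv e i) (st_dir e)"
  unfolding v_def dv_def by (rule avg_has_dir_deriv[OF cont_u])

lemma vh_has_dir_deriv: "has_dir_deriv (vh e) (dvh e) (st_dir e)"
proof (cases e)
  case None
  then show ?thesis
    using has_dir_deriv_const[of 1 "st_dir e"] by (rule_tac has_dir_deriv_cong) (auto simp: vh_def dvh_def)
next
  case (Some j)
  then show ?thesis
    using v_has_dir_deriv[of j e] by (rule_tac has_dir_deriv_cong) (auto simp: vh_def dvh_def)
qed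

lemma corr_flux_has_dir_deriv: "has_dir_deriv (corr_flux e) (corr_flux_deriv e) (st_dir e)"
proof -
  note n = avg_has_dir_deriv[OF cont_comps(2)[of e], of e]
  note dv = v_has_dir_deriv[of _ e]
  note dvh = vh_has_dir_deriv[of e]
  have 1: "has_dir_deriv (\<lambda>z. (\<Sum>i\<in>UNIV. v i z * v i z) * n e z)
      (\<lambda>z. (\<Sum>i\<in>UNIV. dv e i z * v i z + v i z * dv e i z) * n e z + (\<Sum>i\<in>UNIV. v i z * v i z) * dn e e z) (st_dir e)"
    by (intro has_dir_deriv_mult has_dir_deriv_sum dv n)
  have 2: "has_dir_deriv (\<lambda>z. P (r z) * vh e z)
      (\<lambda>z. g (r z) * dr e z * vh e z + P (r z) * dvh e z) (st_dir e)"
    by (intro has_dir_deriv_mult has_dir_deriv_compose[OF avg_has_dir_deriv[OF cont_\<rho>] P_deriv] dvh)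
  have 3: "has_dir_deriv (\<lambda>z. space_part e * (\<pi> z * vh e z))
      (\<lambda>z. 0 * (\<pi> z * vh e z) + space_part e * (d\<pi> e z * vh e z + \<pi> z * dvh e z)) (st_dir e)"
    by (intro has_dir_deriv_mult has_dir_deriv_const avg_has_dir_deriv[OF cont_comps(4)] dvh)
  have 4: "has_dir_deriv (\<lambda>z. \<Sum>i\<in>UNIV. v i z * (n e z * v i z - mf i e z))
      (\<lambda>z. \<Sum>i\<in>UNIV. dv e i z * (n e z * v i z - mf i e z)
            + v i z * (dn e e z * v i z + n e z * dv e i z - dmf e i e z)) (st_dir e)"
    by (intro has_dir_deriv_mult has_dir_deriv_sum has_dir_deriv_diff dv n avg_has_dir_deriv[OF cont_comps(3)])
  have 5: "has_dir_deriv (\<lambda>z. L z * (r z * vh e z - n e z))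
      (\<lambda>z. dL e z * (r z * vh e z - n e z) + L z * (dr e z * vh e z + r z * dvh e z - dn e e z)) (st_dir e)"
    by (intro has_dir_deriv_mult has_dir_deriv_diff avg_has_dir_deriv[OF cont_comps(5)]
        avg_has_dir_deriv[OF cont_\<rho>] dvh n)
  have 6: "has_dir_deriv (\<lambda>z. 1 / 2 * ((\<Sum>i\<in>UNIV. v i z * v i z) * n e z))
      (\<lambda>z. 0 * ((\<Sum>i\<in>UNIV. v i z * v i z) * n e z) +
        1 / 2 * ((\<Sum>i\<in>UNIV. dv e i z * v i z + v i z * dv e i z) * n e z + (\<Sum>i\<in>UNIV. v i z * v i z) * dn e e z)) (st_dir e)"
    by (intro has_dir_deriv_mult[OF has_dir_deriv_const 1])
  have kin: "1 / 2 * ((\<Sum>i\<in>UNIV. dv e i z * v i z + v i z * dv e i z) * n e z + (\<Sum>i\<in>UNIV. v i z * v i z) * dn e e z)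
     = (\<Sum>i\<in>UNIV. v i z * dv e i z) * n e z + 1 / 2 * (\<Sum>i\<in>UNIV. (v i z)\<^sup>2) * dn e e z" for z
  proof -
    have "(\<Sum>i\<in>UNIV. dv e i z * v i z + v i z * dv e i z) = 2 * (\<Sum>i\<in>UNIV. v i z * dv e i z)"
      by (simp add: sum_distrib_left mult.commute)
    then show ?thesis by (simp add: power2_eq_square algebra_simps)
  qed
  show ?thesis
    by (rule has_dir_deriv_cong[OF has_dir_deriv_diff[OF has_dir_deriv_diff[OF
          has_dir_deriv_add[OF has_dir_deriv_add[OF 6 2] 3] 4] 5]])
      (simp_all only: corr_flux_def flux_def mom_comm_def mass_comm_def corr_flux_deriv_def kin power2_eq_square mult.assoc mult_zero_left add_0_left)
qed

lemma corr_flux_periodic: "corr_flux e (t, x + axis i 1) = corr_flux e (t, x)"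
proof -
  have "vh e (t, x + axis i 1) = vh e (t, x)" for e
    by (cases e) (simp_all add: vh_def v_def avg_periodic)
  then show ?thesis
    unfolding corr_flux_def flux_def mom_comm_def mass_comm_def by (simp add: v_def avg_periodic)
qed

text \<open>
  Integration by parts. In space the integrand is periodic; in time \<open>\<phi>\<close> vanishes on the two layers
  that are compared, which have width $\delta/2$.
\<close>

lemma integral_test_flux: "integral B (\<lambda>z. \<phi>' e z * corr_flux e z + \<phi> z * corr_flux_deriv e z) = 0"
proof -
  define h where "h = (case e of None \<Rightarrow> \<delta> / 2 | Some j \<Rightarrow> 1)"
  have len: "((T - \<delta>, \<chi> i. 1) - (\<delta>, 0 :: real ^ 'd)) \<bullet> st_dir e = (case e of None \<Rightarrow> T - 2 * \<delta> | Some j \<Rightarrow> 1)"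
    by (cases e) (auto simp: inner_axis)
  have BB: "B = cbox (\<delta>, 0) (T - \<delta>, \<chi> i. 1)"
    by (simp only: B core_def)
  have "integral (cbox (\<delta>, 0) (T - \<delta>, \<chi> i. 1)) (\<lambda>z. \<phi>' e z * corr_flux e z + \<phi> z * corr_flux_deriv e z) = 0"
  proof (rule integral_dir_deriv_eq_0[OF st_dir_in_Basis[of e], where g="\<lambda>z. \<phi> z * corr_flux e z" and h=h])
    show "has_dir_deriv (\<lambda>z. \<phi> z * corr_flux e z) (\<lambda>z. \<phi>' e z * corr_flux e z + \<phi> z * corr_flux_deriv e z) (st_dir e)"
      by (intro has_dir_deriv_mult \<phi>_deriv corr_flux_has_dir_deriv)
    show "continuous_on UNIV (\<lambda>z. \<phi> z * corr_flux e z)" "continuous_on UNIV (\<lambda>z. \<phi>' e z * corr_flux e z + \<phi> z * corr_flux_deriv e z)"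
      by (intro continuous_on_add continuous_on_mult cont_\<phi> continuous_corr_flux continuous_corr_flux_deriv)+
    show "0 < h" "h \<le> ((T - \<delta>, \<chi> i. 1) - (\<delta>, 0 :: real ^ 'd)) \<bullet> st_dir e"
      unfolding len using \<delta> by (cases e; simp add: h_def)+
    fix z :: "real \<times> (real ^ 'd)"
    assume z: "(\<delta>, 0) \<bullet> st_dir e \<le> z \<bullet> st_dir e" "z \<bullet> st_dir e \<le> (\<delta>, 0) \<bullet> st_dir e + h"
    show "\<phi> (z + (((T - \<delta>, \<chi> i. 1) - (\<delta>, 0 :: real ^ 'd)) \<bullet> st_dir e) *\<^sub>R st_dir e) *
        corr_flux e (z + (((T - \<delta>, \<chi> i. 1) - (\<delta>, 0 :: real ^ 'd)) \<bullet> st_dir e) *\<^sub>R st_dir e) = \<phi> z * corr_flux e z"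
      unfolding len
    proof (cases e)
      case None
      then have "\<delta> \<le> fst z" "fst z \<le> \<delta> + \<delta> / 2" using z by (cases z; simp add: h_def)+
      then have "\<phi> z = 0" "\<phi> (z + (T - 2 * \<delta>) *\<^sub>R st_dir None) = 0"
        using \<delta> by (auto intro!: \<phi>_support)
      then show "\<phi> (z + (case e of None \<Rightarrow> T - 2 * \<delta> | Some j \<Rightarrow> 1) *\<^sub>R st_dir e) *
          corr_flux e (z + (case e of None \<Rightarrow> T - 2 * \<delta> | Some j \<Rightarrow> 1) *\<^sub>R st_dir e) = \<phi> z * corr_flux e z"
        using None by simp
    next
      case (Some j)
      then show "\<phi> (z + (case e of None \<Rightarrow> T - 2 * \<delta> | Some j \<Rightarrow> 1) *\<^sub>R st_dir e) *
          corr_flux e (z + (case e of None \<Rightarrow> T - 2 * \<delta> | Some j \<Rightarrow> 1) *\<^sub>R st_dir e) = \<phi> z * corr_flux e z"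
        by (cases z) (simp add: \<phi>_periodic corr_flux_periodic)
    qed
  qed
  then show ?thesis
    by (rule trans[OF arg_cong[OF BB, of "\<lambda>A. integral A (\<lambda>z. \<phi>' e z * corr_flux e z + \<phi> z * corr_flux_deriv e z)"]])
qed

end

section \<open>The energy defect at a fixed scale\<close>

lemma card_bound:
  assumes "\<And>i. \<bar>f i\<bar> \<le> c"
  shows "\<bar>\<Sum>i\<in>(UNIV :: 'b::finite set). f i\<bar> \<le> real CARD('b) * c"
  using sum_norm_bound[of UNIV f c] assms by simp

lemma abs_mult_bound: "\<bar>x\<bar> \<le> c \<Longrightarrow> \<bar>y\<bar> \<le> d \<Longrightarrow> \<bar>x * y\<bar> \<le> c * (d::real)"
  unfolding abs_mult by (rule mult_mono) (auto intro: order_trans[OF abs_ge_zero])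

lemma (in smoothing) integral_const_B: "integral B (\<lambda>w. c :: real) = c * measure lborel B"
  unfolding B core_def by (simp only: integral_const real_scaleR_def mult.commute)

text \<open>
  Here \<open>a\<close> and \<open>b\<close> bound the oscillations of the velocity and of density and momentum at scale
  \<open>\<epsilon>\<close>, whereas \<open>U\<close>, \<open>G\<close> and \<open>C\<close> are bounds that do not depend on the scale.
\<close>

locale euler_scale = euler_smoothing T \<delta> \<epsilon> M0 B \<rho> u p q P g lo hi H \<theta> \<phi> \<phi>'
  for T \<delta> \<epsilon> M0 :: real and B :: "(real \<times> (real ^ 'd)) set"
    and \<rho> :: "real \<times> (real ^ 'd) \<Rightarrow> real" and u :: "real \<times> (real ^ 'd) \<Rightarrow> real ^ 'd"
    and p q P g :: "real \<Rightarrow> real" and lo hi H \<theta> :: real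
    and \<phi> :: "real \<times> (real ^ 'd) \<Rightarrow> real" and \<phi>' :: "'d option \<Rightarrow> real \<times> (real ^ 'd) \<Rightarrow> real" +
  fixes a b U G C :: real
  assumes osc_u: "\<And>z i. z \<in> core (2 * \<delta>) T \<Longrightarrow> osc (\<lambda>w. u w $ i) z a"
    and osc_momentum: "\<And>z e. z \<in> core (2 * \<delta>) T \<Longrightarrow> osc (\<lambda>w. \<rho> w * hat e w) z b"
    and b: "0 < b"
    and u_bound: "\<And>w i. w \<in> B \<Longrightarrow> \<bar>u w $ i\<bar> \<le> U"
    and g_bound: "\<And>w. w \<in> B \<Longrightarrow> \<bar>g (\<rho> w)\<bar> \<le> G"
    and \<phi>_bound: "\<And>z. z \<in> B \<Longrightarrow> \<bar>\<phi> z\<bar> \<le> C" "\<And>z e. z \<in> B \<Longrightarrow> \<bar>\<phi>' e z\<bar> \<le> C"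
    and mass_eq: "\<And>z. z \<in> core (2 * \<delta>) T \<Longrightarrow> (\<Sum>e\<in>UNIV. dn e e z) = 0"
    and momentum_eq: "\<And>z i. z \<in> core (2 * \<delta>) T \<Longrightarrow> (\<Sum>e\<in>UNIV. dmf e i e z) + d\<pi> (Some i) z = 0"
    and U1: "1 \<le> U"
    and momentum_bound: "\<And>w e. w \<in> B \<Longrightarrow> \<bar>\<rho> w * hat e w\<bar> \<le> U"
    and potential_bound: "\<And>w. w \<in> B \<Longrightarrow> \<bar>P (\<rho> w)\<bar> \<le> U"
    and pressure_bound: "\<And>w. w \<in> B \<Longrightarrow> \<bar>p (\<rho> w)\<bar> \<le> U"
    and potential_lipschitz: "\<And>x y. x \<in> {lo..hi} \<Longrightarrow> y \<in> {lo..hi} \<Longrightarrow> \<bar>P x - P y\<bar> \<le> U * \<bar>x - y\<bar>"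
    and pressure_lipschitz: "\<And>x y. x \<in> {lo..hi} \<Longrightarrow> y \<in> {lo..hi} \<Longrightarrow> \<bar>p x - p y\<bar> \<le> U * \<bar>x - y\<bar>"
begin

text \<open>
  The three contributions come from: a test function derivative times a commutator of products; a
  velocity derivative times such a commutator; and the pressure terms, all of order
  \<open>\<kappa> * a * b powr (1 + \<theta>)\<close>.
\<close>

definition defect :: real where
  "defect = a * b + \<kappa> * a * a * b + \<kappa> * a * (b powr \<theta> * b)"

definition defect_const :: real where
  "defect_const = 2 * real CARD('d option) * C * (real CARD('d) * U + G + real CARD('d) + 5 * H)"

lemma near_subset: "w \<in> near z \<Longrightarrow> w \<in> B"
  by (simp add: near_def)

lemma hat_None: "(\<lambda>w. \<rho> w * hat None w) = \<rho>"
  by (simp add: hat_def)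

lemma hat_Some: "(\<lambda>w. \<rho> w * hat (Some j) w) = (\<lambda>w. \<rho> w * u w $ j)"
  by (simp add: hat_def)

lemma osc_\<rho>: "z \<in> core (2 * \<delta>) T \<Longrightarrow> osc \<rho> z b"
  using osc_momentum[of z None] by (simp add: hat_None)

context
  fixes z :: "real \<times> (real ^ 'd)" assumes z: "z \<in> core (2 * \<delta>) T"
begin

lemma a_nonneg: "0 \<le> a"
  by (rule osc_nonneg[OF z osc_u[OF z]])

lemma v_bound: "\<bar>v i z\<bar> \<le> U"
  unfolding v_def by (rule avg_bound[OF z cont_u u_bound[OF near_subset]])

lemma L_bound: "\<bar>L z\<bar> \<le> G"
  by (rule avg_bound[OF z cont_comps(5) g_bound[OF near_subset]])

lemma r_range: "lo \<le> r z" "r z \<le> hi"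
proof -
  have "\<bar>avg (\<lambda>w. \<rho> w - (lo + hi) / 2) z\<bar> \<le> (hi - lo) / 2"
  proof (rule avg_bound[OF z])
    show "continuous_on B (\<lambda>w. \<rho> w - (lo + hi) / 2)"
      by (intro continuous_on_diff cont_\<rho> continuous_on_const)
    show "\<bar>\<rho> w - (lo + hi) / 2\<bar> \<le> (hi - lo) / 2" if "w \<in> near z" for w
    proof -
      have "lo \<le> \<rho> w" "\<rho> w \<le> hi" using range_\<rho>[OF near_subset[OF that]] by auto
      then show ?thesis by (simp add: abs_le_iff field_simps)
    qed
  qed
  then have "\<bar>r z - (lo + hi) / 2\<bar> \<le> (hi - lo) / 2"
    by (simp only: avg_shift[OF z cont_\<rho>])
  then have "r z - (lo + hi) / 2 \<le> (hi - lo) / 2" "- (r z - (lo + hi) / 2) \<le> (hi - lo) / 2"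
    by (simp_all only: abs_le_iff)
  then show "lo \<le> r z" "r z \<le> hi" by (simp_all add: field_simps)
qed

lemma mom_comm_bound: "\<bar>mom_comm i e z\<bar> \<le> 2 * (a * b)"
  using commutator_bound[OF z osc_momentum[OF z, of e] osc_u[OF z, of i]]
  by (simp add: mom_comm_def v_def mult.commute[of a])

lemma mass_comm_bound: "\<bar>mass_comm e z\<bar> \<le> 2 * (a * b)"
proof (cases e)
  case None
  then show ?thesis using a_nonneg b by (simp add: mass_comm_def vh_def hat_None)
next
  case (Some j)
  then show ?thesis
    using commutator_bound[OF z osc_\<rho>[OF z] osc_u[OF z, of j]]
    by (simp add: mass_comm_def vh_def hat_Some v_def mult.commute[of a])
qed

lemma mass_comm_deriv_bound: "\<bar>mass_comm_deriv e z\<bar> \<le> 3 * (\<kappa> * a * b)"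
proof (cases e)
  case None
  then show ?thesis using a_nonneg b \<kappa>_pos by (simp add: mass_comm_deriv_def vh_def dvh_def hat_None)
next
  case (Some j)
  then show ?thesis
    using commutator_deriv_bound[OF z osc_\<rho>[OF z] osc_u[OF z, of j], of e]
    by (simp add: mass_comm_deriv_def vh_def dvh_def hat_Some v_def dv_def mult_ac)
qed

lemma dv_bound: "\<bar>dv e i z\<bar> \<le> \<kappa> * a"
  unfolding dv_def by (rule davg_osc[OF z osc_u[OF z]])

lemma dvh_bound: "\<bar>dvh e z\<bar> \<le> \<kappa> * a"
  using dv_bound a_nonneg \<kappa>_pos by (cases e) (simp_all add: dvh_def)

lemma dL_bound: "\<bar>dL e z\<bar> \<le> \<kappa> * (H * b powr \<theta>)"
proof (rule davg_osc[OF z])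
  have "\<bar>g (\<rho> w) - g (\<rho> z)\<bar> \<le> H * b powr \<theta>" if "w \<in> near z" for w
  proof -
    have "\<bar>\<rho> w - \<rho> z\<bar> powr \<theta> \<le> b powr \<theta>"
      using osc_\<rho>[OF z] that \<theta> by (intro powr_mono2) (auto simp: osc_def)
    then show ?thesis
      using g_holder[of "\<rho> w" "\<rho> z"] mult_left_mono[OF _ H] order_trans by blast
  qed
  then show "osc (\<lambda>w. g (\<rho> w)) z (H * b powr \<theta>)"
    using cont_comps(5) by (simp add: osc_def)
qed

lemma pressure_commutator: "\<bar>p (r z) - \<pi> z\<bar> \<le> 2 * H * (b powr \<theta> * b)"
  using nonlinear_commutator_bound[OF z osc_\<rho>[OF z] cont_p p_taylor H] \<theta> b
  by (simp add: powr_add mult.commute)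

lemma g_commutator: "\<bar>g (r z) - L z\<bar> \<le> 2 * H * b powr \<theta>"
  using nonlinear_commutator_bound[OF z osc_\<rho>[OF z] cont_g, of "\<lambda>_. 0" H \<theta>] g_holder H \<theta>
  by simp

lemma corr_flux_deriv_sum:
  "(\<Sum>e\<in>UNIV. corr_flux_deriv e z) = - (\<Sum>e\<in>UNIV. \<Sum>i\<in>UNIV. dv e i z * mom_comm i e z) - (p (r z) - \<pi> z) * (\<Sum>e\<in>UNIV. dvh e z)
     + (g (r z) - L z) * (\<Sum>e\<in>UNIV. mass_comm_deriv e z) - (\<Sum>e\<in>UNIV. dL e z * mass_comm e z)"
  unfolding corr_flux_deriv_def mom_comm_def mass_comm_def mass_comm_deriv_def
  by (rule energy_flux_identity[where v="\<lambda>i. v i z" and dn="\<lambda>e. dn e e z" and dq="\<lambda>i e. dmf e i e z"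
        and d\<pi>="\<lambda>e. d\<pi> e z" and sp=space_part, OF mass_eq[OF z] momentum_eq[OF z] pressure[OF r_range]])
    (simp_all add: vh_def dvh_def space_part_def)

text \<open>
  Of the four sums, the first is of order \<open>\<kappa> * a\<close> times \<open>a * b\<close>. In the others,
  the regularity of \<open>p\<close> or \<open>g\<close> yields a power of \<open>b\<close>; their orders are
  \<open>b powr (1 + \<theta>)\<close> times \<open>\<kappa> * a\<close>, then \<open>b powr \<theta>\<close> times \<open>\<kappa> * a * b\<close>, and
  \<open>\<kappa> * b powr \<theta>\<close> times \<open>a * b\<close>.
\<close>

lemma corr_flux_deriv_sum_bound: "\<bar>\<Sum>e\<in>UNIV. corr_flux_deriv e z\<bar> \<le> real CARD('d option) * (2 * real CARD('d) * (\<kappa> * a * a * b) + 10 * H * (\<kappa> * a * (b powr \<theta> * b)))"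
proof -
  have 1: "\<bar>\<Sum>e\<in>UNIV. \<Sum>i\<in>UNIV. dv e i z * mom_comm i e z\<bar> \<le> real CARD('d option) * (real CARD('d) * (\<kappa> * a * (2 * (a * b))))"
    by (intro card_bound abs_mult_bound dv_bound mom_comm_bound)
  have 2: "\<bar>(p (r z) - \<pi> z) * (\<Sum>e\<in>UNIV. dvh e z)\<bar> \<le> (2 * H * (b powr \<theta> * b)) * (real CARD('d option) * (\<kappa> * a))"
    by (intro abs_mult_bound pressure_commutator card_bound dvh_bound)
  have 3: "\<bar>(g (r z) - L z) * (\<Sum>e\<in>UNIV. mass_comm_deriv e z)\<bar> \<le> (2 * H * b powr \<theta>) * (real CARD('d option) * (3 * (\<kappa> * a * b)))"
    by (intro abs_mult_bound g_commutator card_bound mass_comm_deriv_bound)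
  have 4: "\<bar>\<Sum>e\<in>UNIV. dL e z * mass_comm e z\<bar> \<le> real CARD('d option) * (\<kappa> * (H * b powr \<theta>) * (2 * (a * b)))"
    by (intro card_bound abs_mult_bound dL_bound mass_comm_bound)
  have "\<bar>\<Sum>e\<in>UNIV. corr_flux_deriv e z\<bar> \<le> real CARD('d option) * (real CARD('d) * (\<kappa> * a * (2 * (a * b)))) + (2 * H * (b powr \<theta> * b)) * (real CARD('d option) * (\<kappa> * a))
      + (2 * H * b powr \<theta>) * (real CARD('d option) * (3 * (\<kappa> * a * b))) + real CARD('d option) * (\<kappa> * (H * b powr \<theta>) * (2 * (a * b)))"
    unfolding corr_flux_deriv_sum using 1 2 3 4 by linarith
  also have "\<dots> = real CARD('d option) * (2 * real CARD('d) * (\<kappa> * a * a * b) + 10 * H * (\<kappa> * a * (b powr \<theta> * b)))"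
    by (simp add: algebra_simps)
  finally show ?thesis .
qed

lemma pointwise_defect:
  "\<bar>(\<Sum>e\<in>UNIV. \<phi>' e z * flux e z) - (\<Sum>e\<in>UNIV. \<phi>' e z * corr_flux e z + \<phi> z * corr_flux_deriv e z)\<bar>
    \<le> defect_const * defect"
proof -
  let ?m = "real CARD('d)" and ?m1 = "real CARD('d option)"
  let ?E1 = "a * b" and ?E2 = "\<kappa> * a * a * b" and ?E3 = "\<kappa> * a * (b powr \<theta> * b)"
  have eq: "(\<Sum>e\<in>UNIV. \<phi>' e z * flux e z) - (\<Sum>e\<in>UNIV. \<phi>' e z * corr_flux e z + \<phi> z * corr_flux_deriv e z)
     = (\<Sum>e\<in>UNIV. \<phi>' e z * ((\<Sum>i\<in>UNIV. v i z * mom_comm i e z) + L z * mass_comm e z)) - \<phi> z * (\<Sum>e\<in>UNIV. corr_flux_deriv e z)"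
    by (simp add: corr_flux_def sum.distrib sum_subtractf sum_distrib_left algebra_simps)
  have 1: "\<bar>\<Sum>e\<in>UNIV. \<phi>' e z * ((\<Sum>i\<in>UNIV. v i z * mom_comm i e z) + L z * mass_comm e z)\<bar>
      \<le> ?m1 * (C * (?m * (U * (2 * (a * b))) + G * (2 * (a * b))))"
  proof (intro card_bound abs_mult_bound \<phi>_bound[OF inner_near(4)[OF z]])
    show "\<bar>(\<Sum>i\<in>UNIV. v i z * mom_comm i e z) + L z * mass_comm e z\<bar> \<le> ?m * (U * (2 * (a * b))) + G * (2 * (a * b))" for e
      by (rule order_trans[OF abs_triangle_ineq])
        (intro add_mono card_bound abs_mult_bound v_bound mom_comm_bound L_bound mass_comm_bound)
  qed
  have 2: "\<bar>\<phi> z * (\<Sum>e\<in>UNIV. corr_flux_deriv e z)\<bar> \<le> C * (?m1 * (2 * ?m * ?E2 + 10 * H * ?E3))"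
    by (intro abs_mult_bound \<phi>_bound[OF inner_near(4)[OF z]] corr_flux_deriv_sum_bound)
  have "0 \<le> C" using \<phi>_bound(1)[OF inner_near(4)[OF z]] by linarith
  moreover have "0 \<le> U" using v_bound[of undefined] by linarith
  moreover have "0 \<le> G" using L_bound by linarith
  ultimately have nn: "0 \<le> ?m1 * C" "0 \<le> ?m * U + G" "0 \<le> ?m" by auto
  have E: "0 \<le> ?E1" "0 \<le> ?E2" "0 \<le> ?E3"
    using a_nonneg b \<kappa>_pos by auto
  have "2 * (?m * U + G) * ?E1 + 2 * ?m * ?E2 + 10 * H * ?E3
      \<le> 2 * (?m * U + G + ?m + 5 * H) * ?E1 + 2 * (?m * U + G + ?m + 5 * H) * ?E2 + 2 * (?m * U + G + ?m + 5 * H) * ?E3"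
    using nn E H by (intro add_mono mult_right_mono) auto
  then have "?m1 * C * (2 * (?m * U + G) * ?E1 + 2 * ?m * ?E2 + 10 * H * ?E3)
      \<le> ?m1 * C * (2 * (?m * U + G + ?m + 5 * H) * ?E1 + 2 * (?m * U + G + ?m + 5 * H) * ?E2 + 2 * (?m * U + G + ?m + 5 * H) * ?E3)"
    by (rule mult_left_mono[OF _ nn(1)])
  moreover have "?m1 * (C * (?m * (U * (2 * (a * b))) + G * (2 * (a * b)))) + C * (?m1 * (2 * ?m * ?E2 + 10 * H * ?E3))
      = ?m1 * C * (2 * (?m * U + G) * ?E1 + 2 * ?m * ?E2 + 10 * H * ?E3)"
    by (simp add: algebra_simps)
  moreover have "defect_const * defect
     = ?m1 * C * (2 * (?m * U + G + ?m + 5 * H) * ?E1 + 2 * (?m * U + G + ?m + 5 * H) * ?E2 + 2 * (?m * U + G + ?m + 5 * H) * ?E3)"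
    by (simp add: defect_const_def defect_def algebra_simps)
  ultimately show ?thesis
    unfolding eq using 1 2 by linarith
qed

end

lemma continuous_flux: "continuous_on B (\<lambda>z. \<Sum>e\<in>UNIV. \<phi>' e z * flux e z)"
proof -
  have "continuous_on B (\<lambda>z. P (r z))"
    by (rule continuous_on_compose2[OF cont_P continuous_avg[OF cont_\<rho>]]) simp
  then have "continuous_on B (flux e)" for e
    unfolding flux_def
    by (intro continuous_on_add continuous_on_mult continuous_on_sum continuous_on_power
      continuous_on_const continuous_avg cont_comps cont_smooth)
  then show ?thesis
    by (intro continuous_on_sum continuous_on_mult continuous_on_subset[OF cont_\<phi>(2)]) auto
qed

text \<open>
  By \<open>integral_test_flux\<close> the integral does not change when the divergence of the test function times
  the corrected flux is subtracted from the integrand, which then is pointwise small.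
\<close>

lemma energy_defect:
  "\<bar>integral B (\<lambda>z. \<Sum>e\<in>UNIV. \<phi>' e z * flux e z)\<bar>
    \<le> defect_const * defect * measure lborel B"
proof -
  let ?F = "\<lambda>z. \<Sum>e\<in>UNIV. \<phi>' e z * flux e z"
  let ?Z = "\<lambda>z. \<Sum>e\<in>UNIV. \<phi>' e z * corr_flux e z + \<phi> z * corr_flux_deriv e z"
  let ?K = "defect_const * defect"
  have contZ1: "continuous_on B (\<lambda>z. \<phi>' e z * corr_flux e z + \<phi> z * corr_flux_deriv e z)" for e
    by (intro continuous_on_add continuous_on_mult continuous_corr_flux continuous_corr_flux_deriv
        continuous_on_subset[OF cont_\<phi>(1)] continuous_on_subset[OF cont_\<phi>(2)]) auto
  then have contZ: "continuous_on B ?Z" by (intro continuous_on_sum)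
  have Z: "integral B ?Z = 0"
    by (subst integral_sum) (auto simp: integral_test_flux intro!: integrable_B contZ1)
  have nn: "0 \<le> ?K"
  proof -
    have c: "centre T \<in> core (2 * \<delta>) T"
      using \<delta> by (auto simp: mem_core centre_def)
    show ?thesis
      by (rule order_trans[OF abs_ge_zero pointwise_defect[OF c]])
  qed
  have bound: "norm (?F z - ?Z z) \<le> ?K" if zB: "z \<in> B" for z
  proof (cases "z \<in> core (2 * \<delta>) T")
    case True
    then show ?thesis unfolding real_norm_def by (rule pointwise_defect)
  next
    case False
    then have "fst z \<notin> {2 * \<delta>..T - 2 * \<delta>}"
      using zB by (auto simp: B mem_core)
    then have "?F z = 0" "?Z z = 0" using \<phi>_support by simp_all
    then show ?thesis using nn by simp
  qed
  have int: "(\<lambda>z. ?F z - ?Z z) integrable_on B"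
    by (intro integrable_B continuous_on_diff continuous_flux contZ)
  have eq: "integral B ?F = integral B (\<lambda>z. ?F z - ?Z z)"
    using integral_diff[OF integrable_B[OF continuous_flux] integrable_B[OF contZ]] Z by linarith
  have "norm (integral B (\<lambda>z. ?F z - ?Z z)) \<le> integral B (\<lambda>z. ?K)"
    by (intro integral_norm_bound_integral int bound integrable_B continuous_on_const)
  then show ?thesis unfolding eq integral_const_B real_norm_def .
qed

text \<open>
  The energy flux of the solution itself, which does not depend on the scale.
\<close>

definition limit_flux :: "'d option \<Rightarrow> real \<times> (real ^ 'd) \<Rightarrow> real" where
  "limit_flux e z = 1 / 2 * (\<Sum>i\<in>UNIV. (u z $ i)\<^sup>2) * (\<rho> z * hat e z) + P (\<rho> z) * hat e z
     + space_part e * (p (\<rho> z) * hat e z)"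

context
  fixes z :: "real \<times> (real ^ 'd)" assumes z: "z \<in> core (2 * \<delta>) T"
begin

lemma flux_error: "\<bar>flux e z - limit_flux e z\<bar> \<le> (real CARD('d) + 2) * U\<^sup>2 * (a + b)"
proof -
  have zB: "z \<in> B" by (rule inner_near(4)[OF z])
  note a0 = a_nonneg[OF z]
  have U0: "0 \<le> U" "U \<le> U\<^sup>2" using U1 by (auto simp: power2_eq_square)
  have v: "\<bar>v i z\<bar> \<le> U" "\<bar>u z $ i\<bar> \<le> U" "\<bar>v i z - u z $ i\<bar> \<le> a" for i
    using v_bound[OF z] u_bound[OF zB] avg_osc[OF z osc_u[OF z]] by (auto simp: v_def)
  have n: "\<bar>n e z\<bar> \<le> U" "\<bar>n e z - \<rho> z * hat e z\<bar> \<le> b"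
    using avg_bound[OF z cont_comps(2) momentum_bound[OF near_subset]] avg_osc[OF z osc_momentum[OF z]] by auto
  have vh: "\<bar>vh e z\<bar> \<le> U" "\<bar>vh e z - hat e z\<bar> \<le> a"
    using v U1 a0 by (cases e; simp add: vh_def hat_def)+
  have \<rho>z: "\<rho> z \<in> {lo..hi}" "r z \<in> {lo..hi}" using range_\<rho>[OF zB] r_range[OF z] by auto
  have "\<bar>P (r z) - P (\<rho> z)\<bar> \<le> U * \<bar>r z - \<rho> z\<bar>"
    by (rule potential_lipschitz[OF \<rho>z(2,1)])
  also have "\<dots> \<le> U * b" by (rule mult_left_mono[OF avg_osc[OF z osc_\<rho>[OF z]] U0(1)])
  finally have P: "\<bar>P (r z) - P (\<rho> z)\<bar> \<le> U * b" .
  have "osc (\<lambda>w. p (\<rho> w)) z (U * b)"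
    unfolding osc_def
  proof (intro conjI ballI cont_comps)
    fix w assume w: "w \<in> near z"
    then have "\<rho> w \<in> {lo..hi}" using range_\<rho>[OF near_subset[OF w]] by auto
    then have "\<bar>p (\<rho> w) - p (\<rho> z)\<bar> \<le> U * \<bar>\<rho> w - \<rho> z\<bar>" by (rule pressure_lipschitz[OF _ \<rho>z(1)])
    also have "\<dots> \<le> U * b"
      using osc_\<rho>[OF z] w by (intro mult_left_mono[OF _ U0(1)]) (auto simp: osc_def)
    finally show "\<bar>p (\<rho> w) - p (\<rho> z)\<bar> \<le> U * b" .
  qed
  from avg_osc[OF z this] have \<pi>: "\<bar>\<pi> z - p (\<rho> z)\<bar> \<le> U * b" .
  have prod: "\<bar>x * vh e z - y * hat e z\<bar> \<le> U\<^sup>2 * (a + b)" if "\<bar>x - y\<bar> \<le> U * b" "\<bar>y\<bar> \<le> U" for x y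
  proof -
    have "\<bar>(x - y) * vh e z\<bar> \<le> (U * b) * U" "\<bar>y * (vh e z - hat e z)\<bar> \<le> U * a"
      by (rule abs_mult_bound[OF that(1) vh(1)], rule abs_mult_bound[OF that(2) vh(2)])
    moreover have "U * a \<le> U\<^sup>2 * a" using U0 a0 by (rule_tac mult_right_mono) auto
    moreover have "x * vh e z - y * hat e z = (x - y) * vh e z + y * (vh e z - hat e z)"
      by (simp add: algebra_simps)
    ultimately show ?thesis by (simp add: algebra_simps power2_eq_square)
  qed
  have sq: "\<bar>(v i z)\<^sup>2 - (u z $ i)\<^sup>2\<bar> \<le> (2 * U) * a" for i
  proof -
    have "\<bar>v i z + u z $ i\<bar> \<le> 2 * U" using v(1,2)[of i] by linarith
    from abs_mult_bound[OF this v(3)[of i]] show ?thesis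
      by (simp add: power2_eq_square algebra_simps)
  qed
  have u2: "\<bar>(u z $ i)\<^sup>2\<bar> \<le> U * U" for i
    using abs_mult_bound[OF v(2) v(2), of i i] by (simp add: power2_eq_square)
  let ?m = "real CARD('d)"
  let ?V = "\<Sum>i\<in>UNIV. (v i z)\<^sup>2" and ?W = "\<Sum>i\<in>UNIV. (u z $ i)\<^sup>2"
  have "\<bar>?V - ?W\<bar> \<le> ?m * ((2 * U) * a)"
    unfolding sum_subtractf[symmetric] by (rule card_bound[OF sq])
  from abs_mult_bound[OF this n(1)]
  have k1: "\<bar>(?V - ?W) * n e z\<bar> \<le> ?m * ((2 * U) * a) * U" .
  have "\<bar>?W\<bar> \<le> ?m * (U * U)" by (rule card_bound[OF u2])
  from abs_mult_bound[OF this n(2)]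
  have k2: "\<bar>?W * (n e z - \<rho> z * hat e z)\<bar> \<le> ?m * (U * U) * b" .
  have k2': "?m * (U * U) * b \<le> 2 * (?m * (U * U) * b)"
    using b U0 by simp
  have half: "\<bar>1 / 2 * (x + y)\<bar> \<le> 1 / 2 * (c + d)" if "\<bar>x\<bar> \<le> c" "\<bar>y\<bar> \<le> d" for x y c d :: real
    using that abs_triangle_ineq[of x y] unfolding abs_mult by simp
  have "1 / 2 * ?V * n e z - 1 / 2 * ?W * (\<rho> z * hat e z)
      = 1 / 2 * ((?V - ?W) * n e z + ?W * (n e z - \<rho> z * hat e z))"
    by (simp add: algebra_simps)
  also have "\<bar>\<dots>\<bar> \<le> 1 / 2 * (?m * ((2 * U) * a) * U + 2 * (?m * (U * U) * b))"
    by (rule half[OF k1 order_trans[OF k2 k2']])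
  also have "\<dots> = ?m * U\<^sup>2 * (a + b)"
    by (simp add: power2_eq_square algebra_simps)
  finally have K: "\<bar>1 / 2 * ?V * n e z - 1 / 2 * ?W * (\<rho> z * hat e z)\<bar> \<le> ?m * U\<^sup>2 * (a + b)" .
  have Q: "\<bar>P (r z) * vh e z - P (\<rho> z) * hat e z\<bar> \<le> U\<^sup>2 * (a + b)"
    by (rule prod[OF P potential_bound[OF zB]])
  have "\<bar>\<pi> z * vh e z - p (\<rho> z) * hat e z\<bar> \<le> U\<^sup>2 * (a + b)"
    by (rule prod[OF \<pi> pressure_bound[OF zB]])
  then have Sp: "\<bar>space_part e * (\<pi> z * vh e z) - space_part e * (p (\<rho> z) * hat e z)\<bar> \<le> U\<^sup>2 * (a + b)"
    using a0 b by (cases e) (auto simp: space_part_def)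
  have "(?m + 2) * U\<^sup>2 * (a + b) = ?m * U\<^sup>2 * (a + b) + U\<^sup>2 * (a + b) + U\<^sup>2 * (a + b)"
    by (simp add: algebra_simps)
  with K Q Sp show ?thesis
    unfolding flux_def limit_flux_def by linarith
qed

end

lemma continuous_limit_flux: "continuous_on B (\<lambda>z. \<Sum>e\<in>UNIV. \<phi>' e z * limit_flux e z)"
proof -
  have "continuous_on B (\<lambda>z. P (\<rho> z))"
    by (rule continuous_on_compose2[OF cont_P cont_\<rho>]) simp
  then have "continuous_on B (limit_flux e)" for e
    unfolding limit_flux_def
    by (intro continuous_on_add continuous_on_mult continuous_on_sum continuous_on_power
        continuous_on_const cont_comps cont_u cont_\<rho>)
  then show ?thesis
    by (intro continuous_on_sum continuous_on_mult continuous_on_subset[OF cont_\<phi>(2)]) auto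
qed

lemma energy_defect_limit:
  "\<bar>integral B (\<lambda>z. \<Sum>e\<in>UNIV. \<phi>' e z * limit_flux e z)\<bar>
    \<le> (defect_const * defect + real CARD('d option) * (C * ((real CARD('d) + 2) * U\<^sup>2 * (a + b)))) * measure lborel B"
proof -
  let ?F = "\<lambda>z. \<Sum>e\<in>UNIV. \<phi>' e z * flux e z"
  let ?FL = "\<lambda>z. \<Sum>e\<in>UNIV. \<phi>' e z * limit_flux e z"
  let ?K = "real CARD('d option) * (C * ((real CARD('d) + 2) * U\<^sup>2 * (a + b)))"
  have c: "centre T \<in> core (2 * \<delta>) T"
    using \<delta> by (auto simp: mem_core centre_def)
  have diff: "\<bar>?F z - ?FL z\<bar> \<le> ?K" if "z \<in> B" for z
  proof (cases "z \<in> core (2 * \<delta>) T")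
    case True
    have "?F z - ?FL z = (\<Sum>e\<in>UNIV. \<phi>' e z * (flux e z - limit_flux e z))"
      by (rule trans[OF sum_subtractf[symmetric]]) (simp only: right_diff_distrib)
    also have "\<bar>\<dots>\<bar> \<le> ?K"
      by (intro card_bound abs_mult_bound \<phi>_bound[OF that] flux_error[OF True])
    finally show ?thesis .
  next
    case False
    then have "fst z \<notin> {2 * \<delta>..T - 2 * \<delta>}"
      using that by (auto simp: B mem_core)
    then have "?F z = 0" "?FL z = 0" using \<phi>_support by simp_all
    moreover have "0 \<le> C" using \<phi>_bound(1)[OF that] by linarith
    ultimately show ?thesis using a_nonneg[OF c] b by simp
  qed
  have int: "(\<lambda>z. ?F z - ?FL z) integrable_on B"
    by (intro integrable_B continuous_on_diff continuous_flux continuous_limit_flux)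
  have "norm (integral B (\<lambda>z. ?F z - ?FL z)) \<le> integral B (\<lambda>z. ?K)"
    unfolding real_norm_def[symmetric]
    by (intro integral_norm_bound_integral int integrable_B continuous_on_const) (simp only: real_norm_def diff)
  moreover have "integral B (\<lambda>z. ?F z - ?FL z) = integral B ?F - integral B ?FL"
    by (intro integral_diff integrable_B continuous_flux continuous_limit_flux)
  ultimately show ?thesis
    using energy_defect unfolding integral_const_B real_norm_def distrib_right by linarith
qed

end

section \<open>The weak formulation and functions on the torus\<close>

text \<open>
  The weak formulation uses the Lebesgue integral over a domain open in time, the mollification the
  gauge integral over a compact box.
\<close>

lemma LINT_fundamental_domain:
  fixes h :: "real \<times> (real ^ 'd) \<Rightarrow> real"
  assumes \<delta>: "0 < \<delta>" and h: "continuous_on (core \<delta> T) h"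
    and supp: "\<And>w. fst w \<notin> {\<delta>..T - \<delta>} \<Longrightarrow> h w = 0"
  shows "(LINT w:fundamental_domain T|lborel. h w) = integral (core \<delta> T) h"
proof -
  have eq: "indicator (fundamental_domain T) w *\<^sub>R h w = indicator (core \<delta> T) w *\<^sub>R h w" for w
  proof (cases "fst w \<in> {\<delta>..T - \<delta>}")
    case True
    then have "w \<in> fundamental_domain T \<longleftrightarrow> w \<in> core \<delta> T"
      using \<delta> by (cases w) (auto simp: fundamental_domain_def mem_core mem_box_cart)
    then show ?thesis by (simp add: indicator_def)
  qed (simp add: supp)
  have "set_integrable lborel (core \<delta> T) h"
    unfolding set_integrable_def
    by (rule borel_integrable_compact[OF _ h]) (simp add: core_def)
  from set_borel_integral_eq_integral(2)[OF this] show ?thesis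
    unfolding set_lebesgue_integral_def eq .
qed

text \<open>
  The set where one of the bounds fails is open, and a nonempty open set is not a null set.
\<close>

lemma AE_bounds_imp_bounds:
  fixes f :: "'a::euclidean_space \<Rightarrow> real"
  assumes S: "open S" "continuous_on S f" and ae: "AE z in lborel. z \<in> S \<longrightarrow> lo \<le> f z \<and> f z \<le> hi"
    and z: "z \<in> S"
  shows "lo \<le> f z \<and> f z \<le> hi"
proof -
  let ?A = "S \<inter> f -` (- {lo..hi})"
  have op: "open ?A" using S by (intro continuous_open_preimage) auto
  have "AE z in lborel. z \<notin> ?A" using ae by eventually_elim auto
  then have "?A \<in> null_sets lborel"
    using op by (subst AE_iff_null_sets) auto
  then have "negligible ?A"
    by (simp add: negligible_iff_null_sets null_sets_completionI)
  then have "?A = {}" using op open_not_negligible by blast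
  then show ?thesis using z by auto
qed

lemma periodic_int_shift:
  assumes "space_periodic_on (spacetime T) f" "t \<in> {0<..<T}"
  shows "f (t, x + (\<Sum>i\<in>I. of_int (k i) *\<^sub>R axis i 1)) = f (t, x)"
proof -
  have 1: "f (t, x + axis i 1) = f (t, x)" for x i
    using assms by (auto simp: space_periodic_on_def spacetime_def)
  have nat: "f (t, x + real n *\<^sub>R axis i 1) = f (t, x)" for n x i
  proof (induction n)
    case (Suc n)
    then show ?case using 1[of "x + real n *\<^sub>R axis i 1" i] by (simp add: algebra_simps)
  qed simp
  have int: "f (t, x + of_int m *\<^sub>R axis i 1) = f (t, x)" for m x i
  proof (cases "m \<ge> 0")
    case True
    then show ?thesis using nat[of x "nat m" i] by simp
  next
    case False
    then show ?thesis using nat[of "x + of_int m *\<^sub>R axis i 1" "nat (- m)" i] by (simp add: algebra_simps)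
  qed
  show ?thesis
  proof (induction I rule: infinite_finite_induct)
    case (insert i I)
    have "x + (\<Sum>i\<in>insert i I. of_int (k i) *\<^sub>R axis i 1)
        = (x + (\<Sum>i\<in>I. of_int (k i) *\<^sub>R axis i 1)) + of_int (k i) *\<^sub>R axis i 1"
      unfolding sum.insert[OF insert.hyps] by (simp only: ac_simps)
    then show ?case by (simp only: int insert.IH)
  qed auto
qed

text \<open>
  Shifting \<open>w\<close> by the integer vector nearest to the difference in space makes the Euclidean distance
  at most a constant times \<open>\<epsilon>\<close>.
\<close>

lemma holder_torus_near:
  fixes f :: "real \<times> (real ^ 'd) \<Rightarrow> 'b::metric_space"
  assumes per: "space_periodic_on (spacetime T) f"
    and C: "\<And>z w. z \<in> spacetime T \<Longrightarrow> w \<in> spacetime T \<Longrightarrow> dist (f z) (f w) \<le> C * dist z w powr \<alpha>" "0 \<le> C"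
    and \<alpha>: "0 \<le> \<alpha>" and \<epsilon>: "0 < \<epsilon>" and zw: "z \<in> spacetime T" "w \<in> spacetime T"
    and near: "torus_norm_sq (z - w) < \<epsilon>\<^sup>2"
  shows "dist (f w) (f z) \<le> C * (real CARD('d) + 1) powr \<alpha> * \<epsilon> powr \<alpha>"
proof -
  obtain t x s y where z: "z = (t, x)" and w: "w = (s, y)" by (cases z, cases w)
  define k where "k i = round (x $ i - y $ i)" for i
  define y' where "y' = y + (\<Sum>i\<in>UNIV. of_int (k i) *\<^sub>R axis i 1)"
  have y': "y' $ i = y $ i + of_int (k i)" for i
  proof -
    have "(\<Sum>i\<in>UNIV. of_int (k i) *\<^sub>R axis i 1) = (\<chi> i. real_of_int (k i))"
      using basis_expansion[of "\<chi> i. real_of_int (k i)"] by (simp add: scalar_mult_eq_scaleR)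
    then show ?thesis by (simp add: y'_def)
  qed
  have s: "s \<in> {0<..<T}" using zw(2) by (simp add: w spacetime_def)
  have fw: "f w = f (s, y')"
    unfolding w y'_def by (rule periodic_int_shift[OF per s, symmetric])
  have small: "\<bar>x $ i - y' $ i\<bar> \<le> \<epsilon>" for i
  proof -
    define r where "r = x $ i - y' $ i"
    have r: "r = (x $ i - y $ i) - of_int (k i)" by (simp add: r_def y')
    have "\<bar>r\<bar> \<le> 1 / 2"
      unfolding r k_def using of_int_round_abs_le[of "x $ i - y $ i"] by (simp add: abs_minus_commute)
    then have "\<bar>r\<bar> \<le> \<bar>sin (pi * r)\<bar>" by (rule abs_le_abs_sin_pi)
    also have "\<bar>sin (pi * r)\<bar> = \<bar>sin (pi * (x $ i - y $ i))\<bar>"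
    proof -
      have "pi * r = pi * (x $ i - y $ i) - pi * of_int (k i)" by (simp add: r right_diff_distrib)
      then have "sin (pi * r) = sin (pi * (x $ i - y $ i)) * cos (pi * of_int (k i))"
        by (simp only: sin_diff sin_npi_int mult_zero_right diff_0_right)
      then show ?thesis by (simp add: abs_mult cos_npi_int)
    qed
    also have "\<dots> < \<epsilon>"
      using torus_norm_sq_less(2)[OF near \<epsilon>, of i] by (simp add: z w)
    finally show ?thesis by (simp add: r_def)
  qed
  have "dist z (s, y') = norm (z - (s, y'))" by (simp only: dist_norm)
  also have "\<dots> \<le> norm (t - s) + norm (x - y')"
    unfolding z by (simp add: norm_Pair sqrt_add_le_add_sqrt order_trans[OF sqrt_sum_squares_le_sum_abs])
  also have "norm (x - y') \<le> (\<Sum>i\<in>UNIV. \<bar>(x - y') $ i\<bar>)" by (rule norm_le_l1_cart)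
  also have "\<dots> \<le> (\<Sum>i\<in>(UNIV :: 'd set). \<epsilon>)" by (rule sum_mono) (use small in simp)
  also have "\<dots> = real CARD('d) * \<epsilon>" by simp
  also have "norm (t - s) \<le> \<epsilon>" using torus_norm_sq_less(1)[OF near \<epsilon>] by (simp add: z w)
  finally have d: "dist z (s, y') \<le> (real CARD('d) + 1) * \<epsilon>" by (simp add: algebra_simps)
  have "(s, y') \<in> spacetime T" using s by (simp add: spacetime_def)
  from C(1)[OF this zw(1)] have "dist (f w) (f z) \<le> C * dist (s, y') z powr \<alpha>" by (simp only: fw)
  also have "\<dots> \<le> C * ((real CARD('d) + 1) * \<epsilon>) powr \<alpha>"
    using d \<alpha> by (intro mult_left_mono[OF _ C(2)] powr_mono2) (auto simp: dist_commute)
  also have "\<dots> = C * (real CARD('d) + 1) powr \<alpha> * \<epsilon> powr \<alpha>"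
    using \<epsilon> by (simp add: powr_mult)
  finally show ?thesis .
qed

context smoothing
begin

lemma mollifier_test_function:
  fixes z :: "real \<times> (real ^ 'd)"
  assumes z: "z \<in> core (2 * \<delta>) T"
  shows "(\<lambda>w. mollifier \<epsilon> (z - w)) \<in> test_functions T"
proof -
  obtain t x where zx: "z = (t, x)" by (cases z)
  have t: "\<delta> + \<epsilon> < t" "t < T - \<delta> - \<epsilon>" using inner_near(1,2)[OF z] by (simp_all add: zx)
  have "mollifier \<epsilon> (z - (s, y + axis i 1)) = mollifier \<epsilon> (z - (s, y))" for s y i
    using mollifier_periodic[of \<epsilon> "t - s" "x - y - axis i 1" i] by (simp add: zx algebra_simps)
  moreover have "\<forall>s y. s \<notin> {t - \<epsilon>..t + \<epsilon>} \<longrightarrow> mollifier \<epsilon> (z - (s, y)) = 0"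
  proof (intro allI impI)
    fix s y assume that: "s \<notin> {t - \<epsilon>..t + \<epsilon>}"
    show "mollifier \<epsilon> (z - (s, y)) = 0"
    proof (rule mollifier_support(1)[OF \<epsilon>(1)], rule ccontr)
      assume "\<not> \<epsilon>\<^sup>2 \<le> torus_norm_sq (z - (s, y))"
      then have "\<bar>t - s\<bar> < \<epsilon>" using torus_norm_sq_less(1)[of "z - (s, y)" \<epsilon>] \<epsilon>(1) by (simp add: zx)
      then show False using that by auto
    qed
  qed
  moreover have "0 < t - \<epsilon>" "t + \<epsilon> < T" using t \<delta> \<epsilon> by auto
  moreover have "\<forall>k. C_k k (\<lambda>w. mollifier \<epsilon> (z - w))" by (intro allI C_k_mollifier)
  ultimately show ?thesis
    unfolding test_functions_def space_periodic_on_def by blast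
qed

text \<open>
  The sign in the definition of the weak derivative cancels the one from reflecting the mollifier.
  Hence testing an equation with this function yields the mollified equation at \<open>z\<close>.
\<close>

lemma weak_deriv_mollifier:
  fixes z :: "real \<times> (real ^ 'd)"
  assumes z: "z \<in> core (2 * \<delta>) T" and f: "continuous_on B f"
  shows "weak_deriv T (st_dir e) f (\<lambda>w. mollifier \<epsilon> (z - w)) = mass * davg e f z"
proof -
  have "(LINT w:fundamental_domain T|lborel. f w * - mollifier_deriv \<epsilon> e (z - w))
      = integral (core \<delta> T) (\<lambda>w. f w * - mollifier_deriv \<epsilon> e (z - w))"
  proof (rule LINT_fundamental_domain[OF \<delta>(1)])
    show "continuous_on (core \<delta> T) (\<lambda>w. f w * - mollifier_deriv \<epsilon> e (z - w))"
      using f unfolding B by (intro continuous_on_mult continuous_on_minus continuous_mollifier_deriv_minus)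
    fix w :: "real \<times> (real ^ 'd)" assume w: "fst w \<notin> {\<delta>..T - \<delta>}"
    have "mollifier_deriv \<epsilon> e (z - w) = 0"
    proof (rule mollifier_support(2)[OF \<epsilon>(1)], rule ccontr)
      assume "\<not> \<epsilon>\<^sup>2 \<le> torus_norm_sq (z - w)"
      then have "\<bar>fst z - fst w\<bar> < \<epsilon>" using torus_norm_sq_less(1)[of "z - w" \<epsilon>] \<epsilon>(1) by simp
      then show False using w inner_near(1,2)[OF z] \<epsilon>(1) by auto
    qed
    then show "f w * - mollifier_deriv \<epsilon> e (z - w) = 0" by simp
  qed
  then have "weak_deriv T (st_dir e) f (\<lambda>w. mollifier \<epsilon> (z - w)) = integral B (\<lambda>w. f w * mollifier_deriv \<epsilon> e (z - w))"
    unfolding weak_deriv_def frechet_derivative_mollifier B by simp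
  then show ?thesis using mass_pos by (simp add: davg_def weigh_def)
qed

end

lemma weak_deriv_cong:
  assumes "\<And>z. z \<in> fundamental_domain T \<Longrightarrow> f z = f' z"
  shows "weak_deriv T e f \<phi> = weak_deriv T e f' \<phi>"
proof -
  have "indicator (fundamental_domain T) z *\<^sub>R (f z * frechet_derivative \<phi> (at z) e)
      = indicator (fundamental_domain T) z *\<^sub>R (f' z * frechet_derivative \<phi> (at z) e)" for z
    using assms[of z] by (simp add: indicator_def)
  then show ?thesis by (simp only: weak_deriv_def set_lebesgue_integral_def)
qed

lemma fundamental_domain_subset: "fundamental_domain T \<subseteq> spacetime T"
  by (auto simp: fundamental_domain_def spacetime_def)

lemma test_functionE:
  fixes \<phi> :: "real \<times> (real ^ 'd) \<Rightarrow> real"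
  assumes \<phi>: "\<phi> \<in> test_functions T" and T: "0 < T"
  obtains \<delta> where "0 < \<delta>" "\<delta> \<le> T / 8"
    "\<And>v. has_dir_deriv \<phi> (\<lambda>z. frechet_derivative \<phi> (at z) v) v"
    "continuous_on UNIV \<phi>" "\<And>v. continuous_on UNIV (\<lambda>z. frechet_derivative \<phi> (at z) v)"
    "\<And>t x i. \<phi> (t, x + axis i 1) = \<phi> (t, x)"
    "\<And>z. fst z \<notin> {2 * \<delta>..T - 2 * \<delta>} \<Longrightarrow> \<phi> z = 0"
    "\<And>z v. fst z \<notin> {2 * \<delta>..T - 2 * \<delta>} \<Longrightarrow> frechet_derivative \<phi> (at z) v = 0"
proof -
  obtain a b where ab: "0 < a" "b < T" "\<And>t x. t \<notin> {a..b} \<Longrightarrow> \<phi> (t, x) = 0"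
    using \<phi> by (auto simp: test_functions_def)
  have C: "C_k k \<phi>" for k using \<phi> by (simp add: test_functions_def)
  \<comment> \<open>The first two terms put the support in time into that of \<open>core (2 * \<delta>) T\<close>, the third one keeps the centre of the
    domain far from its time boundary.\<close>
  define \<delta> where "\<delta> = min (min (a / 2) ((T - b) / 2)) (T / 8)"
  have \<delta>: "0 < \<delta>" "\<delta> \<le> T / 8" "2 * \<delta> \<le> a" "b \<le> T - 2 * \<delta>"
    using ab T by (auto simp: \<delta>_def min_def field_simps)
  have diff: "\<phi> differentiable_on UNIV" using C[of 1] by simp
  have zero: "\<phi> z = 0" if "fst z \<notin> {a..b}" for z
    using ab(3)[of "fst z" "snd z"] that by simp
  show ?thesis
  proof (rule that[OF \<delta>(1,2)])
    show "has_dir_deriv \<phi> (\<lambda>z. frechet_derivative \<phi> (at z) v) v" for v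
      by (rule has_dir_deriv_of_differentiable[OF diff])
    show "continuous_on UNIV \<phi>" using C[of 0] by simp
    show "continuous_on UNIV (\<lambda>z. frechet_derivative \<phi> (at z) v)" for v
      using C[of 1] by (cases v) simp
    show "\<phi> (t, x + axis i 1) = \<phi> (t, x)" for t x i
      using \<phi> by (simp add: test_functions_def space_periodic_on_def)
    fix z :: "real \<times> (real ^ 'd)"
    assume "fst z \<notin> {2 * \<delta>..T - 2 * \<delta>}"
    then have z: "fst z \<notin> {a..b}" using \<delta> by auto
    show "\<phi> z = 0" by (rule zero[OF z])
    fix v
    have "open (fst -` (- {a..b}) :: (real \<times> (real ^ 'd)) set)"
      by (intro open_vimage_fst open_Compl closed_atLeastAtMost)
    then have "(\<phi> has_derivative (\<lambda>_. 0)) (at z)"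
      by (rule has_derivative_transform_within_open[OF has_derivative_const[of 0]]) (use z zero in auto)
    then show "frechet_derivative \<phi> (at z) v = 0" by (rule frechet_derivative_eq)
  qed
qed

lemma holder_torusD:
  fixes f :: "real \<times> (real ^ 'd) \<Rightarrow> 'b::real_normed_vector"
  assumes f: "f \<in> holder_torus \<alpha> T" and \<alpha>: "0 \<le> \<alpha>"
  obtains A M where "0 \<le> A" "0 \<le> M" "continuous_on (spacetime T) f"
    "\<And>z. z \<in> spacetime T \<Longrightarrow> norm (f z) \<le> M"
    "\<And>z w \<epsilon>. 0 < \<epsilon> \<Longrightarrow> z \<in> spacetime T \<Longrightarrow> w \<in> spacetime T \<Longrightarrow>
      torus_norm_sq (z - w) < \<epsilon>\<^sup>2 \<Longrightarrow> norm (f w - f z) \<le> A * \<epsilon> powr \<alpha>"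
proof -
  have per: "space_periodic_on (spacetime T) f" and h: "holder_on (spacetime T) \<alpha> f"
    using f by (auto simp: holder_torus_def)
  obtain C where C: "\<And>z w. z \<in> spacetime T \<Longrightarrow> w \<in> spacetime T \<Longrightarrow> dist (f z) (f w) \<le> C * dist z w powr \<alpha>"
    using h by (auto simp: holder_on_def)
  have C': "dist (f z) (f w) \<le> \<bar>C\<bar> * dist z w powr \<alpha>" if "z \<in> spacetime T" "w \<in> spacetime T" for z w
    by (rule order_trans[OF C[OF that]]) (intro mult_right_mono, auto)
  obtain M where M: "0 < M" "\<And>y. y \<in> f ` spacetime T \<Longrightarrow> norm y \<le> M"
    using h unfolding holder_on_def bounded_pos by blast
  show ?thesis
  proof (rule that[of "\<bar>C\<bar> * (real CARD('d) + 1) powr \<alpha>" M])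
    show "norm (f w - f z) \<le> \<bar>C\<bar> * (real CARD('d) + 1) powr \<alpha> * \<epsilon> powr \<alpha>"
      if "0 < \<epsilon>" "z \<in> spacetime T" "w \<in> spacetime T" "torus_norm_sq (z - w) < \<epsilon>\<^sup>2" for z w \<epsilon>
      unfolding dist_norm[symmetric]
      by (rule holder_torus_near[OF per C' abs_ge_zero \<alpha> that])
  qed (use M h in \<open>auto simp: holder_on_def\<close>)
qed

lemma bounded_on_interval:
  fixes f :: "real \<Rightarrow> real"
  assumes "continuous_on UNIV f"
  obtains M where "0 \<le> M" "\<And>x. x \<in> {lo..hi} \<Longrightarrow> \<bar>f x\<bar> \<le> M"
proof -
  have "bounded (f ` {lo..hi})"
    by (intro compact_imp_bounded compact_continuous_image continuous_on_subset[OF assms]) auto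
  then obtain M where "0 < M" "\<forall>y\<in>f ` {lo..hi}. norm y \<le> M" unfolding bounded_pos by blast
  then show ?thesis by (intro that[of M]) auto
qed

lemma lipschitz_on_interval:
  fixes f :: "real \<Rightarrow> real"
  assumes f: "\<And>x. (f has_real_derivative f' x) (at x)" and M: "\<And>x. x \<in> {lo..hi} \<Longrightarrow> \<bar>f' x\<bar> \<le> M"
    and xy: "x \<in> {lo..hi}" "y \<in> {lo..hi}"
  shows "\<bar>f x - f y\<bar> \<le> M * \<bar>x - y\<bar>"
  using field_differentiable_bound[of "{lo..hi}" f f' M x y] xy M has_field_derivative_at_within[OF f]
  by (simp add: real_norm_def)

lemma powr_tendsto_0: "0 < s \<Longrightarrow> ((\<lambda>\<epsilon>. \<epsilon> powr s) \<longlongrightarrow> 0) (at_right (0::real))"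
  by (rule tendsto_zero_powrI[of "\<lambda>\<epsilon>. \<epsilon>" _ "\<lambda>_. s" s])
    (auto simp: eventually_at_right_less tendsto_ident_at intro: eventually_mono[OF eventually_at_right_less])

text \<open>
  Written in powers of the scale, the terms have the exponents $\alpha + \beta$,
  $2\alpha + \beta - 1$, $\alpha + (1 + \theta)\beta - 1$, $\alpha$ and $\beta$, all positive.
\<close>

lemma defect_tendsto_0:
  fixes A :: real
  assumes A: "0 < A" and \<theta>: "0 < \<theta>" and ab: "0 < \<alpha>" "0 < \<beta>" "\<alpha> + (1 + \<theta>) * \<beta> > 1" "2 * \<alpha> + \<beta> > 1"
  defines "a \<equiv> \<lambda>\<epsilon>. A * \<epsilon> powr \<alpha>" and "b \<equiv> \<lambda>\<epsilon>. A * \<epsilon> powr \<beta>"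
  shows "((\<lambda>\<epsilon>. (K1 * (a \<epsilon> * b \<epsilon> + (k / \<epsilon>) * a \<epsilon> * a \<epsilon> * b \<epsilon> + (k / \<epsilon>) * a \<epsilon> * (b \<epsilon> powr \<theta> * b \<epsilon>))
      + K2 * (a \<epsilon> + b \<epsilon>)) * \<mu>) \<longlongrightarrow> 0) (at_right 0)"
proof -
  have "((\<lambda>\<epsilon>. (K1 * (A * A * \<epsilon> powr (\<alpha> + \<beta>) + k * A * A * A * \<epsilon> powr (2 * \<alpha> + \<beta> - 1)
      + k * A * A powr \<theta> * A * \<epsilon> powr (\<alpha> + (1 + \<theta>) * \<beta> - 1))
      + K2 * (A * \<epsilon> powr \<alpha> + A * \<epsilon> powr \<beta>)) * \<mu>) \<longlongrightarrow>
      (K1 * (A * A * 0 + k * A * A * A * 0 + k * A * A powr \<theta> * A * 0) + K2 * (A * 0 + A * 0)) * \<mu>) (at_right 0)"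
    using ab by (intro tendsto_intros powr_tendsto_0) auto
  then have "((\<lambda>\<epsilon>. (K1 * (A * A * \<epsilon> powr (\<alpha> + \<beta>) + k * A * A * A * \<epsilon> powr (2 * \<alpha> + \<beta> - 1)
      + k * A * A powr \<theta> * A * \<epsilon> powr (\<alpha> + (1 + \<theta>) * \<beta> - 1))
      + K2 * (A * \<epsilon> powr \<alpha> + A * \<epsilon> powr \<beta>)) * \<mu>) \<longlongrightarrow> 0) (at_right 0)" by simp
  then show ?thesis
  proof (rule Lim_transform_eventually)
    show "eventually (\<lambda>\<epsilon>. (K1 * (A * A * \<epsilon> powr (\<alpha> + \<beta>) + k * A * A * A * \<epsilon> powr (2 * \<alpha> + \<beta> - 1)
      + k * A * A powr \<theta> * A * \<epsilon> powr (\<alpha> + (1 + \<theta>) * \<beta> - 1))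
      + K2 * (A * \<epsilon> powr \<alpha> + A * \<epsilon> powr \<beta>)) * \<mu> =
      (K1 * (a \<epsilon> * b \<epsilon> + (k / \<epsilon>) * a \<epsilon> * a \<epsilon> * b \<epsilon> + (k / \<epsilon>) * a \<epsilon> * (b \<epsilon> powr \<theta> * b \<epsilon>))
      + K2 * (a \<epsilon> + b \<epsilon>)) * \<mu>) (at_right 0)"
      using eventually_at_right_less[of 0]
    proof eventually_elim
      case (elim \<epsilon>)
      then have e: "\<epsilon> > 0" by simp
      have 1: "\<epsilon> powr (\<alpha> + \<beta>) = \<epsilon> powr \<alpha> * \<epsilon> powr \<beta>" by (simp add: powr_add)
      have 2: "\<epsilon> powr (2 * \<alpha> + \<beta> - 1) = \<epsilon> powr \<alpha> * \<epsilon> powr \<alpha> * \<epsilon> powr \<beta> / \<epsilon>"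
        using e by (simp only: mult_2 powr_diff powr_add powr_one)
      have 3: "\<epsilon> powr (\<alpha> + (1 + \<theta>) * \<beta> - 1) = \<epsilon> powr \<alpha> * (\<epsilon> powr \<beta> * \<epsilon> powr (\<theta> * \<beta>)) / \<epsilon>"
        using e by (simp only: distrib_right mult_1 powr_diff powr_add powr_one)
      have 4: "(A * \<epsilon> powr \<beta>) powr \<theta> = A powr \<theta> * \<epsilon> powr (\<theta> * \<beta>)"
        using A by (simp only: powr_mult powr_powr mult.commute[of \<theta>])
      show ?case
        unfolding a_def b_def 1 2 3 4 by (simp add: mult_ac)
    qed
  qed
qed

section \<open>The pressure potential\<close>

text \<open>
  Subadditivity of the power: for $t \in [0, 1]$ one has $t \le t^\theta$, which is applied to the
  two fractions $x/y$ and $(y-x)/y$.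
\<close>

lemma powr_diff_le:
  fixes x y \<theta> :: real
  assumes "0 \<le> x" "x \<le> y" "0 < \<theta>" "\<theta> \<le> 1"
  shows "y powr \<theta> - x powr \<theta> \<le> (y - x) powr \<theta>"
proof (cases "y = 0")
  case False
  then have y: "y > 0" using assms by linarith
  have frac: "t \<le> t powr \<theta>" if "0 \<le> t" "t \<le> 1" for t :: real
    using powr_mono'[of \<theta> 1 t] that assms by simp
  have "1 = x / y + (y - x) / y" using y by (simp add: field_simps)
  also have "\<dots> \<le> (x / y) powr \<theta> + ((y - x) / y) powr \<theta>"
    using assms y by (intro add_mono frac) auto
  also have "\<dots> = (x powr \<theta> + (y - x) powr \<theta>) / y powr \<theta>"
    using assms y by (simp add: powr_divide add_divide_distrib)
  finally show ?thesis using y by (simp add: field_simps)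
qed (use assms in auto)

text \<open>
  Outside the interval the derivative is frozen at its end point values; this keeps the Hoelder
  constant. The last estimate follows from the mean value theorem.
\<close>

lemma C1_holder_extension:
  fixes f f' :: "real \<Rightarrow> real"
  assumes "lo \<le> hi" and f: "\<And>x. x \<in> {lo..hi} \<Longrightarrow> (f has_real_derivative f' x) (at x within {lo..hi})"
    and f': "\<And>x y. x \<in> {lo..hi} \<Longrightarrow> y \<in> {lo..hi} \<Longrightarrow> \<bar>f' x - f' y\<bar> \<le> H * \<bar>x - y\<bar> powr \<theta>"
    and H: "0 \<le> H" and \<theta>: "0 < \<theta>"
  obtains F q where "\<And>x. x \<in> {lo..hi} \<Longrightarrow> F x = f x" "\<And>x. x \<in> {lo..hi} \<Longrightarrow> q x = f' x"
    "\<And>x. (F has_real_derivative q x) (at x)" "continuous_on UNIV q"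
    "\<And>x y. \<bar>q x - q y\<bar> \<le> H * \<bar>x - y\<bar> powr \<theta>"
    "\<And>x y. \<bar>F x - F y - q y * (x - y)\<bar> \<le> H * \<bar>x - y\<bar> powr (1 + \<theta>)"
proof -
  define c where "c x = max lo (min hi x)" for x
  define q where "q x = f' (c x)" for x
  have c: "c x \<in> {lo..hi}" "\<bar>c x - c y\<bar> \<le> \<bar>x - y\<bar>" for x y
    using \<open>lo \<le> hi\<close> by (auto simp: c_def)
  have q_eq: "q x = f' x" if "x \<in> {lo..hi}" for x
    using that by (simp add: q_def c_def)
  have q: "\<bar>q x - q y\<bar> \<le> H * \<bar>x - y\<bar> powr \<theta>" for x y
  proof -
    have "\<bar>c x - c y\<bar> powr \<theta> \<le> \<bar>x - y\<bar> powr \<theta>"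
      using c(2) \<theta> by (intro powr_mono2) auto
    then show ?thesis
      using f'[OF c(1) c(1), of x y] mult_left_mono[OF _ H] order_trans unfolding q_def by blast
  qed
  have cont: "isCont q x" for x
  proof -
    have "((\<lambda>y. H * \<bar>y - x\<bar> powr \<theta>) \<longlongrightarrow> 0) (at x)"
    proof -
      have "((\<lambda>y. \<bar>y - x\<bar>) \<longlongrightarrow> \<bar>x - x\<bar>) (at x)" by (intro tendsto_intros)
      from tendsto_powr2[OF this tendsto_const[of \<theta>]] \<theta>
      have "((\<lambda>y. \<bar>y - x\<bar> powr \<theta>) \<longlongrightarrow> 0) (at x)" by simp
      from tendsto_mult_left[OF this, of H] show ?thesis by simp
    qed
    then have "((\<lambda>y. q y - q x) \<longlongrightarrow> 0) (at x)"
      by (rule Lim_null_comparison[rotated]) (use q in auto)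
    then show ?thesis by (simp add: isCont_def LIM_zero_iff)
  qed
  then obtain F0 where F0: "\<And>x. (F0 has_real_derivative q x) (at x)"
    using einterval_antiderivative[of "-\<infinity>" \<infinity> q]
    by (auto simp: has_real_derivative_iff_has_vector_derivative)
  define F where "F x = F0 x + (f lo - F0 lo)" for x
  have F: "(F has_real_derivative q x) (at x)" for x
    unfolding F_def using F0 by (auto intro!: derivative_eq_intros)
  have "((\<lambda>x. F x - f x) has_real_derivative 0) (at x within {lo..hi})" if "x \<in> {lo..hi}" for x
    using DERIV_diff[OF has_field_derivative_at_within[OF F] f[OF that]] q_eq[OF that] by simp
  then obtain k where "\<And>x. x \<in> {lo..hi} \<Longrightarrow> F x - f x = k"
    using has_field_derivative_zero_constant[of "{lo..hi}" "\<lambda>x. F x - f x"] by auto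
  moreover have "F lo - f lo = 0" by (simp add: F_def)
  ultimately have F_eq: "F x = f x" if "x \<in> {lo..hi}" for x
    using that \<open>lo \<le> hi\<close> by (metis atLeastAtMost_iff eq_iff_diff_eq_0 order_refl)
  have taylor: "\<bar>F x - F y - q y * (x - y)\<bar> \<le> H * \<bar>x - y\<bar> powr (1 + \<theta>)" for x y
  proof -
    obtain \<xi> where \<xi>: "F x - F y = q \<xi> * (x - y)" "\<bar>\<xi> - y\<bar> \<le> \<bar>x - y\<bar>"
    proof (cases x y rule: linorder_cases)
      case less
      from MVT2[OF less, of F q] F obtain \<xi> where "x < \<xi>" "\<xi> < y" "F y - F x = (y - x) * q \<xi>" by blast
      then show ?thesis using that[of \<xi>] by (simp add: algebra_simps)
    next
      case equal
      then show ?thesis using that[of y] by simp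
    next
      case greater
      from MVT2[OF greater, of F q] F obtain \<xi> where "y < \<xi>" "\<xi> < x" "F x - F y = (x - y) * q \<xi>" by blast
      then show ?thesis using that[of \<xi>] by (simp add: algebra_simps)
    qed
    have "\<bar>F x - F y - q y * (x - y)\<bar> = \<bar>q \<xi> - q y\<bar> * \<bar>x - y\<bar>"
      by (simp add: \<xi>(1) abs_mult[symmetric] left_diff_distrib)
    also have "\<dots> \<le> (H * \<bar>x - y\<bar> powr \<theta>) * \<bar>x - y\<bar>"
    proof (rule mult_right_mono)
      have "\<bar>\<xi> - y\<bar> powr \<theta> \<le> \<bar>x - y\<bar> powr \<theta>"
        using \<xi>(2) \<theta> by (intro powr_mono2) auto
      then show "\<bar>q \<xi> - q y\<bar> \<le> H * \<bar>x - y\<bar> powr \<theta>"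
        using q[of \<xi> y] mult_left_mono[OF _ H] order_trans by blast
    qed auto
    also have "\<dots> = H * \<bar>x - y\<bar> powr (1 + \<theta>)"
      by (cases "x = y") (auto simp: powr_add)
    finally show ?thesis .
  qed
  show ?thesis
    using F_eq q_eq F continuous_at_imp_continuous_on[of UNIV q] q taylor
    by (rule that) (use cont in auto)
qed

definition pot_integral :: "(real \<Rightarrow> real) \<Rightarrow> real \<Rightarrow> real" where
  "pot_integral p r = (LBINT s=1..r. p s / s\<^sup>2)"

text \<open>
  The base point 1 of the potential need not lie in the range of densities. If it lies between \<open>c\<close>
  and \<open>r\<close>, integrability on the union of the two intervals is needed separately.
\<close>

lemma pot_integral_diff:
  assumes int: "interval_lebesgue_integrable lborel 1 c (\<lambda>s. p s / s\<^sup>2)"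
      "interval_lebesgue_integrable lborel 1 r (\<lambda>s. p s / s\<^sup>2)"
    and mid: "c \<le> 1 \<Longrightarrow> 1 \<le> r \<Longrightarrow> interval_lebesgue_integrable lborel c r (\<lambda>s. p s / s\<^sup>2)"
    and "c \<le> r"
  shows "pot_integral p r = pot_integral p c + (LBINT s=c..r. p s / s\<^sup>2)"
proof -
  have "(LBINT s=ereal 1..c. p s / s\<^sup>2) + (LBINT s=c..r. p s / s\<^sup>2) = (LBINT s=ereal 1..r. p s / s\<^sup>2)"
  proof (rule interval_integral_sum)
    consider "r \<le> 1" | "c \<le> 1" "1 \<le> r" | "1 \<le> c" by linarith
    then show "interval_lebesgue_integrable lborel (min (ereal 1) (min (ereal c) (ereal r)))
        (max (ereal 1) (max (ereal c) (ereal r))) (\<lambda>s. p s / s\<^sup>2)"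
    proof cases
      case 1
      then have e: "min (ereal 1) (min (ereal c) (ereal r)) = c" "max (ereal 1) (max (ereal c) (ereal r)) = 1"
        using \<open>c \<le> r\<close> by (auto simp: min_def max_def one_ereal_def)
      show ?thesis unfolding e using int(1) interval_integrable_endpoints_reverse by blast
    next
      case 2
      then have e: "min (ereal 1) (min (ereal c) (ereal r)) = c" "max (ereal 1) (max (ereal c) (ereal r)) = r"
        using \<open>c \<le> r\<close> by (auto simp: min_def max_def)
      show ?thesis unfolding e by (rule mid[OF 2])
    next
      case 3
      then have e: "min (ereal 1) (min (ereal c) (ereal r)) = 1" "max (ereal 1) (max (ereal c) (ereal r)) = r"
        using \<open>c \<le> r\<close> by (auto simp: min_def max_def one_ereal_def)
      show ?thesis unfolding e by (rule int(2))
    qed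
  qed
  then show ?thesis by (simp add: pot_integral_def one_ereal_def)
qed

text \<open>
  Near 0 the integrand differs from $p(0)/s^2$ by at most $\eta/s^2$, and $r$ times the integral of
  $1/s^2$ from $r$ to $h$ tends to 1.
\<close>

lemma potential_limit_at_vacuum:
  assumes int: "\<And>r :: real. (0 :: real) < r \<Longrightarrow> r \<le> (1 :: real) \<Longrightarrow> interval_lebesgue_integrable lborel 1 r (\<lambda>s. p s / s\<^sup>2)"
    and p0: "(p \<longlongrightarrow> p 0) (at_right 0)"
  shows "((\<lambda>r. r * pot_integral p r) \<longlongrightarrow> - p 0) (at_right 0)"
proof (rule tendstoI)
  fix \<eta> :: real assume "\<eta> > 0"
  then have "eventually (\<lambda>s. dist (p s) (p 0) < \<eta> / 2) (at_right 0)"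
    using p0 by (intro tendstoD) auto
  then obtain h0 where h0: "h0 > 0" "\<And>s. 0 < s \<Longrightarrow> s < h0 \<Longrightarrow> \<bar>p s - p 0\<bar> < \<eta> / 2"
    by (auto simp: eventually_at_right_field dist_real_def)
  define h where "h = min (h0 / 2) (1 / 2)"
  have h: "0 < h" "h < 1" "\<And>s. 0 < s \<Longrightarrow> s \<le> h \<Longrightarrow> \<bar>p s - p 0\<bar> \<le> \<eta> / 2"
    using h0(1) h0(2) by (auto simp: h_def less_imp_le)
  have bound: "\<bar>r * pot_integral p r + p 0\<bar> \<le> r * (\<bar>pot_integral p h\<bar> + \<bar>p 0\<bar> / h) + \<eta> / 2"
    if r: "0 < r" "r < h" for r
  proof -
    let ?f = "\<lambda>s. p s / s\<^sup>2"
    have "set_integrable lborel (einterval (r / 2) 1) ?f"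
      using int[of "r / 2"] r h by (simp add: interval_lebesgue_integrable_def one_ereal_def split: if_splits)
    then have si: "set_integrable lborel {r..h} ?f"
      by (rule set_integrable_subset) (use r h in \<open>auto simp: einterval_def one_ereal_def\<close>)
    have "pot_integral p h = pot_integral p r + (LBINT s=r..h. ?f s)"
      by (rule pot_integral_diff) (use r h int in auto)
    also have "(LBINT s=r..h. ?f s) = integral {r..h} ?f"
      using r by (intro interval_integral_eq_integral si) auto
    finally have J: "pot_integral p r = pot_integral p h - integral {r..h} ?f" by simp
    have inv: "((\<lambda>s. c / s\<^sup>2) has_integral c * (1 / r - 1 / h)) {r..h}" for c
    proof -
      have "((\<lambda>s. c / s\<^sup>2) has_integral (- c / h) - (- c / r)) {r..h}"
        by (rule fundamental_theorem_of_calculus)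
          (use r in \<open>auto intro!: derivative_eq_intros simp: has_real_derivative_iff_has_vector_derivative[symmetric] power2_eq_square\<close>)
      then show ?thesis by (simp add: algebra_simps)
    qed
    have fint: "?f integrable_on {r..h}"
      by (rule set_borel_integral_eq_integral(1)[OF si])
    have "norm (integral {r..h} (\<lambda>s. ?f s - p 0 / s\<^sup>2)) \<le> integral {r..h} (\<lambda>s. (\<eta> / 2) / s\<^sup>2)"
    proof (rule integral_norm_bound_integral)
      show "(\<lambda>s. ?f s - p 0 / s\<^sup>2) integrable_on {r..h}" "(\<lambda>s. (\<eta> / 2) / s\<^sup>2) integrable_on {r..h}"
        by (intro integrable_diff fint has_integral_integrable[OF inv])+
      show "norm (?f s - p 0 / s\<^sup>2) \<le> (\<eta> / 2) / s\<^sup>2" if "s \<in> {r..h}" for s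
        using divide_right_mono[OF h(3)[of s], of "s\<^sup>2"] that r
        by (simp add: diff_divide_distrib[symmetric] abs_divide)
    qed
    then have est: "\<bar>integral {r..h} ?f - p 0 * (1 / r - 1 / h)\<bar> \<le> (\<eta> / 2) * (1 / r - 1 / h)"
      using inv[of "p 0"] inv[of "\<eta> / 2"] fint
      by (simp add: integral_diff integral_unique has_integral_integrable)
    define D where "D = integral {r..h} ?f - p 0 * (1 / r - 1 / h)"
    have "r * pot_integral p r + p 0 = r * pot_integral p h + r * p 0 / h - r * D"
      using r by (simp add: J D_def algebra_simps)
    also have "\<bar>\<dots>\<bar> \<le> \<bar>r * pot_integral p h\<bar> + \<bar>r * p 0 / h\<bar> + \<bar>r * D\<bar>"
    proof -
      have "\<bar>A + A' - A''\<bar> \<le> \<bar>A\<bar> + \<bar>A'\<bar> + \<bar>A''\<bar>" for A A' A'' :: real by linarith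
      then show ?thesis .
    qed
    also have "\<bar>r * D\<bar> \<le> r * ((\<eta> / 2) * (1 / r - 1 / h))"
      using est r by (simp add: abs_mult D_def)
    also have "\<dots> \<le> \<eta> / 2"
      using r h \<open>\<eta> > 0\<close> by (simp add: algebra_simps)
    finally show ?thesis using r h by (simp add: abs_mult algebra_simps)
  qed
  have "((\<lambda>r. r * (\<bar>pot_integral p h\<bar> + \<bar>p 0\<bar> / h) + \<eta> / 2) \<longlongrightarrow> 0 * (\<bar>pot_integral p h\<bar> + \<bar>p 0\<bar> / h) + \<eta> / 2) (at_right 0)"
    by (intro tendsto_intros)
  then have "eventually (\<lambda>r. r * (\<bar>pot_integral p h\<bar> + \<bar>p 0\<bar> / h) + \<eta> / 2 < \<eta>) (at_right 0)"
    using \<open>\<eta> > 0\<close> by (auto dest: order_tendstoD(2)[of _ _ _ \<eta>])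
  moreover have "eventually (\<lambda>r. r < h) (at_right 0)" "eventually (\<lambda>r. r > 0) (at_right (0::real))"
    using h(1) by (auto simp: eventually_at_right_field)
  ultimately show "eventually (\<lambda>r. dist (r * pot_integral p r) (- p 0) < \<eta>) (at_right 0)"
    by eventually_elim (use bound in \<open>force simp: dist_real_def\<close>)
qed

text \<open>
  Where $r > 0$, the potential is $rJ(r)$ with $J' = p/r^2$, so that its derivative is $g = J + p/r$ and
  $g' = p'/r$. Since $|p'(r)| \le K r^\theta$, the increments of $g$ are bounded by those of
  $(K/\theta) r^\theta$, hence $g$ is Hoelder continuous. If the range of densities contains
  the vacuum and other values, $g$ extends to 0 by uniform continuity, and the extension is the one-sided derivative there,
  because $P(0) = -p(0)$ and $p'(0) = 0$.
\<close>

lemma potential_C1_holder: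
  fixes p p' :: "real \<Rightarrow> real"
  assumes \<theta>: "0 < \<theta>" "\<theta> \<le> 1" and I: "0 \<le> lo" "lo \<le> hi"
    and p: "\<And>x. x \<in> {lo..hi} \<Longrightarrow> (p has_real_derivative p' x) (at x within {lo..hi})"
    and p': "\<And>x y. x \<in> {lo..hi} \<Longrightarrow> y \<in> {lo..hi} \<Longrightarrow> \<bar>p' x - p' y\<bar> \<le> H * \<bar>x - y\<bar> powr \<theta>"
    and H: "0 \<le> H"
    and vac: "lo = 0 \<Longrightarrow> (p has_real_derivative 0) (at_right 0)"
    and wd: "potential_well_defined p lo hi"
  obtains g K where "0 \<le> K"
    "\<And>x. x \<in> {lo..hi} \<Longrightarrow> (pressure_potential p has_real_derivative g x) (at x within {lo..hi})"
    "\<And>x y. x \<in> {lo..hi} \<Longrightarrow> y \<in> {lo..hi} \<Longrightarrow> \<bar>g x - g y\<bar> \<le> K * \<bar>x - y\<bar> powr \<theta>"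
    "\<And>x. x \<in> {lo..hi} \<Longrightarrow> x * g x - pressure_potential p x = p x"
proof -
  let ?I = "{lo..hi}" and ?J = "pot_integral p"
  have contp: "continuous_on ?I p"
    by (rule DERIV_continuous_on) (use p in auto)
  have int: "interval_lebesgue_integrable lborel 1 r (\<lambda>s. p s / s\<^sup>2)"
    if "0 < r" "min lo 1 \<le> r" "r \<le> max hi 1" for r
    using wd that by (simp add: potential_well_defined_def)
  have J: "(?J has_real_derivative p r / r\<^sup>2) (at r within ?I)" if r: "r \<in> ?I" "0 < r" for r
  proof -
    \<comment> \<open>A base point for the fundamental theorem of calculus that is positive and does not exceed \<open>r\<close>.\<close>
    define c where "c = (if lo > 0 then lo else r / 2)"
    have c: "0 < c" "lo \<le> c" "c \<le> r" using I r by (auto simp: c_def)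
    have at: "at r within ?I = at r within {c..hi}"
    proof (cases "lo > 0")
      case False
      then have "c < r" using r by (simp add: c_def)
      then show ?thesis
        using c by (intro at_within_nhd[where S="{c<..}"]) auto
    qed (simp add: c_def)
    have cont: "continuous_on {c..hi} (\<lambda>s. p s / s\<^sup>2)"
      using c by (intro continuous_intros continuous_on_subset[OF contp]) auto
    have eq: "?J c + (LBINT s=c..x. p s / s\<^sup>2) = ?J x" if x: "x \<in> {c..hi}" for x
    proof (rule pot_integral_diff[symmetric])
      show "interval_lebesgue_integrable lborel c x (\<lambda>s. p s / s\<^sup>2)"
        using x by (intro interval_integrable_continuous_on continuous_on_subset[OF cont]) auto
    qed (use c x in \<open>auto intro!: int\<close>)
    have "((\<lambda>x. LBINT s=c..x. p s / s\<^sup>2) has_vector_derivative p r / r\<^sup>2) (at r within {c..hi})"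
      using c r by (intro interval_integral_FTC2 cont) auto
    then have "((\<lambda>x. ?J c + (LBINT s=c..x. p s / s\<^sup>2)) has_real_derivative 0 + p r / r\<^sup>2) (at r within {c..hi})"
      unfolding has_real_derivative_iff_has_vector_derivative[symmetric]
      by (intro DERIV_add DERIV_const)
    then show ?thesis
      unfolding at add_0_left
      by (rule has_field_derivative_transform_within[OF _ zero_less_one]) (use c r eq in auto)
  qed
  define g0 where "g0 r = ?J r + p r / r" for r
  have g0: "(g0 has_real_derivative p' r / r) (at r within ?I)" if r: "r \<in> ?I" "0 < r" for r
    unfolding g0_def using r(2)
    by (auto intro!: derivative_eq_intros J[OF r] p[OF r(1)] simp: field_simps power2_eq_square)
  have P_pos: "pressure_potential p r = r * ?J r" if "0 < r" for r
    using that by (simp add: pressure_potential_def pot_integral_def)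
  have P: "(pressure_potential p has_real_derivative g0 r) (at r within ?I)" if r: "r \<in> ?I" "0 < r" for r
  proof -
    have "((\<lambda>r. r * ?J r) has_real_derivative g0 r) (at r within ?I)"
      unfolding g0_def using r(2)
      by (auto intro!: derivative_eq_intros J[OF r] simp: field_simps power2_eq_square)
    then show ?thesis
      by (rule has_field_derivative_transform_within[OF _ r(2) r(1)]) (auto simp: P_pos dist_real_def)
  qed
  obtain K where K: "0 \<le> K" "\<And>s. s \<in> ?I \<Longrightarrow> 0 < s \<Longrightarrow> \<bar>p' s\<bar> \<le> K * s powr \<theta>"
  proof (cases "lo = 0")
    case True
    have "\<bar>p' s\<bar> \<le> H * s powr \<theta>" if s: "s \<in> ?I" "0 < s" for s
    proof -
      have "0 < hi" using s by auto
      then have "(p has_real_derivative p' 0) (at_right 0)"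
        using p[of 0] True by (simp add: at_within_Icc_at_right)
      then have "p' 0 = 0"
        using vac[OF True] has_field_derivative_unique by (metis trivial_limit_at_right_real)
      then show ?thesis using p'[of s 0] s True I by simp
    qed
    then show ?thesis using that[OF H] by blast
  next
    case False
    then have lo: "0 < lo" using I by simp
    define M where "M = \<bar>p' lo\<bar> + H * (hi - lo) powr \<theta>"
    have M: "\<bar>p' s\<bar> \<le> M" if "s \<in> ?I" for s
    proof -
      have "\<bar>s - lo\<bar> powr \<theta> \<le> (hi - lo) powr \<theta>"
        using that \<theta> by (intro powr_mono2) auto
      then have "H * \<bar>s - lo\<bar> powr \<theta> \<le> H * (hi - lo) powr \<theta>" by (rule mult_left_mono[OF _ H])
      then show ?thesis using p'[of s lo] that I by (simp add: M_def)
    qed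
    have M0: "0 \<le> M" using H by (simp add: M_def)
    have "\<bar>p' s\<bar> \<le> (M / lo powr \<theta>) * s powr \<theta>" if s: "s \<in> ?I" for s
    proof -
      have "lo powr \<theta> \<le> s powr \<theta>" using s lo \<theta> by (intro powr_mono2) auto
      then have "M * lo powr \<theta> \<le> M * s powr \<theta>" by (rule mult_left_mono[OF _ M0])
      then have "M \<le> (M / lo powr \<theta>) * s powr \<theta>" using lo by (simp add: field_simps)
      then show ?thesis using M[OF s] by linarith
    qed
    then show ?thesis using that[of "M / lo powr \<theta>"] M0 by simp
  qed
  have mono: "\<bar>g0 y - g0 x\<bar> \<le> (K / \<theta>) * (y powr \<theta> - x powr \<theta>)"
    if xy: "x \<in> ?I" "y \<in> ?I" "0 < x" "x \<le> y" for x y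
  proof -
    have at: "at s within ?I = at s" if "x < s" "s < y" for s
      using that xy by (intro at_within_interior) (auto simp: interior_atLeastAtMost_real)
    have contg: "continuous_on {x..y} g0"
      by (rule DERIV_continuous_on[where D="\<lambda>r. p' r / r"])
        (use xy in \<open>auto intro!: has_field_derivative_subset[OF g0]\<close>)
    \<comment> \<open>Both $(K/\theta) s^\theta + g$ and $(K/\theta) s^\theta - g$ are nondecreasing.\<close>
    have inc: "(K / \<theta>) * x powr \<theta> + \<sigma> * g0 x \<le> (K / \<theta>) * y powr \<theta> + \<sigma> * g0 y" if \<sigma>: "\<sigma> = 1 \<or> \<sigma> = -1" for \<sigma>
    proof (rule DERIV_nonneg_imp_increasing_open[OF xy(4)])
      fix s assume s: "x < s" "s < y"
      have g: "(g0 has_real_derivative p' s / s) (at s)"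
        using g0[of s] s xy by (simp add: at[OF s])
      have "((\<lambda>s. (K / \<theta>) * s powr \<theta> + \<sigma> * g0 s) has_real_derivative (K / \<theta>) * (\<theta> * s powr (\<theta> - 1)) + \<sigma> * (p' s / s)) (at s)"
        using s xy by (intro DERIV_add DERIV_cmult has_real_derivative_powr g) auto
      moreover have "0 \<le> (K / \<theta>) * (\<theta> * s powr (\<theta> - 1)) + \<sigma> * (p' s / s)"
      proof -
        have "\<bar>p' s / s\<bar> \<le> K * s powr (\<theta> - 1)"
          using K(2)[of s] s xy by (simp add: powr_diff divide_right_mono)
        then have "p' s / s \<le> K * s powr (\<theta> - 1)" "- (p' s / s) \<le> K * s powr (\<theta> - 1)"
          by (simp_all only: abs_le_iff)
        moreover have "(K / \<theta>) * (\<theta> * s powr (\<theta> - 1)) = K * s powr (\<theta> - 1)"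
          using \<theta> by simp
        ultimately show ?thesis using \<sigma> by (elim disjE) (simp_all only: mult_1 mult_minus1)
      qed
      ultimately show "\<exists>y. ((\<lambda>s. (K / \<theta>) * s powr \<theta> + \<sigma> * g0 s) has_real_derivative y) (at s) \<and> 0 \<le> y"
        by blast
    next
      show "continuous_on {x..y} (\<lambda>s. (K / \<theta>) * s powr \<theta> + \<sigma> * g0 s)"
        using xy by (intro continuous_intros contg) auto
    qed
    show ?thesis using inc[of 1] inc[of "-1"] by (simp add: abs_le_iff right_diff_distrib)
  qed
  have holder_ord: "\<bar>g0 y - g0 x\<bar> \<le> (K / \<theta>) * (y - x) powr \<theta>"
    if xy: "x \<in> ?I" "y \<in> ?I" "0 < x" "x \<le> y" for x y
  proof -
    have "(K / \<theta>) * (y powr \<theta> - x powr \<theta>) \<le> (K / \<theta>) * (y - x) powr \<theta>"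
      using K(1) \<theta> xy by (intro mult_left_mono powr_diff_le) auto
    then show ?thesis using mono[OF xy] by linarith
  qed
  have holder: "\<bar>g0 x - g0 y\<bar> \<le> (K / \<theta>) * \<bar>x - y\<bar> powr \<theta>"
    if xy: "x \<in> ?I" "y \<in> ?I" "0 < x" "0 < y" for x y
    using holder_ord[of x y] holder_ord[of y x] xy by (cases "x \<le> y") (simp_all add: abs_minus_commute)
  have K\<theta>: "0 \<le> K / \<theta>" using K(1) \<theta> by simp
  have alg: "r * g0 r - pressure_potential p r = p r" if "0 < r" for r
    using that by (simp add: P_pos g0_def algebra_simps)
  have lim0: "((\<lambda>r. r * ?J r) \<longlongrightarrow> - p 0) (at_right 0)" if "lo = 0"
  proof (rule potential_limit_at_vacuum[of p])
    show "(p \<longlongrightarrow> p 0) (at_right 0)"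
      using has_field_derivative_imp_has_derivative[OF vac[OF that]] DERIV_continuous[OF vac[OF that]]
      by (simp add: continuous_within)
    show "interval_lebesgue_integrable lborel 1 r (\<lambda>s. p s / s\<^sup>2)" if "(0 :: real) < r" "r \<le> (1 :: real)" for r :: real
      using that \<open>lo = 0\<close> by (intro int) auto
  qed
  have P0: "pressure_potential p 0 = - p 0" if "lo = 0"
    using tendsto_Lim[OF _ lim0[OF that]] by (simp add: pressure_potential_def pot_integral_def)
  consider "0 < lo" | "lo = 0" "hi = 0" | "lo = 0" "0 < hi" using I by linarith
  then show ?thesis
  proof cases
    case 1
    then show ?thesis
      using P holder alg by (intro that[OF K\<theta>, of g0]) auto
  next
    case 2
    have "at (0 :: real) within {0} = bot"
      using trivial_limit_within[of "0 :: real" "{0}"] by (simp add: islimpt_finite)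
    with 2 show ?thesis
      using P0 by (intro that[of 0 "\<lambda>_. 0"]) (auto simp: has_field_derivative_iff)
  next
    case 3
    let ?X = "{0<..hi}"
    have "uniformly_continuous_on ?X g0"
      unfolding uniformly_continuous_on_def
    proof (intro allI impI)
      fix e :: real assume "e > 0"
      \<comment> \<open>Chosen such that $(K/\theta + 1) d^\theta = e$.\<close>
      define d where "d = (e / (K / \<theta> + 1)) powr (1 / \<theta>)"
      have d: "0 < d" "d powr \<theta> = e / (K / \<theta> + 1)"
        using \<open>e > 0\<close> K\<theta> \<theta> by (auto simp: d_def powr_powr add_nonneg_pos)
      have "\<bar>g0 y - g0 x\<bar> < e" if "x \<in> ?X" "y \<in> ?X" "\<bar>y - x\<bar> < d" for x y
      proof -
        have "\<bar>g0 y - g0 x\<bar> \<le> (K / \<theta>) * \<bar>y - x\<bar> powr \<theta>"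
          using that 3 by (intro holder) auto
        also have "\<dots> \<le> (K / \<theta>) * d powr \<theta>"
          using that \<theta> by (intro mult_left_mono[OF _ K\<theta>] powr_mono2) auto
        also have "\<dots> < (K / \<theta> + 1) * d powr \<theta>"
          using d(1) by (simp add: ring_distribs)
        also have "\<dots> = e" using K\<theta> by (simp add: d(2))
        finally show ?thesis .
      qed
      then show "\<exists>d>0. \<forall>x\<in>?X. \<forall>x'\<in>?X. dist x' x < d \<longrightarrow> dist (g0 x') (g0 x) < e"
        using d(1) by (auto simp: dist_real_def)
    qed
    moreover have "(0::real) \<in> closure ?X"
      using 3 by simp
    ultimately obtain l where l: "(g0 \<longlongrightarrow> l) (at 0 within ?X)"
      by (rule uniformly_continuous_on_extension_at_closure)
    moreover have at0: "at 0 within ?X = at_right (0::real)" "at 0 within {0..hi} = at_right (0::real)"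
      using 3 by (auto intro!: at_within_nhd[where S="{..<hi}"] simp: at_within_Icc_at_right)
    ultimately have l: "(g0 \<longlongrightarrow> l) (at_right 0)" by simp
    define g where "g r = (if r = 0 then l else g0 r)" for r
    have ev: "eventually (\<lambda>r. r \<in> ?I \<and> 0 < r) (at_right 0)"
      using 3 by (auto simp: eventually_at_right_field intro!: exI[of _ hi])
    have holder0: "\<bar>g0 x - l\<bar> \<le> (K / \<theta>) * \<bar>x - 0\<bar> powr \<theta>" if x: "x \<in> ?I" "0 < x" for x
    proof (rule tendsto_le[OF trivial_limit_at_right_real])
      show "((\<lambda>r. \<bar>g0 x - g0 r\<bar>) \<longlongrightarrow> \<bar>g0 x - l\<bar>) (at_right 0)"
        by (intro tendsto_intros l)
      show "((\<lambda>r. (K / \<theta>) * \<bar>x - r\<bar> powr \<theta>) \<longlongrightarrow> (K / \<theta>) * \<bar>x - 0\<bar> powr \<theta>) (at_right 0)"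
        using x by (intro tendsto_intros) auto
      show "eventually (\<lambda>r. \<bar>g0 x - g0 r\<bar> \<le> (K / \<theta>) * \<bar>x - r\<bar> powr \<theta>) (at_right 0)"
        using ev by eventually_elim (use x holder in auto)
    qed
    have "(pressure_potential p has_real_derivative l) (at 0 within ?I)"
    proof -
      have "((\<lambda>r. (p r - p 0) / (r - 0)) \<longlongrightarrow> 0) (at_right 0)"
        using vac[OF 3(1)] by (simp only: has_field_derivative_iff)
      from tendsto_diff[OF l this]
      have "((\<lambda>r. g0 r - (p r - p 0) / (r - 0)) \<longlongrightarrow> l) (at_right 0)" by simp
      moreover have "eventually (\<lambda>r. g0 r - (p r - p 0) / (r - 0) =
          (pressure_potential p r - pressure_potential p 0) / (r - 0)) (at_right 0)"
        using ev by eventually_elim (simp add: P_pos P0[OF 3(1)] g0_def field_simps)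
      ultimately have "((\<lambda>r. (pressure_potential p r - pressure_potential p 0) / (r - 0)) \<longlongrightarrow> l) (at_right 0)"
        by (rule Lim_transform_eventually)
      then show ?thesis using 3 at0 by (simp add: has_field_derivative_iff)
    qed
    then have D: "(pressure_potential p has_real_derivative g x) (at x within ?I)" if "x \<in> ?I" for x
      using that P[of x] I by (cases "x = 0") (auto simp: g_def)
    have Hg: "\<bar>g x - g y\<bar> \<le> (K / \<theta>) * \<bar>x - y\<bar> powr \<theta>" if "x \<in> ?I" "y \<in> ?I" for x y
      using that holder[of x y] holder0[of x] holder0[of y] 3
      by (cases "x = 0"; cases "y = 0") (auto simp: g_def abs_minus_commute)
    have Ag: "x * g x - pressure_potential p x = p x" if "x \<in> ?I" for x
      using that alg[of x] P0[OF 3(1)] 3 by (cases "x = 0") (auto simp: g_def)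
    show ?thesis by (rule that[OF K\<theta> D Hg Ag])
  qed
qed

section \<open>Local energy conservation\<close>

text \<open>
  The energy balance for a pressure and a potential given on the whole line. The integral \<open>I\<close> below is
  the weak energy balance up to sign. It does not depend on the scale, whereas by
  \<open>energy_defect_limit\<close> it is bounded by quantities that tend to 0 with the scale.
\<close>

lemma energy_balance:
  fixes \<rho> :: "real \<times> (real ^ 'd) \<Rightarrow> real" and u :: "real \<times> (real ^ 'd) \<Rightarrow> real ^ 'd"
    and p q P g :: "real \<Rightarrow> real"
  assumes T: "0 < T" and euler: "isentropic_euler T p \<rho> u"
    and exps: "0 < \<alpha>" "0 < \<beta>" "0 < \<theta>" "\<alpha> + (1 + \<theta>) * \<beta> > 1" "2 * \<alpha> + \<beta> > 1"
    and u: "u \<in> holder_torus \<alpha> T" and \<rho>: "\<rho> \<in> holder_torus \<beta> T"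
    and m: "(\<lambda>z. \<rho> z *\<^sub>R u z) \<in> holder_torus \<beta> T"
    and range: "\<And>z. z \<in> spacetime T \<Longrightarrow> lo \<le> \<rho> z \<and> \<rho> z \<le> hi"
    and p: "\<And>x. (p has_real_derivative q x) (at x)" "continuous_on UNIV q"
      "\<And>x y. \<bar>p x - p y - q y * (x - y)\<bar> \<le> H * \<bar>x - y\<bar> powr (1 + \<theta>)"
    and P: "\<And>x. (P has_real_derivative g x) (at x)" "continuous_on UNIV g"
      "\<And>x y. \<bar>g x - g y\<bar> \<le> H * \<bar>x - y\<bar> powr \<theta>"
    and H: "0 \<le> H"
    and pressure: "\<And>r. lo \<le> r \<Longrightarrow> r \<le> hi \<Longrightarrow> r * g r - P r = p r"
    and \<phi>: "\<phi> \<in> test_functions T"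
  shows "weak_dt T (\<lambda>z. 1 / 2 * \<rho> z * (norm (u z))\<^sup>2 + P (\<rho> z)) \<phi>
    + weak_div T (\<lambda>z. (1 / 2 * \<rho> z * (norm (u z))\<^sup>2 + p (\<rho> z) + P (\<rho> z)) *\<^sub>R u z) \<phi> = 0"
proof -
  obtain \<delta> where \<delta>: "0 < \<delta>" "\<delta> \<le> T / 8"
    and \<phi>_facts: "\<And>v. has_dir_deriv \<phi> (\<lambda>z. frechet_derivative \<phi> (at z) v) v"
      "continuous_on UNIV \<phi>" "\<And>v. continuous_on UNIV (\<lambda>z. frechet_derivative \<phi> (at z) v)"
      "\<And>t x i. \<phi> (t, x + axis i 1) = \<phi> (t, x)"
      "\<And>z. fst z \<notin> {2 * \<delta>..T - 2 * \<delta>} \<Longrightarrow> \<phi> z = 0"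
      "\<And>z v. fst z \<notin> {2 * \<delta>..T - 2 * \<delta>} \<Longrightarrow> frechet_derivative \<phi> (at z) v = 0"
    by (rule test_functionE[OF \<phi> T], rule that)
  define \<phi>' where "\<phi>' e z = frechet_derivative \<phi> (at z) (st_dir e)" for e and z :: "real \<times> (real ^ 'd)"
  define B :: "(real \<times> (real ^ 'd)) set" where "B = core \<delta> T"
  have B_sub: "B \<subseteq> spacetime T"
    using \<delta> by (auto simp: B_def mem_core spacetime_def mem_Times_iff)
  have core_sub: "core (2 * \<delta>) T \<subseteq> B"
    using \<delta> by (auto simp: B_def mem_core)
  have B_compact: "compact B" by (simp add: B_def core_def)
  obtain Au Mu where Au: "0 \<le> Au" "0 \<le> Mu" "continuous_on (spacetime T) u"
      "\<And>z. z \<in> spacetime T \<Longrightarrow> norm (u z) \<le> Mu"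
      "\<And>z w \<epsilon>. 0 < \<epsilon> \<Longrightarrow> z \<in> spacetime T \<Longrightarrow> w \<in> spacetime T \<Longrightarrow>
        torus_norm_sq (z - w) < \<epsilon>\<^sup>2 \<Longrightarrow> norm (u w - u z) \<le> Au * \<epsilon> powr \<alpha>"
    by (rule holder_torusD[OF u less_imp_le[OF exps(1)]], rule that)
  obtain Ar Mr where Ar: "0 \<le> Ar" "0 \<le> Mr" "continuous_on (spacetime T) \<rho>"
      "\<And>z. z \<in> spacetime T \<Longrightarrow> norm (\<rho> z) \<le> Mr"
      "\<And>z w \<epsilon>. 0 < \<epsilon> \<Longrightarrow> z \<in> spacetime T \<Longrightarrow> w \<in> spacetime T \<Longrightarrow>
        torus_norm_sq (z - w) < \<epsilon>\<^sup>2 \<Longrightarrow> norm (\<rho> w - \<rho> z) \<le> Ar * \<epsilon> powr \<beta>"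
    by (rule holder_torusD[OF \<rho> less_imp_le[OF exps(2)]], rule that)
  obtain Am Mm where Am: "0 \<le> Am" "0 \<le> Mm" "continuous_on (spacetime T) (\<lambda>z. \<rho> z *\<^sub>R u z)"
      "\<And>z. z \<in> spacetime T \<Longrightarrow> norm (\<rho> z *\<^sub>R u z) \<le> Mm"
      "\<And>z w \<epsilon>. 0 < \<epsilon> \<Longrightarrow> z \<in> spacetime T \<Longrightarrow> w \<in> spacetime T \<Longrightarrow>
        torus_norm_sq (z - w) < \<epsilon>\<^sup>2 \<Longrightarrow> norm (\<rho> w *\<^sub>R u w - \<rho> z *\<^sub>R u z) \<le> Am * \<epsilon> powr \<beta>"
    by (rule holder_torusD[OF m less_imp_le[OF exps(2)]], rule that)
  have cont_p: "continuous_on UNIV p" and cont_P: "continuous_on UNIV P"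
    by (meson DERIV_isCont continuous_at_imp_continuous_on p(1) P(1))+
  obtain M1 where M1: "0 \<le> M1" "\<And>x. x \<in> {lo..hi} \<Longrightarrow> \<bar>p x\<bar> \<le> M1"
    by (rule bounded_on_interval[OF cont_p], rule that)
  obtain M2 where M2: "0 \<le> M2" "\<And>x. x \<in> {lo..hi} \<Longrightarrow> \<bar>P x\<bar> \<le> M2"
    by (rule bounded_on_interval[OF cont_P], rule that)
  obtain M3 where M3: "0 \<le> M3" "\<And>x. x \<in> {lo..hi} \<Longrightarrow> \<bar>q x\<bar> \<le> M3"
    by (rule bounded_on_interval[OF p(2)], rule that)
  obtain M4 where M4: "0 \<le> M4" "\<And>x. x \<in> {lo..hi} \<Longrightarrow> \<bar>g x\<bar> \<le> M4"
    by (rule bounded_on_interval[OF P(2)], rule that)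
  define U where "U = 1 + Mu + Mr + Mm + M1 + M2 + M3 + M4"
  have U: "1 \<le> U" "Mu \<le> U" "Mr \<le> U" "Mm \<le> U" "M1 \<le> U" "M2 \<le> U" "M3 \<le> U" "M4 \<le> U"
    using Au(2) Ar(2) Am(2) M1(1) M2(1) M3(1) M4(1) by (auto simp: U_def)
  define A where "A = 1 + Au + Ar + Am"
  have A: "0 < A" "Au \<le> A" "Ar \<le> A" "Am \<le> A" using Au(1) Ar(1) Am(1) by (auto simp: A_def)
  obtain C where C: "\<And>z. z \<in> B \<Longrightarrow> \<bar>\<phi> z\<bar> \<le> C" "\<And>z e. z \<in> B \<Longrightarrow> \<bar>\<phi>' e z\<bar> \<le> C"
  proof -
    have cs: "continuous_on B (\<lambda>z. \<bar>\<phi> z\<bar> + (\<Sum>e\<in>UNIV. \<bar>\<phi>' e z\<bar>))"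
      unfolding \<phi>'_def
      by (intro continuous_on_add continuous_on_sum continuous_on_rabs
          continuous_on_subset[OF \<phi>_facts(2)] continuous_on_subset[OF \<phi>_facts(3)]) auto
    obtain C where C: "\<And>y. y \<in> (\<lambda>z. \<bar>\<phi> z\<bar> + (\<Sum>e\<in>UNIV. \<bar>\<phi>' e z\<bar>)) ` B \<Longrightarrow> norm y \<le> C"
      using compact_imp_bounded[OF compact_continuous_image[OF cs B_compact]] unfolding bounded_iff by blast
    have C': "\<bar>\<phi> z\<bar> + (\<Sum>e\<in>UNIV. \<bar>\<phi>' e z\<bar>) \<le> C" if "z \<in> B" for z
      using C[of "\<bar>\<phi> z\<bar> + (\<Sum>e\<in>UNIV. \<bar>\<phi>' e z\<bar>)"] that by auto
    have 1: "\<bar>\<phi>' e z\<bar> \<le> (\<Sum>e\<in>UNIV. \<bar>\<phi>' e z\<bar>)" for e z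
      by (rule member_le_sum) auto
    have 2: "0 \<le> (\<Sum>e\<in>UNIV. \<bar>\<phi>' e z\<bar>)" for z by (rule sum_nonneg) auto
    show ?thesis
    proof (rule that[of C])
      show "\<bar>\<phi> z\<bar> \<le> C" if "z \<in> B" for z using 2[of z] C'[OF that] by linarith
      show "\<bar>\<phi>' e z\<bar> \<le> C" if "z \<in> B" for e z
        using 1[of e z] C'[OF that] abs_ge_zero[of "\<phi> z"] by linarith
    qed
  qed
  obtain M0 where M0: "0 < M0" "\<And>\<epsilon> e (z :: real \<times> (real ^ 'd)). 0 < \<epsilon> \<Longrightarrow> \<bar>mollifier_deriv \<epsilon> e z\<bar> \<le> M0 / \<epsilon>"
    using mollifier_deriv_bound by blast
  define ht where "ht e z = (case e of None \<Rightarrow> 1 | Some j \<Rightarrow> u z $ j)" for e z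
  define s1 :: "'d option \<Rightarrow> real" where "s1 e = (case e of None \<Rightarrow> 0 | Some j \<Rightarrow> 1)" for e
  define F where "F e z = 1 / 2 * (\<Sum>i\<in>UNIV. (u z $ i)\<^sup>2) * (\<rho> z * ht e z) + P (\<rho> z) * ht e z
     + s1 e * (p (\<rho> z) * ht e z)" for e z
  define I where "I = integral B (\<lambda>z. \<Sum>e\<in>UNIV. \<phi>' e z * F e z)"
  have cu: "continuous_on B (\<lambda>z. u z $ i)" for i
    by (intro continuous_on_component continuous_on_subset[OF Au(3) B_sub])
  have c\<rho>: "continuous_on B \<rho>"
    by (rule continuous_on_subset[OF Ar(3) B_sub])
  have \<rho>_range: "\<rho> z \<in> {lo..hi}" if "z \<in> B" for z using range[of z] B_sub that by auto
  define k where "k = exp 2 * (2 * pi * (real CARD('d) + 1)) ^ (CARD('d) + 1) * M0"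
  define K1 where "K1 = 2 * real CARD('d option) * C * (real CARD('d) * U + U + real CARD('d) + 5 * H)"
  define K2 where "K2 = real CARD('d option) * C * ((real CARD('d) + 2) * U\<^sup>2)"
  define a where "a \<epsilon> = A * \<epsilon> powr \<alpha>" for \<epsilon>
  define b where "b \<epsilon> = A * \<epsilon> powr \<beta>" for \<epsilon>
  have bound: "\<bar>I\<bar> \<le> (K1 * (a \<epsilon> * b \<epsilon> + (k / \<epsilon>) * a \<epsilon> * a \<epsilon> * b \<epsilon> + (k / \<epsilon>) * a \<epsilon> * (b \<epsilon> powr \<theta> * b \<epsilon>))
      + K2 * (a \<epsilon> + b \<epsilon>)) * measure lborel B" if \<epsilon>: "0 < \<epsilon>" "\<epsilon> \<le> \<delta> / 2" "\<epsilon> \<le> 1 / 2" for \<epsilon>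
  proof -
    \<comment> \<open>The fields are now mollified at the scale \<open>\<epsilon>\<close>.\<close>
    interpret smoothing T \<delta> \<epsilon> M0 B
      by unfold_locales (use \<delta> \<epsilon> M0 B_def in auto)
    interpret euler_smoothing T \<delta> \<epsilon> M0 B \<rho> u p q P g lo hi H \<theta> \<phi> \<phi>'
    proof unfold_locales
      show "has_dir_deriv \<phi> (\<phi>' e) (st_dir e)" for e
        unfolding \<phi>'_def by (rule \<phi>_facts(1))
      show "continuous_on UNIV (\<phi>' e)" for e unfolding \<phi>'_def by (rule \<phi>_facts(3))
      show "\<phi>' e z = 0" if "fst z \<notin> {2 * \<delta>..T - 2 * \<delta>}" for e z
        unfolding \<phi>'_def by (rule \<phi>_facts(6)[OF that])
      show "lo \<le> \<rho> z \<and> \<rho> z \<le> hi" if "z \<in> B" for z using \<rho>_range[OF that] by simp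
    qed (fact cu c\<rho> cont_p p P H exps pressure \<phi>_facts)+
    have near: "torus_norm_sq (z - w) < \<epsilon>\<^sup>2" "w \<in> spacetime T" if "w \<in> near z" for z w
      using that B_sub by (auto simp: near_def)
    have le: "x \<le> A * \<epsilon> powr s" if "x \<le> A' * \<epsilon> powr s" "A' \<le> A" for x A' s
      using that mult_right_mono[OF that(2), of "\<epsilon> powr s"] by simp
    interpret euler_scale T \<delta> \<epsilon> M0 B \<rho> u p q P g lo hi H \<theta> \<phi> \<phi>' "a \<epsilon>" "b \<epsilon>" U U C
    proof unfold_locales
      fix z :: "real \<times> (real ^ 'd)"
      assume z: "z \<in> core (2 * \<delta>) T"
      then have zs: "z \<in> spacetime T" using core_sub B_sub by auto
      show "osc (\<lambda>w. u w $ i) z (a \<epsilon>)" for i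
        unfolding osc_def
      proof (intro conjI ballI cu)
        fix w assume w: "w \<in> near z"
        have "\<bar>u w $ i - u z $ i\<bar> \<le> norm (u w - u z)"
          using component_le_norm_cart[of "u w - u z" i] by simp
        also have "\<dots> \<le> Au * \<epsilon> powr \<alpha>" by (rule Au(5)[OF \<epsilon>(1) zs near(2)[OF w] near(1)[OF w]])
        finally show "\<bar>u w $ i - u z $ i\<bar> \<le> a \<epsilon>" unfolding a_def by (rule le[OF _ A(2)])
      qed
      show "osc (\<lambda>w. \<rho> w * euler_smoothing.hat u e w) z (b \<epsilon>)" for e
        unfolding osc_def
      proof (intro conjI ballI cont_comps)
        fix w assume w: "w \<in> near z"
        show "\<bar>\<rho> w * euler_smoothing.hat u e w - \<rho> z * euler_smoothing.hat u e z\<bar> \<le> b \<epsilon>"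
        proof (cases e)
          case None
          have "\<bar>\<rho> w - \<rho> z\<bar> \<le> Ar * \<epsilon> powr \<beta>"
            using Ar(5)[OF \<epsilon>(1) zs near(2)[OF w] near(1)[OF w]] by simp
          from le[OF this A(3)] show ?thesis using None by (simp add: hat_def b_def)
        next
          case (Some j)
          have "\<bar>\<rho> w * u w $ j - \<rho> z * u z $ j\<bar> \<le> norm (\<rho> w *\<^sub>R u w - \<rho> z *\<^sub>R u z)"
            using component_le_norm_cart[of "\<rho> w *\<^sub>R u w - \<rho> z *\<^sub>R u z" j] by simp
          also have "\<dots> \<le> Am * \<epsilon> powr \<beta>" by (rule Am(5)[OF \<epsilon>(1) zs near(2)[OF w] near(1)[OF w]])
          finally have "\<bar>\<rho> w * u w $ j - \<rho> z * u z $ j\<bar> \<le> Am * \<epsilon> powr \<beta>" .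
          from le[OF this A(4)] show ?thesis using Some by (simp add: hat_def b_def)
        qed
      qed
      \<comment> \<open>The Euler system, tested with the mollifier centred at \<open>z\<close>.\<close>
      have E: "(\<forall>i. weak_dt T (\<lambda>z. \<rho> z * u z $ i) (\<lambda>w. mollifier \<epsilon> (z - w))
             + weak_div T (\<lambda>z. (\<rho> z * u z $ i) *\<^sub>R u z) (\<lambda>w. mollifier \<epsilon> (z - w))
             + weak_dx T i (\<lambda>z. p (\<rho> z)) (\<lambda>w. mollifier \<epsilon> (z - w)) = 0) \<and>
        weak_dt T \<rho> (\<lambda>w. mollifier \<epsilon> (z - w)) + weak_div T (\<lambda>z. \<rho> z *\<^sub>R u z) (\<lambda>w. mollifier \<epsilon> (z - w)) = 0"
        using euler mollifier_test_function[OF z] unfolding isentropic_euler_def by blast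
      have dt: "weak_dt T f (\<lambda>w. mollifier \<epsilon> (z - w)) = mass * davg None f z" if "continuous_on B f" for f
        using weak_deriv_mollifier[OF z that, of None] by (simp add: weak_dt_def)
      have dx: "weak_dx T i f (\<lambda>w. mollifier \<epsilon> (z - w)) = mass * davg (Some i) f z" if "continuous_on B f" for f i
        using weak_deriv_mollifier[OF z that, of "Some i"] by (simp add: weak_dx_def)
      have cm: "continuous_on B (\<lambda>w. \<rho> w * u w $ j)" "continuous_on B (\<lambda>w. \<rho> w * u w $ i * u w $ j)" for i j
        by (intro continuous_on_mult c\<rho> cu)+
      have "mass * (\<Sum>e\<in>UNIV. davg e (\<lambda>w. \<rho> w * euler_smoothing.hat u e w) z) = 0"
        using conjunct2[OF E] unfolding weak_div_def
        by (simp add: dt[OF c\<rho>] dx[OF cm(1)] sum_option hat_def sum_distrib_left distrib_left)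
      then show "(\<Sum>e\<in>UNIV. davg e (\<lambda>w. \<rho> w * euler_smoothing.hat u e w) z) = 0"
        using mass_pos by simp
      have mm: "mass * ((\<Sum>e\<in>UNIV. davg e (\<lambda>w. (\<rho> w * euler_smoothing.hat u e w) * u w $ i) z)
          + davg (Some i) (\<lambda>w. p (\<rho> w)) z) = 0" for i
      proof -
        have "(\<lambda>z. ((\<rho> z * u z $ i) *\<^sub>R u z) $ j) = (\<lambda>z. \<rho> z * u z $ j * u z $ i)" for j
          by (simp add: mult_ac)
        then show ?thesis
          using spec[OF conjunct1[OF E], of i]
          unfolding weak_div_def dt[OF cm(1)] dx[OF cont_comps(4)]
          by (simp only: dx[OF cm(2)]) (simp add: sum_option hat_def sum_distrib_left distrib_left)
      qed
      show "(\<Sum>e\<in>UNIV. davg e (\<lambda>w. (\<rho> w * euler_smoothing.hat u e w) * u w $ i) z)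
          + davg (Some i) (\<lambda>w. p (\<rho> w)) z = 0" for i
        using iffD1[OF mult_eq_0_iff mm[of i]] mass_pos by (elim disjE) (simp, assumption)
    next
      show "0 < b \<epsilon>" using A \<epsilon> by (simp add: b_def)
      fix w :: "real \<times> (real ^ 'd)" assume w: "w \<in> B"
      then have ws: "w \<in> spacetime T" using B_sub by auto
      show "\<bar>u w $ i\<bar> \<le> U" for i
        using component_le_norm_cart[of "u w" i] Au(4)[OF ws] U(2) by linarith
      show "\<bar>g (\<rho> w)\<bar> \<le> U" using M4(2)[OF \<rho>_range[OF w]] U(8) by linarith
      show "\<bar>P (\<rho> w)\<bar> \<le> U" using M2(2)[OF \<rho>_range[OF w]] U(6) by linarith
      show "\<bar>p (\<rho> w)\<bar> \<le> U" using M1(2)[OF \<rho>_range[OF w]] U(5) by linarith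
      show "\<bar>\<rho> w * euler_smoothing.hat u e w\<bar> \<le> U" for e
      proof (cases e)
        case None
        then show ?thesis using Ar(4)[OF ws] U(3) by (simp add: hat_def)
      next
        case (Some j)
        have "\<bar>\<rho> w * u w $ j\<bar> \<le> norm (\<rho> w *\<^sub>R u w)"
          using component_le_norm_cart[of "\<rho> w *\<^sub>R u w" j] by simp
        then show ?thesis using Am(4)[OF ws] U(4) Some by (simp add: hat_def)
      qed
    next
      fix x y assume xy: "x \<in> {lo..hi}" "y \<in> {lo..hi}"
      show "\<bar>P x - P y\<bar> \<le> U * \<bar>x - y\<bar>"
        by (rule lipschitz_on_interval[OF P(1) _ xy]) (use M4(2) U(8) in force)
      show "\<bar>p x - p y\<bar> \<le> U * \<bar>x - y\<bar>"
        by (rule lipschitz_on_interval[OF p(1) _ xy]) (use M3(2) U(7) in force)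
    qed (fact C U)+
    have "I = integral B (\<lambda>z. \<Sum>e\<in>UNIV. \<phi>' e z * limit_flux e z)"
      unfolding I_def limit_flux_def F_def by (simp add: hat_def space_part_def ht_def s1_def)
    then show ?thesis
      using energy_defect_limit
      by (simp add: defect_const_def defect_def \<kappa>_def K0_def K1_def K2_def k_def mult_ac)
  qed
  have "((\<lambda>\<epsilon>. (K1 * (a \<epsilon> * b \<epsilon> + (k / \<epsilon>) * a \<epsilon> * a \<epsilon> * b \<epsilon> + (k / \<epsilon>) * a \<epsilon> * (b \<epsilon> powr \<theta> * b \<epsilon>))
      + K2 * (a \<epsilon> + b \<epsilon>)) * measure lborel B) \<longlongrightarrow> 0) (at_right 0)"
    unfolding a_def b_def by (rule defect_tendsto_0[OF A(1) exps(3,1,2,4,5)])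
  moreover have "eventually (\<lambda>\<epsilon>. \<bar>I\<bar> \<le> (K1 * (a \<epsilon> * b \<epsilon> + (k / \<epsilon>) * a \<epsilon> * a \<epsilon> * b \<epsilon>
      + (k / \<epsilon>) * a \<epsilon> * (b \<epsilon> powr \<theta> * b \<epsilon>)) + K2 * (a \<epsilon> + b \<epsilon>)) * measure lborel B) (at_right 0)"
    unfolding eventually_at_right_field
    by (rule exI[of _ "min (\<delta> / 2) (1 / 2)"]) (use \<delta> bound in auto)
  ultimately have "\<bar>I\<bar> \<le> 0"
    by (rule tendsto_lowerbound) (rule trivial_limit_at_right_real)
  then have I0: "I = 0" by simp
  have cF: "continuous_on B (F e)" for e
  proof -
    have "continuous_on B (ht e)" unfolding ht_def by (cases e) (auto intro: cu)
    moreover have "continuous_on B (\<lambda>z. P (\<rho> z))" "continuous_on B (\<lambda>z. p (\<rho> z))"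
      by (rule continuous_on_compose2[OF cont_P c\<rho>] continuous_on_compose2[OF cont_p c\<rho>]; simp)+
    ultimately show ?thesis
      unfolding F_def
      by (intro continuous_on_add continuous_on_mult continuous_on_sum continuous_on_power
          continuous_on_const cu c\<rho>)
  qed
  have cF': "continuous_on B (\<lambda>z. \<phi>' e z * F e z)" for e
    unfolding \<phi>'_def
    by (intro continuous_on_mult cF continuous_on_subset[OF \<phi>_facts(3)]) auto
  have wd: "weak_deriv T (st_dir e) (F e) \<phi> = - integral B (\<lambda>z. \<phi>' e z * F e z)" for e
  proof -
    have "(LINT w:fundamental_domain T|lborel. \<phi>' e w * F e w) = integral (core \<delta> T) (\<lambda>w. \<phi>' e w * F e w)"
    proof (rule LINT_fundamental_domain[OF \<delta>(1)])
      show "continuous_on (core \<delta> T) (\<lambda>w. \<phi>' e w * F e w)" using cF' by (simp add: B_def)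
      fix w :: "real \<times> (real ^ 'd)" assume "fst w \<notin> {\<delta>..T - \<delta>}"
      then have "fst w \<notin> {2 * \<delta>..T - 2 * \<delta>}" using \<delta> by auto
      then show "\<phi>' e w * F e w = 0" using \<phi>_facts(6) by (simp add: \<phi>'_def)
    qed
    then show ?thesis by (simp add: weak_deriv_def \<phi>'_def B_def mult.commute)
  qed
  have norm2: "(norm (u z))\<^sup>2 = (\<Sum>i\<in>UNIV. (u z $ i)\<^sup>2)" for z
    unfolding power2_norm_eq_inner inner_vec_def by (simp add: power2_eq_square)
  have E: "(\<lambda>z. 1 / 2 * \<rho> z * (norm (u z))\<^sup>2 + P (\<rho> z)) = F None"
    by (rule ext) (simp add: F_def ht_def s1_def norm2)
  have Fj: "(\<lambda>z. ((1 / 2 * \<rho> z * (norm (u z))\<^sup>2 + p (\<rho> z) + P (\<rho> z)) *\<^sub>R u z) $ j) = F (Some j)" for j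
    by (rule ext) (simp add: F_def ht_def s1_def norm2 algebra_simps)
  have "I = (\<Sum>e\<in>UNIV. integral B (\<lambda>z. \<phi>' e z * F e z))"
    unfolding I_def
    by (rule integral_sum) (auto simp: B_def core_def intro!: integrable_continuous cF'[unfolded B_def core_def])
  then have "(\<Sum>e\<in>UNIV. weak_deriv T (st_dir e) (F e) \<phi>) = 0"
    using I0 by (simp add: wd sum_negf)
  then show ?thesis
    unfolding weak_div_def weak_dt_def weak_dx_def E Fj sum_option by simp
qed

theorem corollary4p4:
  fixes T \<gamma> \<alpha> \<beta> lo hi :: real
    and p :: "real \<Rightarrow> real"
    and \<rho> :: "real \<times> (real ^ 'd) \<Rightarrow> real"
    and u :: "real \<times> (real ^ 'd) \<Rightarrow> real ^ 'd"
  assumes "0 < T"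
    and "1 < \<gamma>" "\<gamma> < 2"
    and "isentropic_euler T p \<rho> u"
    and "0 \<le> \<alpha>" "\<alpha> \<le> 1" "0 \<le> \<beta>" "\<beta> \<le> 1"
    and "u \<in> holder_torus \<alpha> T"
    and "\<rho> \<in> holder_torus \<beta> T"
    and "(\<lambda>z. \<rho> z *\<^sub>R u z) \<in> holder_torus \<beta> T"
    and "0 \<le> lo"
    and "AE z in lborel. z \<in> spacetime T \<longrightarrow> lo \<le> \<rho> z \<and> \<rho> z \<le> hi"
    and "\<alpha> + \<gamma> * \<beta> > 1"
    and "2 * \<alpha> + \<beta> > 1"
    and "C1_holder_on {lo..hi} (\<gamma> - 1) p"
    and "lo = 0 \<Longrightarrow> (p has_real_derivative 0) (at_right 0)"
    and "potential_well_defined p lo hi"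
  shows "energy_locally_conserved T p \<rho> u"
proof -
  define \<theta> where "\<theta> = \<gamma> - 1"
  have \<theta>: "0 < \<theta>" "\<theta> \<le> 1" "1 + \<theta> = \<gamma>" using assms(2,3) by (auto simp: \<theta>_def)
  have "0 < \<alpha>" using assms(8,15) by linarith
  moreover have "0 < \<beta>"
  proof (rule ccontr)
    assume "\<not> 0 < \<beta>"
    then have "\<beta> = 0" using assms(7) by linarith
    then show False using assms(6,14) by simp
  qed
  ultimately have exps: "0 < \<alpha>" "0 < \<beta>" "0 < \<theta>" "\<alpha> + (1 + \<theta>) * \<beta> > 1" "2 * \<alpha> + \<beta> > 1"
    using assms(14,15) \<theta> by auto
  have op: "open (spacetime T :: (real \<times> (real ^ 'd)) set)"
    unfolding spacetime_def by (intro open_Times) auto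
  have c\<rho>: "continuous_on (spacetime T) \<rho>"
    using assms(10) by (simp add: holder_torus_def holder_on_def)
  have range: "lo \<le> \<rho> z \<and> \<rho> z \<le> hi" if "z \<in> spacetime T" for z
    by (rule AE_bounds_imp_bounds[OF op c\<rho> assms(13) that])
  have "(T / 2, 0) \<in> (spacetime T :: (real \<times> (real ^ 'd)) set)"
    using assms(1) by (simp add: spacetime_def)
  from range[OF this] have lohi: "lo \<le> hi" by linarith
  obtain p' where p': "\<And>x. x \<in> {lo..hi} \<Longrightarrow> (p has_real_derivative p' x) (at x within {lo..hi})"
    and h: "holder_on {lo..hi} \<theta> p'"
    using assms(16) unfolding C1_holder_on_def \<theta>_def by blast
  obtain H0 where H0: "\<And>x y. x \<in> {lo..hi} \<Longrightarrow> y \<in> {lo..hi} \<Longrightarrow> \<bar>p' x - p' y\<bar> \<le> H0 * \<bar>x - y\<bar> powr \<theta>"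
    using h unfolding holder_on_def dist_real_def by blast
  define H where "H = \<bar>H0\<bar>"
  have H: "\<bar>p' x - p' y\<bar> \<le> H * \<bar>x - y\<bar> powr \<theta>" if "x \<in> {lo..hi}" "y \<in> {lo..hi}" for x y
    by (rule order_trans[OF H0[OF that]]) (intro mult_right_mono, auto simp: H_def)
  have H_nonneg: "0 \<le> H" by (simp add: H_def)
  obtain g0 K where K: "0 \<le> K"
    and g0: "\<And>x. x \<in> {lo..hi} \<Longrightarrow> (pressure_potential p has_real_derivative g0 x) (at x within {lo..hi})"
      "\<And>x y. x \<in> {lo..hi} \<Longrightarrow> y \<in> {lo..hi} \<Longrightarrow> \<bar>g0 x - g0 y\<bar> \<le> K * \<bar>x - y\<bar> powr \<theta>"
      "\<And>x. x \<in> {lo..hi} \<Longrightarrow> x * g0 x - pressure_potential p x = p x"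
    by (rule potential_C1_holder[OF \<theta>(1,2) assms(12) lohi p' H H_nonneg assms(17,18)], assumption+, rule that)
  obtain P g where P: "\<And>x. x \<in> {lo..hi} \<Longrightarrow> P x = pressure_potential p x" "\<And>x. x \<in> {lo..hi} \<Longrightarrow> g x = g0 x"
    "\<And>x. (P has_real_derivative g x) (at x)" "continuous_on UNIV g"
    "\<And>x y. \<bar>g x - g y\<bar> \<le> K * \<bar>x - y\<bar> powr \<theta>"
    by (rule C1_holder_extension[OF lohi g0(1,2) K \<theta>(1)], assumption+, rule that)
  obtain p1 q where p1: "\<And>x. x \<in> {lo..hi} \<Longrightarrow> p1 x = p x"
    "\<And>x. (p1 has_real_derivative q x) (at x)" "continuous_on UNIV q"
    "\<And>x y. \<bar>p1 x - p1 y - q y * (x - y)\<bar> \<le> H * \<bar>x - y\<bar> powr (1 + \<theta>)"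
    by (rule C1_holder_extension[OF lohi p' H H_nonneg \<theta>(1)], assumption+, rule that)
  have eqs: "p1 (\<rho> z) = p (\<rho> z)" "P (\<rho> z) = pressure_potential p (\<rho> z)"
    if "z \<in> fundamental_domain T" for z
    using range[OF subsetD[OF fundamental_domain_subset that]] by (auto intro!: p1(1) P(1))
  have euler: "isentropic_euler T p1 \<rho> u"
  proof -
    have "weak_dx T i (\<lambda>z. p1 (\<rho> z)) \<phi> = weak_dx T i (\<lambda>z. p (\<rho> z)) \<phi>" for i \<phi>
      unfolding weak_dx_def by (rule weak_deriv_cong) (simp add: eqs)
    then show ?thesis using assms(4) by (simp add: isentropic_euler_def)
  qed
  show ?thesis
    unfolding energy_locally_conserved_def
  proof
    fix \<phi> :: "real \<times> (real ^ 'd) \<Rightarrow> real" assume \<phi>: "\<phi> \<in> test_functions T"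
    have "weak_dt T (\<lambda>z. 1 / 2 * \<rho> z * (norm (u z))\<^sup>2 + P (\<rho> z)) \<phi>
      + weak_div T (\<lambda>z. (1 / 2 * \<rho> z * (norm (u z))\<^sup>2 + p1 (\<rho> z) + P (\<rho> z)) *\<^sub>R u z) \<phi> = 0"
    proof (rule energy_balance[OF assms(1) euler exps assms(9,10,11) range p1(2,3) _ P(3,4) _ _ _ \<phi>, where H="max H K"])
      show "\<bar>p1 x - p1 y - q y * (x - y)\<bar> \<le> max H K * \<bar>x - y\<bar> powr (1 + \<theta>)" for x y
        by (rule order_trans[OF p1(4)]) (intro mult_right_mono, auto)
      show "\<bar>g x - g y\<bar> \<le> max H K * \<bar>x - y\<bar> powr \<theta>" for x y
        by (rule order_trans[OF P(5)]) (intro mult_right_mono, auto)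
      show "0 \<le> max H K" using K by simp
      show "r * g r - P r = p1 r" if "lo \<le> r" "r \<le> hi" for r
        using g0(3)[of r] that by (simp add: P(1,2) p1(1))
    qed
    moreover have "weak_dt T (\<lambda>z. 1 / 2 * \<rho> z * (norm (u z))\<^sup>2 + P (\<rho> z)) \<phi>
        = weak_dt T (\<lambda>z. 1 / 2 * \<rho> z * (norm (u z))\<^sup>2 + pressure_potential p (\<rho> z)) \<phi>"
      unfolding weak_dt_def by (rule weak_deriv_cong) (simp add: eqs)
    moreover have "weak_div T (\<lambda>z. (1 / 2 * \<rho> z * (norm (u z))\<^sup>2 + p1 (\<rho> z) + P (\<rho> z)) *\<^sub>R u z) \<phi>
        = weak_div T (\<lambda>z. (1 / 2 * \<rho> z * (norm (u z))\<^sup>2 + p (\<rho> z) + pressure_potential p (\<rho> z)) *\<^sub>R u z) \<phi>"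
      unfolding weak_div_def weak_dx_def by (intro sum.cong refl weak_deriv_cong) (simp add: eqs)
    ultimately show "weak_dt T (\<lambda>z. 1 / 2 * \<rho> z * (norm (u z))\<^sup>2 + pressure_potential p (\<rho> z)) \<phi>
        + weak_div T (\<lambda>z. (1 / 2 * \<rho> z * (norm (u z))\<^sup>2 + p (\<rho> z) + pressure_potential p (\<rho> z)) *\<^sub>R u z) \<phi> = 0"
      by simp
  qed
qed

end
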